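(* Assume the setting and assumptions (R1), (R2) of the context. Suppose that there exist constants $\lambda_1,\lambda_2>0$ and an integer $k_0$ such that for every $l\geq 0$, all $\eta,\mu\in\mathcal{P}(S^{(l)})^{\mathbb{N}}$ and all $k\geq k_0$, $$\left\|\overline{\Phi}^{(l+k,l+1)}(\eta)-\overline{\Phi}^{(l+k,l+1)}(\mu)\right\|\leq\lambda_1e^{-\lambda_2k},$$ and that $$A:=\sup_{k\geq 0}\left[(1+c_k)\left(\frac{n_k}{1-b_k(n_k)}\right)^2\right]<\infty\quad\text{and}\quad B:=2\sup_{k\geq 1}\Lambda_k<\infty .$$ Then for every $r\ge1$ there is a finite constant $e(r)$, whose value depends only on $r$, such that the following hold. If $B=1$, then for any $n$ such that $(n+1)\geq e^{2\lambda_2(k_0+1)}$ and any $(f_l)_{l\geq0}\in\prod_{l\geq0}\mathrm{Osc}_1(S^{(l)})$, $$\sup_{l\geq0}\mathbb{E}\left(\left|\left[\eta^{(l)}_n-\pi^{(l)}\right](f_l)\right|^r\right)^{1/r}\leq\frac{e(r)}{\sqrt{n+1}}\left(A\left(1+\frac{\log(n+1)}{2\lambda_2}\right)+\lambda_1e^{\lambda_2}\right).$$ If $B>1$, then for any $n$ such that $(n+1)\geq e^{2(\lambda_2+\log B)(k_0+1)}$ and any $(f_l)_{l\geq0}\in\prod_{l\geq0}\mathrm{Osc}_1(S^{(l)})$, $$\sup_{l\geq0}\mathbb{E}\left(\left|\left[\eta^{(l)}_n-\pi^{(l)}\right](f_l)\right|^r\right)^{1/r}\leq e(r)\left[\frac{AB}{B-1}+\lambda_1\right]\frac{e^{\lambda_2}}{(n+1)^{\alpha/2}},\qquad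 \alpha:=\frac{\lambda_2}{\lambda_2+\log B}.$$
   Context: Notation. For a measurable space $S$: $\mathcal{P}(S)$ is the set of probability measures on $S$; $\mathcal{B}(S)$ the bounded measurable real functions with the sup norm $\|\cdot\|$; $\mathcal{B}_1(S)$ its unit ball; $\mathrm{osc}(f)=\sup_{x,y}|f(x)-f(y)|$; $\mathrm{Osc}_1(S)$ the measurable functions with $\mathrm{osc}(f)\le 1$. $\mu(f)=\int f\,d\mu$, and for a finite signed measure $\|\mu\|=\sup_{f\in\mathcal{B}_1(S)}|\mu(f)|$. For a bounded integral operator $M$, $M(f)(x)=\int M(x,dy)f(y)$, $(\mu M)(f)=\mu(M(f))$, $\|M\|=\sup_{f\in\mathcal{B}_1}\|M(f)\|$, and if $M$ is Markov, $\beta(M)=\sup\{\mathrm{osc}(M(f)):f\in\mathrm{Osc}_1\}$. Setting (interacting MCMC). $(S^{(l)})_{l\ge0}$ are measurable spaces, $\pi^{(0)}\in\mathcal{P}(S^{(0)})$, $\Phi_l:\mathcal{P}(S^{(l-1)})\to\mathcal{P}(S^{(l)})$ for $l\ge1$, and $\pi^{(l)}=\Phi_l(\pi^{(l-1)})$. $M^{(0)}$ is a Markov transition on $S^{(0)}$ with $\pi^{(0)}M^{(0)}=\pi^{(0)}$; for $l\ge1$ and $\mu\in\mathcal{P}(S^{(l-1)})$, $M^{(l)}_\mu$ is a Markov transition on $S^{(l)}$ with $\Phi_l(\mu)M^{(l)}_\mu=\Phi_l(\mu)$. Convention: $M^{(0)}_\mu=M^{(0)}$. Let $\nu_k\in\mathcal{P}(S^{(k)})$,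 $k\ge0$, be given. $X^{(0)}=(X^{(0)}_n)_{n\ge0}$ is a Markov chain with initial law $\nu_0$ and transition $M^{(0)}$. For $k\ge1$, given $X^{(k-1)}$, $X^{(k)}=(X^{(k)}_n)_{n\geq 0}$ is a Markov chain with initial law $\nu_k$ and $$\mathbb{P}(X^{(k)}_{n+1}\in dx\mid X^{(k-1)},X^{(k)}_n)=M^{(k)}_{\eta^{(k-1)}_n}(X^{(k)}_n,dx),\qquad \eta^{(k)}_n=\frac1{n+1}\sum_{p=0}^n\delta_{X^{(k)}_p}.$$ Standing regularity assumptions. (R1) For each $l\ge1$ there is a kernel $\Gamma_l$ from $\mathcal{B}(S^{(l)})$ into $\mathcal{B}(S^{(l-1)})$ and $\Lambda_l<\infty$ such that for all $f\in\mathcal{B}(S^{(l)})$, $\mu,\nu\in\mathcal{P}(S^{(l-1)})$: $|[\Phi_l(\mu)-\Phi_l(\nu)](f)|\le\int|[\mu-\nu](g)|\,\Gamma_l(f,dg)$ and $\int\Gamma_l(f,dg)\|g\|\le\Lambda_l\|f\|$. (R2) For each $l\ge0$ there are an integer $n_l\ge0$ and a finite constant $c_l$ with $\|M^{(l)}_\mu-M^{(l)}_\nu\|\le c_l\|\mu-\nu\|$ for all $\mu,\nu\in\mathcal{P}(S^{(l-1)})$, and $b_l(n_l):=\sup_{\mu}\beta((M^{(l)}_\mu)^{n_l})<1$ (for $l=0$, $M^{(0)}_\mu=M^{(0)}$). Time averaged semigroup. For $l\ge1$ and $\eta=(\eta_n)_{n\ge0}\in\mathcal{P}(S^{(l-1)})^{\mathbb{N}}$,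 $\overline{\Phi}^{(l)}(\eta)=(\overline\Phi^{(l)}_n(\eta))_{n\ge0}\in\mathcal{P}(S^{(l)})^{\mathbb{N}}$ with $\overline\Phi^{(l)}_n(\eta)=\frac1{n+1}\sum_{p=0}^n\Phi_l(\eta_p)$; $\overline{\Phi}^{(k,l)}=\overline\Phi^{(k)}\circ\overline\Phi^{(k-1)}\circ\cdots\circ\overline\Phi^{(l)}$ for $l\le k$, and $\overline\Phi^{(k,l)}=\mathrm{Id}$ for $l>k$. Distribution flows carry the distance $\|\eta-\mu\|=\sup_{n\ge0}\|\eta_n-\mu_n\|$.
   Formalization: Added: each Γ_l(f,·) is carried by a set of functions g on which (g,x)↦g(x) is jointly measurable (false otherwise); M_μ(x,·) is jointly measurable in (μ,x); c_l≥0. The constant e(r) is stated for spaces inside a fixed universe set; one e(r) for all follows by disjoint unions. *)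

theory Defs
  imports "HOL-Probability.Probability"
begin

section \<open>Bounded functions, oscillations, norms\<close>

text \<open>
  Functions on a measurable space \<open>S\<close> are total functions on the underlying type; all quantities below
  only see their values on \<open>space S\<close>. The suprema are real-valued and are only used where
  the family is nonempty and bounded. The class \<open>Osc1\<close> is carved out of the bounded functions so that
  the supremum in \<open>osc\<close> is a true one; a function of finite oscillation is bounded anyway.
\<close>

abbreviation Prob :: "'a measure \<Rightarrow> 'a measure set" where
  "Prob S \<equiv> space (prob_algebra S)"

definition sup_norm :: "'a measure \<Rightarrow> ('a \<Rightarrow> real) \<Rightarrow> real" where
  "sup_norm S f = (SUP x\<in>space S. \<bar>f x\<bar>)"

definition Bdd :: "'a measure \<Rightarrow> ('a \<Rightarrow> real) set" where
  "Bdd S = {f \<in> borel_measurable S. bounded (f ` space S)}"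

definition Bdd1 :: "'a measure \<Rightarrow> ('a \<Rightarrow> real) set" where
  "Bdd1 S = {f \<in> Bdd S. sup_norm S f \<le> 1}"

definition osc :: "'a measure \<Rightarrow> ('a \<Rightarrow> real) \<Rightarrow> real" where
  "osc S f = (SUP (x, y)\<in>space S \<times> space S. \<bar>f x - f y\<bar>)"

definition Osc1 :: "'a measure \<Rightarrow> ('a \<Rightarrow> real) set" where
  "Osc1 S = {f \<in> Bdd S. osc S f \<le> 1}"

definition tv_dist :: "'a measure \<Rightarrow> 'a measure \<Rightarrow> 'a measure \<Rightarrow> real" where
  "tv_dist S \<mu> \<nu> = (SUP f\<in>Bdd1 S. \<bar>(\<integral>x. f x \<partial>\<mu>) - (\<integral>x. f x \<partial>\<nu>)\<bar>)"

definition flow_dist :: "'a measure \<Rightarrow> (nat \<Rightarrow> 'a measure) \<Rightarrow> (nat \<Rightarrow> 'a measure) \<Rightarrow> real" where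
  "flow_dist S \<eta> \<mu> = (SUP n. tv_dist S (\<eta> n) (\<mu> n))"

definition kernel_op :: "('a \<Rightarrow> 'a measure) \<Rightarrow> ('a \<Rightarrow> real) \<Rightarrow> ('a \<Rightarrow> real)" where
  "kernel_op K f = (\<lambda>x. \<integral>y. f y \<partial>K x)"

definition op_norm :: "'a measure \<Rightarrow> (('a \<Rightarrow> real) \<Rightarrow> ('a \<Rightarrow> real)) \<Rightarrow> real" where
  "op_norm S T = (SUP f\<in>Bdd1 S. sup_norm S (T f))"

definition dobrushin :: "'a measure \<Rightarrow> (('a \<Rightarrow> real) \<Rightarrow> ('a \<Rightarrow> real)) \<Rightarrow> real" where
  "dobrushin S T = (SUP f\<in>Osc1 S. osc S (T f))"

section \<open>Averages of measures, empirical measures, time averaged semigroup\<close>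

definition avg_measure :: "'a measure \<Rightarrow> nat \<Rightarrow> (nat \<Rightarrow> 'a measure) \<Rightarrow> 'a measure" where
  "avg_measure S n \<mu> =
     measure_of (space S) (sets S) (\<lambda>A. (\<Sum>p\<le>n. emeasure (\<mu> p) A) / of_nat (n + 1))"

definition empirical :: "'a measure \<Rightarrow> (nat \<Rightarrow> 'a) \<Rightarrow> nat \<Rightarrow> 'a measure" where
  "empirical S x n = avg_measure S n (\<lambda>p. return S (x p))"

definition Phi_bar ::
    "(nat \<Rightarrow> 'a measure) \<Rightarrow> (nat \<Rightarrow> 'a measure \<Rightarrow> 'a measure) \<Rightarrow> nat
      \<Rightarrow> (nat \<Rightarrow> 'a measure) \<Rightarrow> (nat \<Rightarrow> 'a measure)" where
  "Phi_bar S \<Phi> l \<eta> = (\<lambda>n. avg_measure (S l) n (\<lambda>p. \<Phi> l (\<eta> p)))"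

text \<open>\<open>Phi_bar_comp S \<Phi> k l\<close> applies level \<open>l\<close> first and level \<open>k\<close> last; it is the identity for \<open>l > k\<close>.\<close>

definition Phi_bar_comp ::
    "(nat \<Rightarrow> 'a measure) \<Rightarrow> (nat \<Rightarrow> 'a measure \<Rightarrow> 'a measure) \<Rightarrow> nat \<Rightarrow> nat
      \<Rightarrow> (nat \<Rightarrow> 'a measure) \<Rightarrow> (nat \<Rightarrow> 'a measure)" where
  "Phi_bar_comp S \<Phi> k l = fold (Phi_bar S \<Phi>) [l..<Suc k]"

lemma sets_avg_measure [simp]: "sets (avg_measure S n \<mu>) = sets S"
  by (simp add: avg_measure_def sets.sigma_sets_eq)

lemma space_avg_measure [simp]: "space (avg_measure S n \<mu>) = space S"
  by (simp add: avg_measure_def sets.space_closed)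

lemma emeasure_avg_measure:
  assumes "\<And>p. p \<le> n \<Longrightarrow> sets (\<mu> p) = sets S" and "A \<in> sets S"
  shows "emeasure (avg_measure S n \<mu>) A = (\<Sum>p\<le>n. emeasure (\<mu> p) A) / of_nat (n + 1)"
proof (rule emeasure_measure_of[OF avg_measure_def])
  show "positive (sets (avg_measure S n \<mu>)) (\<lambda>A. (\<Sum>p\<le>n. emeasure (\<mu> p) A) / of_nat (n + 1))"
    by (simp add: positive_def)
  show "countably_additive (sets (avg_measure S n \<mu>))
          (\<lambda>A. (\<Sum>p\<le>n. emeasure (\<mu> p) A) / of_nat (n + 1))"
  proof (rule countably_additiveI)
    fix B :: "nat \<Rightarrow> 'a set"
    assume B: "range B \<subseteq> sets (avg_measure S n \<mu>)" "disjoint_family B"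
    have "(\<Sum>i. emeasure (\<mu> p) (B i)) = emeasure (\<mu> p) (\<Union>i. B i)" if "p \<le> n" for p
      using B assms(1)[OF that] by (intro suminf_emeasure) auto
    then have "(\<Sum>i. \<Sum>p\<le>n. emeasure (\<mu> p) (B i)) = (\<Sum>p\<le>n. emeasure (\<mu> p) (\<Union>i. B i))"
      by (subst suminf_sum) auto
    then show "(\<Sum>i. (\<Sum>p\<le>n. emeasure (\<mu> p) (B i)) / of_nat (n + 1)) =
        (\<Sum>p\<le>n. emeasure (\<mu> p) (\<Union>i. B i)) / of_nat (n + 1)"
      by simp
  qed
qed (use assms in \<open>auto dest: sets.sets_into_space\<close>)

lemma avg_measure_in_Prob:
  assumes "\<And>p. p \<le> n \<Longrightarrow> \<mu> p \<in> Prob S"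
  shows "avg_measure S n \<mu> \<in> Prob S"
proof -
  have s: "sets (\<mu> p) = sets S" "prob_space (\<mu> p)" if "p \<le> n" for p
    using assms[OF that] by (auto simp: space_prob_algebra)
  have 1: "emeasure (\<mu> p) (space S) = 1" if "p \<le> n" for p
    using prob_space.emeasure_space_1[OF s(2)[OF that]] sets_eq_imp_space_eq[OF s(1)[OF that]] by simp
  have "emeasure (avg_measure S n \<mu>) (space S) = (\<Sum>p\<le>n. 1) / of_nat (n + 1)"
    using 1 s(1) by (subst emeasure_avg_measure) auto
  also have "\<dots> = 1"
    by (simp add: ennreal_divide_self ennreal_add_eq_top of_nat_less_top less_top[symmetric])
  finally show ?thesis
    by (auto simp: space_prob_algebra intro!: prob_spaceI)
qed

section \<open>Markov chains in a random environment\<close>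

text \<open>
  The events \<open>{Y n \<in> A}\<close>, \<open>n \<in> N\<close>; they generate the \<open>\<sigma>\<close>-algebra of \<open>(Y n)\<close>, \<open>n \<in> N\<close>.
\<close>

definition events_of :: "'w measure \<Rightarrow> 'a measure \<Rightarrow> (nat \<Rightarrow> 'w \<Rightarrow> 'a) \<Rightarrow> nat set \<Rightarrow> 'w set set" where
  "events_of \<Omega> S Y N = {Y n -` A \<inter> space \<Omega> | n A. n \<in> N \<and> A \<in> sets S}"

text \<open>
  Given the environment (the \<open>\<sigma>\<close>-algebra generated by \<open>E\<close>), \<open>Y\<close> is a Markov chain with initial law
  \<open>\<nu>\<close> and with transition \<open>K n \<omega>\<close> from time \<open>n\<close> to time \<open>n + 1\<close>, where \<open>K n\<close> may depend
  on the environment.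
\<close>

definition markov_chain_given ::
    "'w measure \<Rightarrow> 'w set set \<Rightarrow> 'a measure \<Rightarrow> 'a measure
      \<Rightarrow> (nat \<Rightarrow> 'w \<Rightarrow> 'a \<Rightarrow> 'a measure) \<Rightarrow> (nat \<Rightarrow> 'w \<Rightarrow> 'a) \<Rightarrow> bool" where
  "markov_chain_given \<Omega> E S \<nu> K Y \<longleftrightarrow>
     (\<forall>n. Y n \<in> measurable \<Omega> S) \<and>
     (\<forall>A\<in>sets S. AE \<omega> in \<Omega>.
        real_cond_exp \<Omega> (sigma (space \<Omega>) E) (indicator (Y 0 -` A \<inter> space \<Omega>)) \<omega> = measure \<nu> A) \<and>
     (\<forall>n. \<forall>A\<in>sets S. AE \<omega> in \<Omega>.
        real_cond_exp \<Omega> (sigma (space \<Omega>) (E \<union> events_of \<Omega> S Y {..n}))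
          (indicator (Y (Suc n) -` A \<inter> space \<Omega>)) \<omega> = measure (K n \<omega> (Y n \<omega>)) A)"

section \<open>Interacting Markov chain Monte Carlo\<close>

text \<open>
  The measurable spaces \<open>S l\<close> live on one type, which is no restriction since
  countably many sets embed in their disjoint union.

  Assumption \<open>M_kernel\<close> says that \<open>M l \<mu> x\<close> is measurable in \<open>(\<mu>, x)\<close>, where the set of probability
  measures carries the \<open>\<sigma>\<close>-algebra generated by the evaluations; it contains that each \<open>M l \<mu>\<close> is a Markov
  transition, and it makes the randomly indexed transitions of the chains well defined.

  \<open>M 0 \<mu>\<close> does not depend on \<open>\<mu>\<close>. Wherever a condition for level \<open>l \<ge> 0\<close> has an index in
  \<open>Prob (S (l - 1))\<close>, natural subtraction makes this \<open>Prob (S 0)\<close> for \<open>l = 0\<close>, a mere dummy.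
\<close>

locale interacting_mcmc = prob_space \<Omega> for \<Omega> :: "'w measure" +
  fixes S :: "nat \<Rightarrow> 'a measure"
    and \<pi> :: "nat \<Rightarrow> 'a measure"
    and \<Phi> :: "nat \<Rightarrow> 'a measure \<Rightarrow> 'a measure"
    and M0 :: "'a \<Rightarrow> 'a measure"
    and M :: "nat \<Rightarrow> 'a measure \<Rightarrow> 'a \<Rightarrow> 'a measure"
    and \<nu> :: "nat \<Rightarrow> 'a measure"
    and X :: "nat \<Rightarrow> nat \<Rightarrow> 'w \<Rightarrow> 'a"
  assumes pi_0: "\<pi> 0 \<in> Prob (S 0)"
    and Phi_Prob: "\<And>l \<mu>. \<mu> \<in> Prob (S l) \<Longrightarrow> \<Phi> (Suc l) \<mu> \<in> Prob (S (Suc l))"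
    and pi_Suc: "\<And>l. \<pi> (Suc l) = \<Phi> (Suc l) (\<pi> l)"
    and M0_kernel: "M0 \<in> measurable (S 0) (prob_algebra (S 0))"
    and M0_invariant: "\<pi> 0 \<bind> M0 = \<pi> 0"
    and M_0: "\<And>\<mu>. M 0 \<mu> = M0"
    and M_kernel: "\<And>l. (\<lambda>(\<mu>, x). M (Suc l) \<mu> x)
          \<in> measurable (prob_algebra (S l) \<Otimes>\<^sub>M S (Suc l)) (prob_algebra (S (Suc l)))"
    and M_invariant: "\<And>l \<mu>. \<mu> \<in> Prob (S l) \<Longrightarrow> \<Phi> (Suc l) \<mu> \<bind> M (Suc l) \<mu> = \<Phi> (Suc l) \<mu>"
    and nu_Prob: "\<And>k. \<nu> k \<in> Prob (S k)"
    and chain_0: "markov_chain_given \<Omega> {} (S 0) (\<nu> 0) (\<lambda>n \<omega>. M0) (X 0)"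
    and chain_Suc: "\<And>k. markov_chain_given \<Omega> (events_of \<Omega> (S k) (X k) UNIV) (S (Suc k)) (\<nu> (Suc k))
          (\<lambda>n \<omega>. M (Suc k) (empirical (S k) (\<lambda>p. X k p \<omega>) n)) (X (Suc k))"

text \<open>\<open>b_coeff S M l m\<close> is \<open>b\<^sub>l(m)\<close>, the supremum over \<open>\<mu>\<close> of the contraction coefficient of the \<open>m\<close>-th power of \<open>M l \<mu>\<close>.\<close>

definition b_coeff ::
    "(nat \<Rightarrow> 'a measure) \<Rightarrow> (nat \<Rightarrow> 'a measure \<Rightarrow> 'a \<Rightarrow> 'a measure) \<Rightarrow> nat \<Rightarrow> nat \<Rightarrow> real" where
  "b_coeff S M l m = (SUP \<mu>\<in>Prob (S (l - 1)). dobrushin (S l) (kernel_op (M l \<mu>) ^^ m))"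

text \<open>
  A kernel from \<open>(Bdd S, G)\<close> into \<open>(Bdd S', G')\<close> for arbitrary \<open>\<sigma>\<close>-algebras for which
  the norm is measurable. Each \<open>\<Gamma> f\<close> is concentrated on a measurable set \<open>D\<close> of functions on which the
  evaluation \<open>(g, x) \<mapsto> g x\<close> is jointly measurable, so that integrals over \<open>g\<close> and over random points
  \<open>x\<close> may be interchanged. This cannot be asked for on the whole function space: if \<open>S'\<close> is an uncountable
  standard Borel space, no \<open>\<sigma>\<close>-algebra on \<open>Bdd S'\<close> makes the evaluation jointly measurable (Aumann).
  It does hold for discrete \<open>\<Gamma> f\<close>, and for \<open>\<Gamma> f\<close> a Borel measure with separable support in the
  sup norm. Without it the regularity condition below would be compatible, under the continuum
  hypothesis, with maps \<open>\<Phi>\<close> that depend only on the total mass of the atoms of their argument; such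
  a map does not see the convergence of empirical measures to a diffuse limit.
\<close>

definition function_kernel ::
    "'a measure \<Rightarrow> ('a \<Rightarrow> real) measure \<Rightarrow> 'a measure \<Rightarrow> ('a \<Rightarrow> real) measure
      \<Rightarrow> (('a \<Rightarrow> real) \<Rightarrow> ('a \<Rightarrow> real) measure) \<Rightarrow> bool" where
  "function_kernel S G S' G' \<Gamma> \<longleftrightarrow>
     space G = Bdd S \<and> sup_norm S \<in> borel_measurable G \<and>
     space G' = Bdd S' \<and> sup_norm S' \<in> borel_measurable G' \<and>
     (\<forall>f\<in>Bdd S. sets (\<Gamma> f) = sets G') \<and>
     (\<forall>A\<in>sets G'. (\<lambda>f. emeasure (\<Gamma> f) A) \<in> borel_measurable G) \<and>
     (\<forall>f\<in>Bdd S. \<exists>D\<in>sets G'. emeasure (\<Gamma> f) (space G' - D) = 0 \<and>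
        (\<lambda>(g, x). g x) \<in> borel_measurable (restrict_space G' D \<Otimes>\<^sub>M S'))"

locale regular_interacting_mcmc = interacting_mcmc \<Omega> S \<pi> \<Phi> M0 M \<nu> X
  for \<Omega> :: "'w measure" and S :: "nat \<Rightarrow> 'a measure" and \<pi> \<Phi> M0 M \<nu> X +
  fixes G :: "nat \<Rightarrow> ('a \<Rightarrow> real) measure"
    and \<Gamma> :: "nat \<Rightarrow> ('a \<Rightarrow> real) \<Rightarrow> ('a \<Rightarrow> real) measure"
    and \<Lambda> :: "nat \<Rightarrow> real"
    and nn :: "nat \<Rightarrow> nat"
    and c :: "nat \<Rightarrow> real"
  assumes R1_kernel: "\<And>l. function_kernel (S (Suc l)) (G (Suc l)) (S l) (G l) (\<Gamma> (Suc l))"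
    and R1_Lipschitz: "\<And>l f \<mu> \<mu>'. f \<in> Bdd (S (Suc l)) \<Longrightarrow> \<mu> \<in> Prob (S l) \<Longrightarrow> \<mu>' \<in> Prob (S l) \<Longrightarrow>
          ennreal \<bar>(\<integral>x. f x \<partial>\<Phi> (Suc l) \<mu>) - (\<integral>x. f x \<partial>\<Phi> (Suc l) \<mu>')\<bar>
            \<le> (\<integral>\<^sup>+g. ennreal \<bar>(\<integral>x. g x \<partial>\<mu>) - (\<integral>x. g x \<partial>\<mu>')\<bar> \<partial>\<Gamma> (Suc l) f)"
    and Lambda_nonneg: "\<And>l. 0 \<le> \<Lambda> (Suc l)"
    and R1_bound: "\<And>l f. f \<in> Bdd (S (Suc l)) \<Longrightarrow>
          (\<integral>\<^sup>+g. ennreal (sup_norm (S l) g) \<partial>\<Gamma> (Suc l) f) \<le> ennreal (\<Lambda> (Suc l) * sup_norm (S (Suc l)) f)"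
    and c_nonneg: "\<And>l. 0 \<le> c l"
    and R2_Lipschitz: "\<And>l \<mu> \<mu>'. \<mu> \<in> Prob (S (l - 1)) \<Longrightarrow> \<mu>' \<in> Prob (S (l - 1)) \<Longrightarrow>
          op_norm (S l) (\<lambda>f x. kernel_op (M l \<mu>) f x - kernel_op (M l \<mu>') f x)
            \<le> c l * tv_dist (S (l - 1)) \<mu> \<mu>'"
    and R2_contraction: "\<And>l. b_coeff S M l (nn l) < 1"

definition Lr_norm :: "'w measure \<Rightarrow> real \<Rightarrow> ('w \<Rightarrow> real) \<Rightarrow> real" where
  "Lr_norm \<Omega> r Z = (\<integral>\<omega>. \<bar>Z \<omega>\<bar> powr r \<partial>\<Omega>) powr (1 / r)"

end

theory Submission
  imports Defs
begin

text \<open>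
  The error of level \<open>l\<close> is split along the levels. On one level, the chain has, at each time \<open>p\<close>, a transition
  with invariant law \<open>\<Phi>\<^sub>l(\<eta>\<^sub>p)\<close>, where \<open>\<eta>\<close> is the empirical flow of the level below. Solving the Poisson equation
  of that transition writes \<open>f(X\<^sub>p) - \<Phi>\<^sub>l(\<eta>\<^sub>p)(f)\<close> as a martingale increment plus a term that telescopes up to the drift of
  the solutions in \<open>p\<close>. By the contraction in (R2) the solutions are bounded by \<open>n\<^sub>l / (1 - b\<^sub>l)\<close>; by its Lipschitz
  part, and since \<open>\<eta>\<^sub>p\<close> moves by \<open>O(1 / p)\<close>, the drift is \<open>O(1 / p)\<close>. Hoeffding's lemma makes the martingale
  sub-Gaussian, so all its moments are controlled, and \<open>\<eta>\<^sup>(\<^sup>l\<^sup>)\<close> stays within \<open>(4 r + 10) A / \<surd>(n + 1)\<close> of the time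
  averaged image of \<open>\<eta>\<^sup>(\<^sup>l\<^sup>-\<^sup>1\<^sup>)\<close> in \<open>L\<^sup>r\<close> (lemma \<open>average_error\<close>, applied in \<open>close_emp_push\<close>).

  The time averaged map multiplies \<open>L\<^sup>r\<close> errors of the form \<open>C / \<surd>(n + 1)\<close> by at most \<open>B\<close> (lemma
  \<open>close_push\<close>). This is Minkowski's inequality applied to (R1). It needs the map \<open>\<Phi>\<^sub>l\<close> to be measurable, which
  holds because its values are limits of iterates of the transitions (lemma \<open>rho_measurable\<close>).

  Telescoping over the last \<open>k\<close> levels (over all of them, if \<open>l < k\<close>) gives an error of at most \<open>(4 r + 10) A (1 + B + \<dots> + B\<^sup>k\<^sup>-\<^sup>1) / \<surd>(n + 1)\<close>, and
  replacing the flow of level \<open>l - k\<close> by the constant flow \<open>\<pi>\<^sup>(\<^sup>l\<^sup>-\<^sup>k\<^sup>)\<close> costs at most \<open>\<lambda>\<^sub>1 exp (- \<lambda>\<^sub>2 k)\<close>, by the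
  assumed forgetting of the semigroup (lemma \<open>uniform_error\<close>). Neither bound depends on \<open>l\<close>. It remains to choose \<open>k\<close>
  of order \<open>ln (n + 1) / (2 (\<lambda>\<^sub>2 + ln B))\<close>, which balances the two.
\<close>

section \<open>Bounded functions of controlled oscillation\<close>

text \<open>The pointwise form of \<open>osc S f \<le> a\<close>; it survives sums, scalings and Markov operators without
  any supremum having to be computed.\<close>

definition Osc_le :: "'a measure \<Rightarrow> real \<Rightarrow> ('a \<Rightarrow> real) set" where
  "Osc_le S a = {f \<in> Bdd S. \<forall>x\<in>space S. \<forall>y\<in>space S. \<bar>f x - f y\<bar> \<le> a}"

lemma Bdd_iff: "f \<in> Bdd S \<longleftrightarrow> f \<in> borel_measurable S \<and> (\<exists>c. \<forall>x\<in>space S. \<bar>f x\<bar> \<le> c)"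
  by (auto simp: Bdd_def bounded_iff)

lemma Bdd_measurable [measurable_dest]: "f \<in> Bdd S \<Longrightarrow> f \<in> borel_measurable S"
  by (simp add: Bdd_def)

lemma BddE:
  assumes "f \<in> Bdd S"
  obtains c where "c > 0" "\<And>x. x \<in> space S \<Longrightarrow> \<bar>f x\<bar> \<le> c"
proof -
  obtain c where c: "\<forall>x\<in>space S. \<bar>f x\<bar> \<le> c" using assms unfolding Bdd_iff by blast
  show ?thesis using that[of "max c 1"] c by (simp add: max.coboundedI1)
qed

lemma Bdd_const [simp, intro]: "(\<lambda>x. a) \<in> Bdd S"
  by (auto simp: Bdd_iff)

lemma Bdd_add [intro]:
  assumes "f \<in> Bdd S" "g \<in> Bdd S" shows "(\<lambda>x. f x + g x) \<in> Bdd S"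
proof -
  obtain c d where "\<And>x. x \<in> space S \<Longrightarrow> \<bar>f x\<bar> \<le> c" "\<And>x. x \<in> space S \<Longrightarrow> \<bar>g x\<bar> \<le> d"
    using assms by (metis BddE)
  then have "\<forall>x\<in>space S. \<bar>f x + g x\<bar> \<le> c + d" by (fastforce intro: order_trans[OF abs_triangle_ineq] add_mono)
  with assms show ?thesis by (auto simp: Bdd_iff)
qed

lemma Bdd_mult [intro]:
  assumes "f \<in> Bdd S" "g \<in> Bdd S" shows "(\<lambda>x. f x * g x) \<in> Bdd S"
proof -
  obtain c d where "\<And>x. x \<in> space S \<Longrightarrow> \<bar>f x\<bar> \<le> c" "\<And>x. x \<in> space S \<Longrightarrow> \<bar>g x\<bar> \<le> d" "c > 0" "d > 0"
    using assms by (metis BddE)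
  then have "\<forall>x\<in>space S. \<bar>f x * g x\<bar> \<le> c * d" by (auto simp: abs_mult intro!: mult_mono)
  with assms show ?thesis by (auto simp: Bdd_iff)
qed

lemma Bdd_uminus: "f \<in> Bdd S \<Longrightarrow> (\<lambda>x. - f x) \<in> Bdd S"
  using Bdd_mult[of "\<lambda>x. -1" S f] by simp

lemma Bdd_diff [intro]: "f \<in> Bdd S \<Longrightarrow> g \<in> Bdd S \<Longrightarrow> (\<lambda>x. f x - g x) \<in> Bdd S"
  using Bdd_add[OF _ Bdd_uminus[of g S]] by simp

lemma Bdd_sum [intro]:
  assumes "\<And>i. i \<in> I \<Longrightarrow> f i \<in> Bdd S" shows "(\<lambda>x. \<Sum>i\<in>I. f i x) \<in> Bdd S"
  using assms by (induction I rule: infinite_finite_induct) auto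

lemma sup_norm_upper:
  assumes "f \<in> Bdd S" "x \<in> space S" shows "\<bar>f x\<bar> \<le> sup_norm S f"
proof -
  obtain c where "\<And>x. x \<in> space S \<Longrightarrow> \<bar>f x\<bar> \<le> c" using assms(1) BddE by metis
  then show ?thesis unfolding sup_norm_def by (intro cSUP_upper assms bdd_aboveI2) auto
qed

lemma sup_norm_least:
  assumes "space S \<noteq> {}" "\<And>x. x \<in> space S \<Longrightarrow> \<bar>f x\<bar> \<le> c" shows "sup_norm S f \<le> c"
  unfolding sup_norm_def using assms by (intro cSUP_least) auto

lemma Bdd1I:
  assumes "f \<in> borel_measurable S" "space S \<noteq> {}" "\<And>x. x \<in> space S \<Longrightarrow> \<bar>f x\<bar> \<le> 1"
  shows "f \<in> Bdd1 S"
  using assms sup_norm_least[OF assms(2,3)] by (auto simp: Bdd1_def Bdd_iff)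

lemma Bdd1D:
  assumes "f \<in> Bdd1 S"
  shows "f \<in> Bdd S" "\<And>x. x \<in> space S \<Longrightarrow> \<bar>f x\<bar> \<le> 1"
  using assms sup_norm_upper[of f S] by (fastforce simp: Bdd1_def)+

lemma osc_upper:
  assumes "f \<in> Bdd S" "x \<in> space S" "y \<in> space S" shows "\<bar>f x - f y\<bar> \<le> osc S f"
proof -
  obtain c where c: "\<And>x. x \<in> space S \<Longrightarrow> \<bar>f x\<bar> \<le> c" using assms(1) BddE by metis
  have "\<bar>f u - f v\<bar> \<le> c + c" if "u \<in> space S" "v \<in> space S" for u v
    using c[OF that(1)] c[OF that(2)] by linarith
  then have "bdd_above ((\<lambda>(x, y). \<bar>f x - f y\<bar>) ` (space S \<times> space S))"
    by (intro bdd_aboveI2[where M="c + c"]) auto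
  from cSUP_upper[OF _ this, of "(x, y)"] assms show ?thesis by (auto simp: osc_def)
qed

lemma Osc_leD:
  assumes "f \<in> Osc_le S a"
  shows "f \<in> Bdd S" "\<And>x y. x \<in> space S \<Longrightarrow> y \<in> space S \<Longrightarrow> \<bar>f x - f y\<bar> \<le> a"
  using assms by (auto simp: Osc_le_def)

lemma Osc_leI:
  assumes "f \<in> Bdd S" "\<And>x y. x \<in> space S \<Longrightarrow> y \<in> space S \<Longrightarrow> \<bar>f x - f y\<bar> \<le> a"
  shows "f \<in> Osc_le S a"
  using assms by (auto simp: Osc_le_def)

lemma Osc_le_iff_osc:
  assumes "space S \<noteq> {}" shows "f \<in> Osc_le S a \<longleftrightarrow> f \<in> Bdd S \<and> osc S f \<le> a"
proof
  assume f: "f \<in> Osc_le S a"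
  have "osc S f \<le> a" unfolding osc_def using assms Osc_leD[OF f] by (intro cSUP_least) auto
  with f show "f \<in> Bdd S \<and> osc S f \<le> a" by (simp add: Osc_leD)
next
  assume f: "f \<in> Bdd S \<and> osc S f \<le> a"
  then show "f \<in> Osc_le S a" by (auto intro!: Osc_leI intro: order_trans[OF osc_upper])
qed

lemma Osc1_eq: "space S \<noteq> {} \<Longrightarrow> Osc1 S = Osc_le S 1"
  unfolding Osc1_def using Osc_le_iff_osc[of S _ 1] by blast

lemma Osc_le_nonneg: "f \<in> Osc_le S a \<Longrightarrow> space S \<noteq> {} \<Longrightarrow> 0 \<le> a"
  by (metis Osc_leD(2) abs_ge_zero all_not_in_conv order_trans)

lemma Osc_le_mono: "f \<in> Osc_le S a \<Longrightarrow> a \<le> b \<Longrightarrow> f \<in> Osc_le S b"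
  by (fastforce simp: Osc_le_def)

lemma Osc_le_add:
  assumes "f \<in> Osc_le S a" "g \<in> Osc_le S b" shows "(\<lambda>x. f x + g x) \<in> Osc_le S (a + b)"
proof (rule Osc_leI)
  fix x y assume "x \<in> space S" "y \<in> space S"
  then show "\<bar>f x + g x - (f y + g y)\<bar> \<le> a + b"
    using Osc_leD(2)[OF assms(1), of x y] Osc_leD(2)[OF assms(2), of x y] by linarith
qed (use assms Osc_leD in auto)

lemma Osc_le_const [simp]: "a \<ge> 0 \<Longrightarrow> (\<lambda>x. c) \<in> Osc_le S a"
  by (auto intro!: Osc_leI)

lemma Osc_le_sum:
  assumes "\<And>i. i \<in> I \<Longrightarrow> f i \<in> Osc_le S (a i)"
  shows "(\<lambda>x. \<Sum>i\<in>I. f i x) \<in> Osc_le S (\<Sum>i\<in>I. a i)"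
  using assms by (induction I rule: infinite_finite_induct) (auto intro: Osc_le_add)

lemma Osc_le_scale:
  assumes "f \<in> Osc_le S a" shows "(\<lambda>x. t * f x) \<in> Osc_le S (\<bar>t\<bar> * a)"
proof (rule Osc_leI)
  fix x y assume "x \<in> space S" "y \<in> space S"
  then show "\<bar>t * f x - t * f y\<bar> \<le> \<bar>t\<bar> * a"
    using Osc_leD(2)[OF assms, of x y] by (simp add: abs_mult mult_left_mono flip: right_diff_distrib)
qed (use Bdd_mult[OF Bdd_const Osc_leD(1)[OF assms]] in simp)

lemma Osc_le_minus_const:
  assumes "f \<in> Osc_le S a" shows "(\<lambda>x. f x - c) \<in> Osc_le S a"
  using assms by (auto simp: Osc_le_def)

lemma Osc_le_of_bound:
  assumes "f \<in> Bdd S" "\<And>x. x \<in> space S \<Longrightarrow> \<bar>f x\<bar> \<le> c" shows "f \<in> Osc_le S (2 * c)"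
proof (rule Osc_leI[OF assms(1)])
  fix x y assume "x \<in> space S" "y \<in> space S"
  then show "\<bar>f x - f y\<bar> \<le> 2 * c" using assms(2)[of x] assms(2)[of y] by linarith
qed

text \<open>The midpoint of the range of \<open>f\<close> is the best constant; this is why oscillation bounds lose no
  factor \<open>2\<close> against the sup norm.\<close>

lemma Osc_le_midpoint:
  assumes "f \<in> Osc_le S a" "space S \<noteq> {}"
  shows "\<exists>m. \<forall>x\<in>space S. \<bar>f x - m\<bar> \<le> a / 2"
proof -
  obtain c where c: "\<And>x. x \<in> space S \<Longrightarrow> \<bar>f x\<bar> \<le> c" using Osc_leD(1)[OF assms(1)] BddE by metis
  have bd: "bdd_above (f ` space S)" "bdd_below (f ` space S)"
    using c by (auto intro!: bdd_aboveI2[where M=c] bdd_belowI2[where m="-c"] simp: abs_le_iff) (metis minus_le_iff)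
  let ?u = "SUP x\<in>space S. f x" and ?l = "INF x\<in>space S. f x"
  have "?u \<le> f y + a" if y: "y \<in> space S" for y
    using Osc_leD(2)[OF assms(1) _ y] assms(2) by (intro cSUP_least) (auto simp: abs_le_iff algebra_simps)
  then have "?u - a \<le> ?l" using assms(2) by (intro cINF_greatest) (auto simp: algebra_simps)
  moreover have "?l \<le> f x" "f x \<le> ?u" if "x \<in> space S" for x
    using that bd by (auto intro: cINF_lower cSUP_upper)
  ultimately have "\<bar>f x - (?u + ?l) / 2\<bar> \<le> a / 2" if "x \<in> space S" for x
    using that by (fastforce simp: abs_le_iff field_simps)
  then show ?thesis by blast
qed

section \<open>Integrals against probability measures\<close>

lemma ProbD:
  assumes "\<mu> \<in> Prob S"
  shows "prob_space \<mu>" "sets \<mu> = sets S" "space \<mu> = space S" "space S \<noteq> {}"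
proof -
  show 1: "prob_space \<mu>" "sets \<mu> = sets S" using assms by (auto simp: space_prob_algebra)
  show "space \<mu> = space S" by (rule sets_eq_imp_space_eq[OF 1(2)])
  with prob_space.not_empty[OF 1(1)] show "space S \<noteq> {}" by simp
qed

lemma Prob_integrable:
  assumes "\<mu> \<in> Prob S" "f \<in> Bdd S" shows "integrable \<mu> f"
proof -
  interpret prob_space \<mu> using ProbD[OF assms(1)] by simp
  obtain c where "\<And>x. x \<in> space S \<Longrightarrow> \<bar>f x\<bar> \<le> c" using assms(2) BddE by metis
  then show ?thesis
    using assms ProbD[OF assms(1)] by (intro integrable_const_bound[where B=c])
      (auto simp: Bdd_iff cong: measurable_cong_sets)
qed

lemma Prob_integral_dist:
  assumes "\<mu> \<in> Prob S" "f \<in> Bdd S" "\<And>x. x \<in> space S \<Longrightarrow> \<bar>f x - a\<bar> \<le> d"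
  shows "\<bar>(\<integral>x. f x \<partial>\<mu>) - a\<bar> \<le> d"
proof -
  interpret prob_space \<mu> using ProbD[OF assms(1)] by simp
  have i: "integrable \<mu> f" using Prob_integrable assms by blast
  have "(\<integral>x. f x \<partial>\<mu>) - a = (\<integral>x. f x - a \<partial>\<mu>)" using i by (simp add: prob_space)
  also have "\<bar>\<dots>\<bar> \<le> (\<integral>x. \<bar>f x - a\<bar> \<partial>\<mu>)" by (rule integral_abs_bound)
  also have "\<dots> \<le> (\<integral>x. d \<partial>\<mu>)"
    using i assms(3) ProbD(3)[OF assms(1)] by (intro integral_mono) auto
  finally show ?thesis by (simp add: prob_space)
qed

lemma Prob_integral_abs_le:
  assumes "\<mu> \<in> Prob S" "f \<in> Bdd S" "\<And>x. x \<in> space S \<Longrightarrow> \<bar>f x\<bar> \<le> d"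
  shows "\<bar>\<integral>x. f x \<partial>\<mu>\<bar> \<le> d"
  using Prob_integral_dist[of \<mu> S f 0 d] assms by simp

lemma Prob_integral_cong:
  assumes "\<mu> \<in> Prob S" "\<And>x. x \<in> space S \<Longrightarrow> f x = g x"
  shows "(\<integral>x. f x \<partial>\<mu>) = (\<integral>x. g x \<partial>\<mu>)"
  using assms ProbD(3)[OF assms(1)] by (intro Bochner_Integration.integral_cong) auto

lemma Prob_integral_minus_const:
  assumes "\<mu> \<in> Prob S" "f \<in> Bdd S"
  shows "(\<integral>x. f x - a \<partial>\<mu>) = (\<integral>x. f x \<partial>\<mu>) - a"
proof -
  interpret prob_space \<mu> using ProbD[OF assms(1)] by simp
  show ?thesis using Prob_integrable[OF assms] by (simp add: prob_space)
qed

lemma tv_dist_upper: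
  assumes "\<mu> \<in> Prob S" "\<nu> \<in> Prob S" "f \<in> Bdd1 S"
  shows "\<bar>(\<integral>x. f x \<partial>\<mu>) - (\<integral>x. f x \<partial>\<nu>)\<bar> \<le> tv_dist S \<mu> \<nu>"
  unfolding tv_dist_def
proof (rule cSUP_upper[OF assms(3)], rule bdd_aboveI2)
  fix f assume f: "f \<in> Bdd1 S"
  have "\<bar>\<integral>x. f x \<partial>\<mu>\<bar> \<le> 1" "\<bar>\<integral>x. f x \<partial>\<nu>\<bar> \<le> 1"
    using Prob_integral_abs_le assms Bdd1D[OF f] by blast+
  then show "\<bar>(\<integral>x. f x \<partial>\<mu>) - (\<integral>x. f x \<partial>\<nu>)\<bar> \<le> 2" by linarith
qed

lemma Bdd1_nonempty: "space S \<noteq> {} \<Longrightarrow> Bdd1 S \<noteq> {}"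
  using Bdd1I[of "\<lambda>x. 0" S] by auto

lemma tv_dist_least:
  assumes "space S \<noteq> {}"
    and "\<And>f. f \<in> Bdd1 S \<Longrightarrow> \<bar>(\<integral>x. f x \<partial>\<mu>) - (\<integral>x. f x \<partial>\<nu>)\<bar> \<le> c"
  shows "tv_dist S \<mu> \<nu> \<le> c"
  unfolding tv_dist_def by (rule cSUP_least[OF Bdd1_nonempty[OF assms(1)] assms(2)])

lemma tv_dist_le_2:
  assumes "\<mu> \<in> Prob S" "\<nu> \<in> Prob S" shows "tv_dist S \<mu> \<nu> \<le> 2"
proof (rule tv_dist_least)
  fix f assume f: "f \<in> Bdd1 S"
  have "\<bar>\<integral>x. f x \<partial>\<mu>\<bar> \<le> 1" "\<bar>\<integral>x. f x \<partial>\<nu>\<bar> \<le> 1"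
    using Prob_integral_abs_le assms Bdd1D[OF f] by blast+
  then show "\<bar>(\<integral>x. f x \<partial>\<mu>) - (\<integral>x. f x \<partial>\<nu>)\<bar> \<le> 2" by linarith
qed (use assms ProbD in blast)

lemma Osc_le_imp_Bdd1:
  assumes "f \<in> Osc_le S a" "a > 0" "z \<in> space S"
  shows "(\<lambda>x. (f x - f z) / a) \<in> Bdd1 S"
  using assms Osc_leD[OF assms(1)] by (intro Bdd1I) (auto simp: Bdd_iff divide_le_eq)

lemma tv_dist_Osc1:
  assumes "\<mu> \<in> Prob S" "\<nu> \<in> Prob S" "f \<in> Osc1 S"
  shows "\<bar>(\<integral>x. f x \<partial>\<mu>) - (\<integral>x. f x \<partial>\<nu>)\<bar> \<le> tv_dist S \<mu> \<nu>"
proof -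
  obtain z where z: "z \<in> space S" using ProbD[OF assms(1)] by auto
  have f: "f \<in> Osc_le S 1" using assms Osc1_eq z by fastforce
  have "(\<lambda>x. f x - f z) \<in> Bdd1 S" using Osc_le_imp_Bdd1[OF f _ z] by simp
  from tv_dist_upper[OF assms(1,2) this] show ?thesis
    using Osc_leD(1)[OF f] assms by (simp add: Prob_integral_minus_const)
qed

section \<open>Geometrically contracting Markov operators\<close>

lemma kernel_Prob: "K \<in> S \<rightarrow>\<^sub>M prob_algebra S \<Longrightarrow> x \<in> space S \<Longrightarrow> K x \<in> Prob S"
  by (rule measurable_space)

lemma kernel_op_Bdd:
  assumes K: "K \<in> S \<rightarrow>\<^sub>M prob_algebra S" and f: "f \<in> Bdd S"
  shows "kernel_op K f \<in> Bdd S"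
proof -
  obtain c where "\<And>x. x \<in> space S \<Longrightarrow> \<bar>f x\<bar> \<le> c" using f BddE by metis
  then have "\<forall>x\<in>space S. \<bar>kernel_op K f x\<bar> \<le> c"
    unfolding kernel_op_def using Prob_integral_abs_le[OF kernel_Prob[OF K] f] by blast
  moreover have "kernel_op K f \<in> borel_measurable S"
    unfolding kernel_op_def
    by (rule measurable_compose[OF measurable_prob_algebraD[OF K] integral_measurable_subprob_algebra])
      (use f in \<open>auto dest: Bdd_measurable\<close>)
  ultimately show ?thesis by (auto simp: Bdd_iff)
qed

lemma kernel_op_Osc_le:
  assumes K: "K \<in> S \<rightarrow>\<^sub>M prob_algebra S" and f: "f \<in> Osc_le S a"
  shows "kernel_op K f \<in> Osc_le S a"
proof (rule Osc_leI)
  show "kernel_op K f \<in> Bdd S" using kernel_op_Bdd[OF K] Osc_leD[OF f] by blast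
  fix x y assume x: "x \<in> space S" and y: "y \<in> space S"
  have "\<bar>f u - kernel_op K f y\<bar> \<le> a" if "u \<in> space S" for u
    unfolding kernel_op_def using Prob_integral_dist[OF kernel_Prob[OF K y] Osc_leD(1)[OF f], of "f u" a]
      Osc_leD(2)[OF f] that by (simp add: abs_minus_commute)
  then show "\<bar>kernel_op K f x - kernel_op K f y\<bar> \<le> a"
    unfolding kernel_op_def by (intro Prob_integral_dist[OF kernel_Prob[OF K x] Osc_leD(1)[OF f]])
qed

lemma kernel_op_pow_Bdd:
  assumes "K \<in> S \<rightarrow>\<^sub>M prob_algebra S" "f \<in> Bdd S"
  shows "(kernel_op K ^^ m) f \<in> Bdd S"
  using assms by (induction m) (auto intro: kernel_op_Bdd)

lemma kernel_op_pow_Osc_le: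
  assumes "K \<in> S \<rightarrow>\<^sub>M prob_algebra S" "f \<in> Osc_le S a"
  shows "(kernel_op K ^^ m) f \<in> Osc_le S a"
  using assms by (induction m) (auto intro: kernel_op_Osc_le)

lemma kernel_op_diff:
  assumes "K \<in> S \<rightarrow>\<^sub>M prob_algebra S" "f \<in> Bdd S" "g \<in> Bdd S" "x \<in> space S"
  shows "kernel_op K (\<lambda>y. f y - g y) x = kernel_op K f x - kernel_op K g x"
  unfolding kernel_op_def
  by (rule Bochner_Integration.integral_diff)
    (rule Prob_integrable[OF kernel_Prob[OF assms(1,4)]], fact)+

lemma kernel_op_scale: "kernel_op K (\<lambda>y. t * f y) x = t * kernel_op K f x"
  unfolding kernel_op_def by simp

lemma kernel_op_pow_scale: "(kernel_op K ^^ m) (\<lambda>y. t * f y) = (\<lambda>x. t * (kernel_op K ^^ m) f x)"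
  by (induction m) (simp_all add: kernel_op_scale[abs_def])

lemma kernel_op_minus_const:
  assumes "K \<in> S \<rightarrow>\<^sub>M prob_algebra S" "f \<in> Bdd S" "x \<in> space S"
  shows "kernel_op K (\<lambda>y. f y - c) x = kernel_op K f x - c"
  unfolding kernel_op_def by (rule Prob_integral_minus_const[OF kernel_Prob[OF assms(1,3)] assms(2)])

lemma kernel_op_sum:
  assumes "K \<in> S \<rightarrow>\<^sub>M prob_algebra S" "\<And>i. i \<in> I \<Longrightarrow> f i \<in> Bdd S" "x \<in> space S"
  shows "kernel_op K (\<lambda>y. \<Sum>i\<in>I. f i y) x = (\<Sum>i\<in>I. kernel_op K (f i) x)"
  unfolding kernel_op_def
  by (rule Bochner_Integration.integral_sum)
    (rule Prob_integrable[OF kernel_Prob[OF assms(1,3)] assms(2)])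

lemma kernel_op_cong:
  assumes "K \<in> S \<rightarrow>\<^sub>M prob_algebra S" "x \<in> space S" "\<And>y. y \<in> space S \<Longrightarrow> f y = g y"
  shows "kernel_op K f x = kernel_op K g x"
  unfolding kernel_op_def by (rule Prob_integral_cong[OF kernel_Prob[OF assms(1,2)] assms(3)])

lemma dobrushin_upper:
  assumes K: "K \<in> S \<rightarrow>\<^sub>M prob_algebra S" and S: "space S \<noteq> {}" and f: "f \<in> Osc_le S 1"
  shows "osc S ((kernel_op K ^^ m) f) \<le> dobrushin S (kernel_op K ^^ m)"
  unfolding dobrushin_def
proof (rule cSUP_upper)
  show "f \<in> Osc1 S" using f S by (simp add: Osc1_eq)
  show "bdd_above ((\<lambda>f. osc S ((kernel_op K ^^ m) f)) ` Osc1 S)"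
  proof (rule bdd_aboveI2)
    fix f assume "f \<in> Osc1 S"
    then have "(kernel_op K ^^ m) f \<in> Osc_le S 1" using kernel_op_pow_Osc_le[OF K] S by (simp add: Osc1_eq)
    then show "osc S ((kernel_op K ^^ m) f) \<le> 1" using S by (simp add: Osc_le_iff_osc)
  qed
qed

lemma dobrushin_le_1:
  assumes K: "K \<in> S \<rightarrow>\<^sub>M prob_algebra S" and S: "space S \<noteq> {}"
  shows "dobrushin S (kernel_op K ^^ m) \<le> 1"
  unfolding dobrushin_def
proof (rule cSUP_least)
  show "Osc1 S \<noteq> {}" unfolding Osc1_eq[OF S] using Osc_le_const[of 1 0 S] by fastforce
  fix f assume "f \<in> Osc1 S"
  then have "(kernel_op K ^^ m) f \<in> Osc_le S 1" using kernel_op_pow_Osc_le[OF K] S by (simp add: Osc1_eq)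
  then show "osc S ((kernel_op K ^^ m) f) \<le> 1" using S by (simp add: Osc_le_iff_osc)
qed

lemma dobrushin_nonneg:
  assumes K: "K \<in> S \<rightarrow>\<^sub>M prob_algebra S" and S: "space S \<noteq> {}"
  shows "0 \<le> dobrushin S (kernel_op K ^^ m)"
proof -
  obtain z where z: "z \<in> space S" using S by auto
  have f: "(\<lambda>x. 0) \<in> Osc_le S 1" by simp
  have "0 \<le> osc S ((kernel_op K ^^ m) (\<lambda>x. 0))"
    using osc_upper[OF kernel_op_pow_Bdd[OF K, of "\<lambda>x. 0" m] z z] by simp
  with dobrushin_upper[OF K S f, of m] show ?thesis by linarith
qed

text \<open>Packaged form of \<open>\<beta>(K\<^sup>N) \<le> b\<close> for a Markov transition \<open>K\<close>. The case \<open>N = 0\<close> is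
  allowed: \<open>b < 1\<close> then forces every bounded function to be constant, and all statements below,
  with \<open>N / (1 - b) = 0\<close>, remain correct.\<close>

locale contracting_kernel =
  fixes S :: "'a measure" and K :: "'a \<Rightarrow> 'a measure" and N :: nat and b :: real
  assumes kernel: "K \<in> S \<rightarrow>\<^sub>M prob_algebra S"
    and nonempty: "space S \<noteq> {}"
    and b_nonneg: "0 \<le> b" and b_less_1: "b < 1"
    and contraction: "dobrushin S (kernel_op K ^^ N) \<le> b"
begin

abbreviation P where "P \<equiv> kernel_op K"

lemma contract_once:
  assumes f: "f \<in> Osc_le S a" shows "(P ^^ N) f \<in> Osc_le S (b * a)"
proof -
  have a: "0 \<le> a" using f nonempty by (rule Osc_le_nonneg)
  show ?thesis
  proof (cases "a = 0")
    case True
    then show ?thesis using kernel_op_pow_Osc_le[OF kernel f] by simp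
  next
    case False
    have "(\<lambda>x. (1 / a) * f x) \<in> Osc_le S (\<bar>1 / a\<bar> * a)" by (rule Osc_le_scale[OF f])
    then have g: "(\<lambda>x. (1 / a) * f x) \<in> Osc_le S 1" using a False by simp
    have "osc S ((P ^^ N) (\<lambda>x. (1 / a) * f x)) \<le> b"
      using dobrushin_upper[OF kernel nonempty g, of N] contraction by linarith
    then have "(P ^^ N) (\<lambda>x. (1 / a) * f x) \<in> Osc_le S b"
      using nonempty kernel_op_pow_Bdd[OF kernel Osc_leD(1)[OF g]] by (simp add: Osc_le_iff_osc)
    from Osc_le_scale[OF this, of a] show ?thesis
      unfolding kernel_op_pow_scale using a False by (simp add: mult.commute)
  qed
qed

lemma contract_many:
  assumes f: "f \<in> Osc_le S a" shows "(P ^^ (N * j)) f \<in> Osc_le S (b ^ j * a)"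
proof (induction j)
  case (Suc j)
  have "(P ^^ (N * Suc j)) f = (P ^^ N) ((P ^^ (N * j)) f)" by (simp add: funpow_add)
  then show ?case using contract_once[OF Suc.IH] by (simp add: mult.assoc)
qed (use f in simp)

text \<open>Between multiples of \<open>N\<close> only the trivial contraction of a Markov operator is available.\<close>

lemma contract_general:
  assumes f: "f \<in> Osc_le S a" shows "(P ^^ (j * N + i)) f \<in> Osc_le S (b ^ j * a)"
proof -
  have "(P ^^ (j * N + i)) f = (P ^^ i) ((P ^^ (N * j)) f)"
    by (subst add.commute) (simp add: funpow_add mult.commute)
  then show ?thesis using kernel_op_pow_Osc_le[OF kernel contract_many[OF f]] by simp
qed

text \<open>Bound for the potential kernel \<open>\<Sum>\<^sub>m P\<^sup>m\<close> acting on functions modulo constants.\<close>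

definition C where "C = real N / (1 - b)"

lemma C_nonneg: "0 \<le> C"
  unfolding C_def using b_less_1 by simp

text \<open>Either \<open>N = 0\<close> and \<open>C = 0\<close>, or \<open>C \<ge> 1\<close>; this lets boundary terms of size \<open>C\<close> be absorbed
  in the main error, which has size \<open>C\<^sup>2\<close>.\<close>

lemma C_le_square: "C \<le> C\<^sup>2"
proof (cases "N = 0")
  case False
  then have "1 - b \<le> real N" using b_nonneg by (simp add: order_trans[of _ 1])
  then have "1 \<le> C" unfolding C_def using b_less_1 by (simp add: le_divide_eq)
  then have "1 * C \<le> C * C" by (intro mult_right_mono) auto
  then show ?thesis by (simp add: power2_eq_square)
next
  case True
  then show ?thesis unfolding C_def by simp
qed

text \<open>Grouping the powers in blocks of length \<open>N\<close> leaves \<open>N\<close> times a geometric series in \<open>b\<close>.\<close>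

lemma potential_Osc_le:
  assumes f: "f \<in> Osc_le S a"
  shows "(\<lambda>x. \<Sum>m<N * j. (P ^^ m) f x) \<in> Osc_le S (C * a)"
proof -
  have a: "0 \<le> a" using f nonempty by (rule Osc_le_nonneg)
  have "(\<lambda>x. \<Sum>m\<in>{i * N..<i * N + N}. (P ^^ m) f x) \<in> Osc_le S (\<Sum>m\<in>{i * N..<i * N + N}. b ^ i * a)" for i
    by (rule Osc_le_sum) (metis atLeastLessThan_iff contract_general f le_Suc_ex)
  then have "(\<lambda>x. \<Sum>i<j. \<Sum>m\<in>{i * N..<i * N + N}. (P ^^ m) f x) \<in> Osc_le S (\<Sum>i<j. real N * (b ^ i * a))"
    by (intro Osc_le_sum) simp
  then have "(\<lambda>x. \<Sum>m<N * j. (P ^^ m) f x) \<in> Osc_le S (\<Sum>i<j. real N * (b ^ i * a))"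
    by (simp add: sum.nat_group mult.commute)
  moreover have "(\<Sum>i<j. real N * (b ^ i * a)) \<le> C * a"
  proof -
    have "(\<Sum>i<j. b ^ i) \<le> 1 / (1 - b)"
      using b_nonneg b_less_1 by (simp add: geometric_sum divide_le_eq field_simps)
    then have "real N * a * (\<Sum>i<j. b ^ i) \<le> real N * a * (1 / (1 - b))"
      using a by (intro mult_left_mono) auto
    then show ?thesis by (simp add: C_def sum_distrib_left mult_ac)
  qed
  ultimately show ?thesis by (rule Osc_le_mono)
qed

text \<open>Invariance gives \<open>\<rho>(P\<^sup>m f) = \<rho>(f)\<close>, and a function of small oscillation is close to its mean.\<close>

lemma pow_near_invariant:
  assumes rho: "\<rho> \<in> Prob S" "\<rho> \<bind> K = \<rho>" and f: "f \<in> Osc_le S a" and x: "x \<in> space S"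
  shows "\<bar>(P ^^ (N * j)) f x - (\<integral>y. f y \<partial>\<rho>)\<bar> \<le> b ^ j * a"
proof -
  have step: "(\<integral>y. P g y \<partial>\<rho>) = (\<integral>y. g y \<partial>\<rho>)" if g: "g \<in> Bdd S" for g
  proof -
    obtain c where c: "\<And>x. x \<in> space S \<Longrightarrow> \<bar>g x\<bar> \<le> c" using g BddE by metis
    have Kr: "K \<in> \<rho> \<rightarrow>\<^sub>M subprob_algebra S"
      using measurable_prob_algebraD[OF kernel] ProbD[OF rho(1)] by (simp cong: measurable_cong_sets)
    have "(\<integral>y. g y \<partial>(\<rho> \<bind> K)) = (\<integral>y. P g y \<partial>\<rho>)"
      unfolding kernel_op_def
    proof (rule integral_bind[where B=c and B'=1 and K=S])
      show "g \<in> borel_measurable S" using g by (rule Bdd_measurable)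
      show "finite_measure \<rho>" using ProbD[OF rho(1)] by (simp add: prob_space_def)
      show "AE x in \<rho>. emeasure (K x) (space (K x)) \<le> ennreal 1"
        using ProbD(1)[OF kernel_Prob[OF kernel]] ProbD(3)[OF rho(1)]
        by (intro AE_I2) (simp add: prob_space.emeasure_space_1)
    qed (use c Kr ProbD[OF rho(1)] in auto)
    with rho show ?thesis by simp
  qed
  have inv: "(\<integral>y. (P ^^ m) f y \<partial>\<rho>) = (\<integral>y. f y \<partial>\<rho>)" for m
    by (induction m) (use step kernel_op_pow_Bdd[OF kernel Osc_leD(1)[OF f]] in auto)
  have F: "(P ^^ (N * j)) f \<in> Osc_le S (b ^ j * a)" by (rule contract_many[OF f])
  have "\<bar>(\<integral>y. (P ^^ (N * j)) f y \<partial>\<rho>) - (P ^^ (N * j)) f x\<bar> \<le> b ^ j * a"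
    using Osc_leD[OF F] x by (intro Prob_integral_dist[OF rho(1)]) auto
  then show ?thesis by (simp add: inv abs_minus_commute)
qed

text \<open>If \<open>D - P D = g\<close>, then \<open>D - P\<^sup>m D\<close> is a partial sum of the potential of \<open>g\<close>, and
  \<open>P\<^sup>m D\<close> flattens out.\<close>

lemma Osc_le_of_coboundary:
  assumes D: "D \<in> Bdd S" and g: "g \<in> Osc_le S a"
    and eq: "\<And>x. x \<in> space S \<Longrightarrow> D x - P D x = g x"
  shows "D \<in> Osc_le S (C * a)"
proof (rule Osc_leI[OF D])
  fix x y assume x: "x \<in> space S" and y: "y \<in> space S"
  have pow: "(P ^^ m) D x - (P ^^ Suc m) D x = (P ^^ m) g x" if "x \<in> space S" for m x
    using that
  proof (induction m arbitrary: x)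
    case (Suc m)
    have "(P ^^ Suc m) D x - (P ^^ Suc (Suc m)) D x = P (\<lambda>y. (P ^^ m) D y - (P ^^ Suc m) D y) x"
      using kernel_op_diff[OF kernel kernel_op_pow_Bdd[OF kernel D] kernel_op_pow_Bdd[OF kernel D] Suc.prems, of m "Suc m"]
      by simp
    also have "\<dots> = P ((P ^^ m) g) x"
      by (rule kernel_op_cong[OF kernel Suc.prems]) (rule Suc.IH)
    finally show ?case by simp
  qed (use eq in simp)
  have tele: "D x - (P ^^ M) D x = (\<Sum>m<M. (P ^^ m) g x)" if "x \<in> space S" for M x
    using pow[OF that] sum_lessThan_telescope'[of "\<lambda>m. (P ^^ m) D x" M] by simp
  obtain d where d: "\<And>x. x \<in> space S \<Longrightarrow> \<bar>D x\<bar> \<le> d" using D BddE by metis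
  have D': "D \<in> Osc_le S (2 * d)" by (rule Osc_le_of_bound[OF D d])
  have "\<bar>D x - D y\<bar> \<le> b ^ j * (2 * d) + C * a" for j
    using Osc_leD(2)[OF contract_many[OF D', of j] x y] Osc_leD(2)[OF potential_Osc_le[OF g, of j] x y]
      tele[OF x, of "N * j"] tele[OF y, of "N * j"] by linarith
  moreover have "(\<lambda>j. b ^ j * (2 * d) + C * a) \<longlonglongrightarrow> 0 * (2 * d) + C * a"
    using b_nonneg b_less_1 by (intro tendsto_intros LIMSEQ_realpow_zero)
  ultimately show "\<bar>D x - D y\<bar> \<le> C * a"
    by (intro LIMSEQ_le_const[where X="\<lambda>j. b ^ j * (2 * d) + C * a"]) auto
qed

end

section \<open>Truncated Poisson equation\<close>

text \<open>The potential series is cut after \<open>m\<close> terms and normalised to vanish at a base point \<open>z\<close>. The cut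
  keeps all sums finite, so that measurability is immediate; its price is an error \<open>K\<^sup>m f\<close> in
  the Poisson equation, geometrically small and removed by \<open>m \<rightarrow> \<infinity>\<close> at the end. The base point, instead of
  centring by the invariant law, turns oscillation bounds into bounds for the function itself
  and is the same for all kernels.\<close>

definition poisson :: "('a \<Rightarrow> 'a measure) \<Rightarrow> 'a \<Rightarrow> nat \<Rightarrow> ('a \<Rightarrow> real) \<Rightarrow> 'a \<Rightarrow> real" where
  "poisson K z m f x = (\<Sum>i<m. (kernel_op K ^^ i) f x - (kernel_op K ^^ i) f z)"

lemma poisson_Bdd:
  assumes "K \<in> S \<rightarrow>\<^sub>M prob_algebra S" "f \<in> Bdd S"
  shows "poisson K z m f \<in> Bdd S"
  unfolding poisson_def[abs_def] using assms kernel_op_pow_Bdd by (intro Bdd_sum Bdd_diff Bdd_const)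

lemma poisson_equation:
  assumes K: "K \<in> S \<rightarrow>\<^sub>M prob_algebra S" and f: "f \<in> Bdd S" and x: "x \<in> space S"
  shows "poisson K z m f x - kernel_op K (poisson K z m f) x = f x - (kernel_op K ^^ m) f x"
proof -
  have B: "(kernel_op K ^^ i) f \<in> Bdd S" for i using K f by (rule kernel_op_pow_Bdd)
  have "kernel_op K (poisson K z m f) x
      = (\<Sum>i<m. kernel_op K (\<lambda>y. (kernel_op K ^^ i) f y - (kernel_op K ^^ i) f z) x)"
    unfolding poisson_def[abs_def] using B by (intro kernel_op_sum[OF K _ x]) auto
  also have "\<dots> = (\<Sum>i<m. (kernel_op K ^^ Suc i) f x - (kernel_op K ^^ i) f z)"
    using kernel_op_minus_const[OF K B x] by simp
  finally have "poisson K z m f x - kernel_op K (poisson K z m f) x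
      = (\<Sum>i<m. (kernel_op K ^^ i) f x - (kernel_op K ^^ Suc i) f x)"
    unfolding poisson_def by (simp flip: sum_subtractf)
  also have "\<dots> = f x - (kernel_op K ^^ m) f x"
    using sum_lessThan_telescope'[of "\<lambda>i. (kernel_op K ^^ i) f x" m] by simp
  finally show ?thesis .
qed

context contracting_kernel
begin

lemma poisson_Osc_le:
  assumes f: "f \<in> Osc_le S a"
  shows "poisson K z (N * j) f \<in> Osc_le S (C * a)"
  using Osc_le_minus_const[OF potential_Osc_le[OF f], of j "\<Sum>i<N * j. (P ^^ i) f z"]
  by (simp add: poisson_def[abs_def] sum_subtractf)

lemma poisson_base [simp]: "poisson K z m f z = 0"
  by (simp add: poisson_def)

lemma poisson_abs_le:
  assumes f: "f \<in> Osc_le S a" and z: "z \<in> space S" and x: "x \<in> space S"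
  shows "\<bar>poisson K z (N * j) f x\<bar> \<le> C * a"
  using Osc_leD(2)[OF poisson_Osc_le[OF f] x z, of z j] by simp

end

text \<open>The difference \<open>D\<close> of the two truncated Poisson solutions satisfies
  \<open>D - K D = (K - L) u\<^sub>L + (L\<^sup>m f - K\<^sup>m f)\<close>; the first term is controlled by the distance of
  the kernels, the second by the truncation.\<close>

lemma poisson_perturbation:
  assumes "contracting_kernel S K N b" "contracting_kernel S L N b"
    and f: "f \<in> Osc_le S 1" and z: "z \<in> space S" and x: "x \<in> space S"
    and close: "\<And>g a x. g \<in> Osc_le S a \<Longrightarrow> x \<in> space S \<Longrightarrow> \<bar>kernel_op K g x - kernel_op L g x\<bar> \<le> \<delta> * a"
  shows "\<bar>poisson K z (N * j) f x - poisson L z (N * j) f x\<bar>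
      \<le> 2 * \<delta> * (real N / (1 - b))\<^sup>2 + 2 * (real N / (1 - b)) * b ^ j"
proof -
  interpret K: contracting_kernel S K N b by fact
  interpret L: contracting_kernel S L N b by fact
  let ?m = "N * j"
  let ?u = "poisson K z ?m f" and ?v = "poisson L z ?m f"
  have fB: "f \<in> Bdd S" using f by (rule Osc_leD)
  have u: "?u \<in> Bdd S" by (rule poisson_Bdd[OF K.kernel fB])
  have v: "?v \<in> Bdd S" by (rule poisson_Bdd[OF L.kernel fB])
  have vO: "?v \<in> Osc_le S L.C" using L.poisson_Osc_le[OF f] by simp
  define h where "h x = kernel_op K ?v x - kernel_op L ?v x" for x
  define g where "g x = h x + ((kernel_op L ^^ ?m) f x - (kernel_op K ^^ ?m) f x)" for x
  have h: "h \<in> Osc_le S (2 * (\<delta> * L.C))"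
    unfolding h_def using close[OF vO] kernel_op_Bdd[OF K.kernel v] kernel_op_Bdd[OF L.kernel v]
    by (intro Osc_le_of_bound) auto
  have "(\<lambda>x. (kernel_op L ^^ ?m) f x + (-1) * (kernel_op K ^^ ?m) f x) \<in> Osc_le S (b ^ j * 1 + \<bar>-1\<bar> * (b ^ j * 1))"
    by (intro Osc_le_add Osc_le_scale K.contract_many L.contract_many f)
  then have "g \<in> Osc_le S (2 * (\<delta> * L.C) + 2 * b ^ j)"
    unfolding g_def[abs_def] using Osc_le_add[OF h] by fastforce
  then have "(\<lambda>x. ?u x - ?v x) \<in> Osc_le S (K.C * (2 * (\<delta> * L.C) + 2 * b ^ j))"
  proof (rule K.Osc_le_of_coboundary[rotated])
    show "(\<lambda>x. ?u x - ?v x) \<in> Bdd S" using u v by blast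
    fix x assume x: "x \<in> space S"
    show "?u x - ?v x - kernel_op K (\<lambda>x. ?u x - ?v x) x = g x"
      using kernel_op_diff[OF K.kernel u v x] poisson_equation[OF K.kernel fB x, of z ?m]
        poisson_equation[OF L.kernel fB x, of z ?m] unfolding g_def h_def by linarith
  qed
  from Osc_leD(2)[OF this x z] show ?thesis
    by (simp add: K.C_def L.C_def power2_eq_square algebra_simps)
qed

section \<open>The \<open>L\<^sup>r\<close> norm of bounded random variables\<close>

text \<open>Both forms of Minkowski's inequality below rest on this form of convexity, which includes the
  boundary point \<open>0\<close>. For \<open>a = 0\<close> the left side is \<open>0\<close>, because \<open>0 powr (r - 1) = 0\<close> even for \<open>r = 1\<close>.\<close>

lemma powr_above_tangent:
  fixes x a r :: real
  assumes "r \<ge> 1" "0 \<le> x" "0 \<le> a"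
  shows "a powr r + r * a powr (r - 1) * (x - a) \<le> x powr r"
proof -
  consider "a = 0" | "a > 0" "x = 0" | "a > 0" "x > 0" using assms by linarith
  then show ?thesis
  proof cases
    case 2
    have "a powr (r - 1) * a = a powr r" using 2 powr_mult_base[of a "r - 1"] by (simp add: mult.commute)
    then have "a powr r + r * a powr (r - 1) * (x - a) = a powr r * (1 - r)" using 2 by (simp add: algebra_simps)
    then show ?thesis using assms 2 by (simp add: mult_nonneg_nonpos)
  next
    case 3
    have "x powr r - a powr r \<ge> (r * a powr (r - 1)) * (x - a)"
    proof (rule convex_on_imp_above_tangent[OF powr_convex[OF assms(1)]])
      show "((\<lambda>x. x powr r) has_field_derivative r * a powr (r - 1)) (at a within {0<..})"
        using 3 by (intro DERIV_subset[OF has_real_derivative_powr]) auto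
      show "a \<in> interior {0<..}" using 3 by (simp add: interior_open)
    qed (use 3 in \<open>auto simp: connected_Ioi\<close>)
    then show ?thesis by simp
  qed (use assms in simp)
qed

context prob_space
begin

lemma integrable_Bdd:
  assumes "Z \<in> Bdd M" shows "integrable M Z"
proof -
  obtain c where "\<And>x. x \<in> space M \<Longrightarrow> \<bar>Z x\<bar> \<le> c" using assms BddE by metis
  then show ?thesis using assms by (intro integrable_const_bound[where B=c]) (auto simp: Bdd_iff)
qed

lemma Bdd_powr:
  assumes "Z \<in> Bdd S" "r \<ge> 0" shows "(\<lambda>\<omega>. \<bar>Z \<omega>\<bar> powr r) \<in> Bdd S"
proof -
  obtain c where "\<And>x. x \<in> space S \<Longrightarrow> \<bar>Z x\<bar> \<le> c" using assms BddE by metis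
  then have "\<forall>x\<in>space S. \<bar>\<bar>Z x\<bar> powr r\<bar> \<le> c powr r" using assms by (auto intro!: powr_mono2)
  then show ?thesis using assms by (auto simp: Bdd_iff)
qed

context
  fixes r :: real assumes r: "r \<ge> 1"
begin

lemma Lr_le_iff:
  assumes "\<alpha> \<ge> 0"
  shows "Lr_norm M r Z \<le> \<alpha> \<longleftrightarrow> (\<integral>\<omega>. \<bar>Z \<omega>\<bar> powr r \<partial>M) \<le> \<alpha> powr r"
proof -
  have E: "0 \<le> (\<integral>\<omega>. \<bar>Z \<omega>\<bar> powr r \<partial>M)" by (intro integral_nonneg_AE) auto
  show ?thesis
  proof
    assume "Lr_norm M r Z \<le> \<alpha>"
    then have "((\<integral>\<omega>. \<bar>Z \<omega>\<bar> powr r \<partial>M) powr (1 / r)) powr r \<le> \<alpha> powr r"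
      unfolding Lr_norm_def using r by (intro powr_mono2) auto
    then show "(\<integral>\<omega>. \<bar>Z \<omega>\<bar> powr r \<partial>M) \<le> \<alpha> powr r" using E r by (simp add: powr_powr)
  next
    assume "(\<integral>\<omega>. \<bar>Z \<omega>\<bar> powr r \<partial>M) \<le> \<alpha> powr r"
    then have "(\<integral>\<omega>. \<bar>Z \<omega>\<bar> powr r \<partial>M) powr (1 / r) \<le> (\<alpha> powr r) powr (1 / r)"
      using E r by (intro powr_mono2) auto
    then show "Lr_norm M r Z \<le> \<alpha>" unfolding Lr_norm_def using assms r by (simp add: powr_powr)
  qed
qed

lemma Lr_nonneg: "0 \<le> Lr_norm M r Z"
  by (simp add: Lr_norm_def)

lemma Lr_cong: "(\<And>\<omega>. \<omega> \<in> space M \<Longrightarrow> Z \<omega> = W \<omega>) \<Longrightarrow> Lr_norm M r Z = Lr_norm M r W"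
  unfolding Lr_norm_def by (metis (no_types, lifting) Bochner_Integration.integral_cong)

lemma Lr_bounded:
  assumes "Z \<in> Bdd M" "d \<ge> 0" "\<And>\<omega>. \<omega> \<in> space M \<Longrightarrow> \<bar>Z \<omega>\<bar> \<le> d"
  shows "Lr_norm M r Z \<le> d"
proof -
  have "(\<integral>\<omega>. \<bar>Z \<omega>\<bar> powr r \<partial>M) \<le> (\<integral>\<omega>. d powr r \<partial>M)"
    using assms r by (intro integral_mono integrable_Bdd Bdd_powr powr_mono2 Bdd_const) auto
  then show ?thesis by (simp add: Lr_le_iff[OF assms(2)] prob_space)
qed

lemma Lr_scale: "Lr_norm M r (\<lambda>\<omega>. t * Z \<omega>) = \<bar>t\<bar> * Lr_norm M r Z"
proof -
  have "(\<integral>\<omega>. \<bar>t * Z \<omega>\<bar> powr r \<partial>M) = \<bar>t\<bar> powr r * (\<integral>\<omega>. \<bar>Z \<omega>\<bar> powr r \<partial>M)"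
    by (simp add: abs_mult powr_mult)
  then show ?thesis
    using r by (simp add: Lr_norm_def powr_mult powr_powr)
qed

text \<open>Minkowski's inequality: with \<open>\<alpha>\<close>, \<open>\<beta>\<close> slightly above the two norms, apply convexity of
  \<open>t \<mapsto> t\<^sup>r\<close> to the weights \<open>\<alpha> / (\<alpha> + \<beta>)\<close> and \<open>\<beta> / (\<alpha> + \<beta>)\<close>.\<close>

lemma Lr_add:
  assumes Z: "Z \<in> Bdd M" and W: "W \<in> Bdd M"
  shows "Lr_norm M r (\<lambda>\<omega>. Z \<omega> + W \<omega>) \<le> Lr_norm M r Z + Lr_norm M r W"
proof (rule field_le_epsilon)
  fix e :: real assume e: "e > 0"
  define \<alpha> \<beta> where "\<alpha> = Lr_norm M r Z + e / 2" and "\<beta> = Lr_norm M r W + e / 2"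
  have pos: "\<alpha> > 0" "\<beta> > 0" unfolding \<alpha>_def \<beta>_def using e Lr_nonneg[of Z] Lr_nonneg[of W] by auto
  have EZ: "(\<integral>\<omega>. \<bar>Z \<omega>\<bar> powr r \<partial>M) \<le> \<alpha> powr r" and EW: "(\<integral>\<omega>. \<bar>W \<omega>\<bar> powr r \<partial>M) \<le> \<beta> powr r"
    using Lr_le_iff[of \<alpha> Z] Lr_le_iff[of \<beta> W] pos e by (auto simp: \<alpha>_def \<beta>_def)
  let ?s = "\<alpha> + \<beta>"
  have pw: "\<bar>z + w\<bar> powr r \<le> ?s powr r * ((\<alpha> / ?s) * (\<bar>z\<bar> powr r / \<alpha> powr r) + (\<beta> / ?s) * (\<bar>w\<bar> powr r / \<beta> powr r))"
    for z w :: real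
  proof -
    define x y where "x = \<bar>z\<bar> / \<alpha>" and "y = \<bar>w\<bar> / \<beta>"
    define p where "p = \<alpha> / ?s"
    have q: "\<beta> / ?s = 1 - p" unfolding p_def using pos by (simp add: field_simps)
    have p: "0 \<le> p" "p \<le> 1" unfolding p_def using pos by auto
    have xy: "0 \<le> x" "0 \<le> y" unfolding x_def y_def using pos by auto
    define m where "m = p * x + (1 - p) * y"
    have m: "0 \<le> m" unfolding m_def using p xy by auto
    have "p * (m powr r + r * m powr (r - 1) * (x - m)) + (1 - p) * (m powr r + r * m powr (r - 1) * (y - m))
        \<le> p * x powr r + (1 - p) * y powr r"
      using p xy m r by (intro add_mono mult_left_mono powr_above_tangent) auto
    moreover have "p * (m powr r + r * m powr (r - 1) * (x - m)) + (1 - p) * (m powr r + r * m powr (r - 1) * (y - m))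
        = m powr r + r * m powr (r - 1) * (p * x + (1 - p) * y - m)"
      by (simp add: algebra_simps)
    ultimately have "m powr r \<le> p * x powr r + (1 - p) * y powr r" by (simp add: m_def)
    then have 1: "?s powr r * m powr r \<le> ?s powr r * (p * x powr r + (1 - p) * y powr r)"
      by (intro mult_left_mono) auto
    have "\<bar>z + w\<bar> \<le> ?s * m"
    proof -
      have "?s * m = (?s * p) * x + (?s * (1 - p)) * y" by (simp add: m_def algebra_simps)
      also have "\<dots> = \<bar>z\<bar> + \<bar>w\<bar>" unfolding q[symmetric] using pos by (simp add: p_def x_def y_def)
      finally show ?thesis by simp
    qed
    then have "\<bar>z + w\<bar> powr r \<le> (?s * m) powr r" using r by (intro powr_mono2) auto
    then have "\<bar>z + w\<bar> powr r \<le> ?s powr r * m powr r" using m pos by (simp add: powr_mult)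
    also note 1
    finally show ?thesis using pos unfolding q p_def[symmetric] by (simp add: x_def y_def powr_divide)
  qed
  have "(\<integral>\<omega>. \<bar>Z \<omega> + W \<omega>\<bar> powr r \<partial>M) \<le>
      (\<integral>\<omega>. ?s powr r * ((\<alpha> / ?s) * (\<bar>Z \<omega>\<bar> powr r / \<alpha> powr r) + (\<beta> / ?s) * (\<bar>W \<omega>\<bar> powr r / \<beta> powr r)) \<partial>M)"
    using Z W r pw integrable_Bdd[OF Bdd_powr[OF Z, of r]] integrable_Bdd[OF Bdd_powr[OF W, of r]]
    by (intro integral_mono integrable_Bdd[OF Bdd_powr[OF Bdd_add[OF Z W]]] integrable_mult_right
        Bochner_Integration.integrable_add integrable_divide) auto
  also have "\<dots> = ?s powr r * ((\<alpha> / ?s) * ((\<integral>\<omega>. \<bar>Z \<omega>\<bar> powr r \<partial>M) / \<alpha> powr r) + (\<beta> / ?s) * ((\<integral>\<omega>. \<bar>W \<omega>\<bar> powr r \<partial>M) / \<beta> powr r))"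
    using integrable_Bdd[OF Bdd_powr[OF Z, of r]] integrable_Bdd[OF Bdd_powr[OF W, of r]] r by simp
  also have "\<dots> \<le> ?s powr r * ((\<alpha> / ?s) * 1 + (\<beta> / ?s) * 1)"
    using EZ EW pos by (intro mult_left_mono add_mono) (auto simp: divide_le_eq)
  also have "\<dots> = ?s powr r" using pos by (simp flip: add_divide_distrib)
  finally have "Lr_norm M r (\<lambda>\<omega>. Z \<omega> + W \<omega>) \<le> ?s" using pos by (subst Lr_le_iff) auto
  then show "Lr_norm M r (\<lambda>\<omega>. Z \<omega> + W \<omega>) \<le> Lr_norm M r Z + Lr_norm M r W + e"
    by (simp add: \<alpha>_def \<beta>_def)
qed

lemma Lr_sum:
  assumes "finite I" "\<And>i. i \<in> I \<Longrightarrow> Z i \<in> Bdd M"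
  shows "Lr_norm M r (\<lambda>\<omega>. \<Sum>i\<in>I. Z i \<omega>) \<le> (\<Sum>i\<in>I. Lr_norm M r (Z i))"
  using assms
proof (induction I)
  case empty
  show ?case using Lr_bounded[of "\<lambda>_. 0" 0] by simp
next
  case (insert i I)
  have "Lr_norm M r (\<lambda>\<omega>. Z i \<omega> + (\<Sum>i\<in>I. Z i \<omega>)) \<le> Lr_norm M r (Z i) + Lr_norm M r (\<lambda>\<omega>. \<Sum>i\<in>I. Z i \<omega>)"
    using insert by (intro Lr_add) auto
  with insert show ?case by auto
qed

text \<open>Minkowski's inequality for integrals over a finite measure, in the only form that is needed:
  all the norms under the integral have a common bound. Jensen's inequality in the \<open>Q\<close> variable,
  then Fubini.\<close>

lemma Lr_integral_average:
  fixes h :: "'b \<Rightarrow> 'a \<Rightarrow> real"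
  assumes Q: "finite_measure Q"
    and h [measurable]: "(\<lambda>(g, \<omega>). h g \<omega>) \<in> borel_measurable (Q \<Otimes>\<^sub>M M)"
    and h_bd: "\<And>g \<omega>. g \<in> space Q \<Longrightarrow> \<omega> \<in> space M \<Longrightarrow> 0 \<le> h g \<omega> \<and> h g \<omega> \<le> H"
    and C: "C \<ge> 0" "\<And>g. g \<in> space Q \<Longrightarrow> Lr_norm M r (h g) \<le> C"
    and Z: "Z \<in> Bdd M" "\<And>\<omega>. \<omega> \<in> space M \<Longrightarrow> \<bar>Z \<omega>\<bar> \<le> (\<integral>g. h g \<omega> \<partial>Q)"
  shows "Lr_norm M r Z \<le> measure Q (space Q) * C"
proof -
  interpret Q: finite_measure Q by fact
  interpret pair_sigma_finite Q M ..
  interpret QM: finite_measure "Q \<Otimes>\<^sub>M M" by (rule finite_measure_pair_measure) unfold_locales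
  define W where "W = measure Q (space Q)"
  have W0: "W \<ge> 0" by (simp add: W_def)
  have hm: "(\<lambda>g. h g \<omega>) \<in> borel_measurable Q" if "\<omega> \<in> space M" for \<omega>
    using measurable_compose[OF measurable_Pair2'[OF that, of Q] h] by simp
  have hi: "integrable Q (\<lambda>g. h g \<omega>)" if "\<omega> \<in> space M" for \<omega>
    using h_bd[OF _ that] hm[OF that] by (intro Q.integrable_const_bound[where B=H]) auto
  have hri: "integrable Q (\<lambda>g. h g \<omega> powr r)" if "\<omega> \<in> space M" for \<omega>
    using h_bd[OF _ that] hm[OF that] r by (intro Q.integrable_const_bound[where B="H powr r"]) (auto intro!: powr_mono2)
  show ?thesis
  proof (cases "W = 0")
    case True
    have "\<bar>Z \<omega>\<bar> \<le> 0" if w: "\<omega> \<in> space M" for \<omega>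
    proof -
      have "(\<integral>g. h g \<omega> \<partial>Q) \<le> (\<integral>g. H \<partial>Q)" using hi[OF w] h_bd[OF _ w] by (intro integral_mono) auto
      also have "\<dots> = 0" using True by (simp add: W_def)
      finally show ?thesis using Z(2)[OF w] by linarith
    qed
    then have "Lr_norm M r Z \<le> 0" using Z by (intro Lr_bounded) auto
    then show ?thesis using True by (simp add: W_def)
  next
    case False
    then have W: "W > 0" using W0 by simp
    have pw: "\<bar>Z \<omega>\<bar> powr r \<le> W powr (r - 1) * (\<integral>g. h g \<omega> powr r \<partial>Q)" if w: "\<omega> \<in> space M" for \<omega>
    proof -
      define m where "m = (\<integral>g. h g \<omega> \<partial>Q) / W"
      have m: "0 \<le> m" unfolding m_def using W h_bd[OF _ w] by (intro divide_nonneg_nonneg integral_nonneg_AE) auto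
      have "(\<integral>g. m powr r + r * m powr (r - 1) * (h g \<omega> - m) \<partial>Q) \<le> (\<integral>g. h g \<omega> powr r \<partial>Q)"
        using hi[OF w] hri[OF w] h_bd[OF _ w] m r by (intro integral_mono powr_above_tangent) auto
      moreover have "(\<integral>g. m powr r + r * m powr (r - 1) * (h g \<omega> - m) \<partial>Q) = m powr r * W"
        using hi[OF w] W by (simp add: m_def flip: W_def)
      ultimately have "m powr r * W \<le> (\<integral>g. h g \<omega> powr r \<partial>Q)" by simp
      then have 1: "W powr (r - 1) * (m powr r * W) \<le> W powr (r - 1) * (\<integral>g. h g \<omega> powr r \<partial>Q)"
        by (intro mult_left_mono) auto
      have "\<bar>Z \<omega>\<bar> powr r \<le> (W * m) powr r"
        using Z(2)[OF w] W r by (intro powr_mono2) (auto simp: m_def)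
      also have "\<dots> = W powr (r - 1) * (m powr r * W)"
        using W m powr_mult_base[of W "r - 1"] by (simp add: powr_mult mult_ac)
      finally show ?thesis using 1 by linarith
    qed
    have PI: "integrable (Q \<Otimes>\<^sub>M M) (\<lambda>(g, \<omega>). h g \<omega> powr r)"
      using h_bd r by (intro QM.integrable_const_bound[where B="H powr r"])
        (auto intro!: powr_mono2 AE_I2 simp: space_pair_measure)
    have "(\<integral>\<omega>. \<bar>Z \<omega>\<bar> powr r \<partial>M) \<le> (\<integral>\<omega>. W powr (r - 1) * (\<integral>g. h g \<omega> powr r \<partial>Q) \<partial>M)"
      using pw Z r integrable_snd[OF PI] by (intro integral_mono integrable_Bdd[OF Bdd_powr[OF Z(1)]] integrable_mult_right) auto
    also have "\<dots> = W powr (r - 1) * (\<integral>g. (\<integral>\<omega>. h g \<omega> powr r \<partial>M) \<partial>Q)"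
      using Fubini_integral[OF PI] by simp
    also have "\<dots> \<le> W powr (r - 1) * (\<integral>g. C powr r \<partial>Q)"
    proof (intro mult_left_mono integral_mono)
      show "integrable Q (\<lambda>g. \<integral>\<omega>. h g \<omega> powr r \<partial>M)" using integrable_fst[OF PI] by simp
      fix g assume g: "g \<in> space Q"
      have "(\<integral>\<omega>. h g \<omega> powr r \<partial>M) = (\<integral>\<omega>. \<bar>h g \<omega>\<bar> powr r \<partial>M)"
        using h_bd[OF g] by (intro Bochner_Integration.integral_cong) auto
      with C(2)[OF g] show "(\<integral>\<omega>. h g \<omega> powr r \<partial>M) \<le> C powr r" by (simp add: Lr_le_iff[OF C(1)])
    qed auto
    also have "\<dots> = (W * C) powr r"
      using W C powr_mult_base[of W "r - 1"] by (simp add: powr_mult mult_ac flip: W_def)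
    finally show ?thesis using W C by (subst Lr_le_iff) (auto simp: W_def)
  qed
qed

text \<open>A sub-Gaussian Laplace transform bounds all moments: \<open>y\<^sup>r \<le> r\<^sup>r e\<^sup>y\<close>, used with \<open>y = \<bar>Z\<bar> / s\<close>.\<close>

lemma Lr_subgaussian:
  assumes Z: "Z \<in> Bdd M" and s: "s \<ge> 0"
    and exp_mom: "\<And>t. (\<integral>\<^sup>+\<omega>. ennreal (exp (t * Z \<omega>)) \<partial>M) \<le> ennreal (exp (t\<^sup>2 * s\<^sup>2 / 2))"
  shows "Lr_norm M r Z \<le> 4 * r * s"
proof -
  \<comment> \<open>The choice \<open>t = 1 / s\<close> fails for \<open>s = 0\<close>; hence the detour through \<open>s' > s\<close>.\<close>
  have main: "Lr_norm M r Z \<le> 4 * r * s'" if s': "s' > s" for s'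
  proof -
    have s'0: "s' > 0" using s s' by simp
    have E: "expectation (\<lambda>\<omega>. exp (t * Z \<omega>)) \<le> 2" and I: "integrable M (\<lambda>\<omega>. exp (t * Z \<omega>))"
      if t: "\<bar>t\<bar> = 1 / s'" for t
    proof -
      have "t\<^sup>2 * s\<^sup>2 \<le> 1"
      proof -
        have "\<bar>t * s\<bar> \<le> 1" using t s s' s'0 by (simp add: abs_mult)
        then show ?thesis by (metis abs_1 power2_le_iff_abs_le power_mult_distrib power_one abs_ge_zero zero_le_one power_mono one_power2 power2_abs)
      qed
      then have "exp (t\<^sup>2 * s\<^sup>2 / 2) \<le> exp (1 / 2)" by simp
      also have "exp (1 / 2 :: real) \<le> 2"
        by (rule real_le_rsqrt[of "exp (1/2)" 4, simplified], use exp_le in \<open>simp add: power2_eq_square flip: exp_add\<close>)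
      finally have 1: "(\<integral>\<^sup>+\<omega>. ennreal (exp (t * Z \<omega>)) \<partial>M) \<le> ennreal 2"
        using exp_mom[of t] by (meson ennreal_leI order_trans)
      show I: "integrable M (\<lambda>\<omega>. exp (t * Z \<omega>))"
        using Z 1 by (intro integrableI_nonneg) (auto intro: le_less_trans)
      then show "expectation (\<lambda>\<omega>. exp (t * Z \<omega>)) \<le> 2"
        using 1 by (simp add: nn_integral_eq_integral flip: ennreal_numeral)
    qed
    have pw: "\<bar>Z \<omega>\<bar> powr r \<le> (s' * r) powr r * (exp (1 / s' * Z \<omega>) + exp (- 1 / s' * Z \<omega>))" for \<omega>
    proof -
      define y where "y = \<bar>Z \<omega>\<bar> / s'"
      have y: "0 \<le> y" unfolding y_def using s'0 by simp
      have "y / r \<le> exp (y / r)" using exp_ge_add_one_self[of "y / r"] by linarith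
      then have "y \<le> r * exp (y / r)" using r by (simp add: divide_le_eq mult.commute)
      then have "(s' * y) powr r \<le> (s' * r * exp (y / r)) powr r"
        using r y s'0 by (intro powr_mono2) auto
      also have "\<dots> = (s' * r) powr r * exp y"
        using r s'0 by (simp add: powr_mult exp_powr_real)
      also have "exp y \<le> exp (1 / s' * Z \<omega>) + exp (- 1 / s' * Z \<omega>)"
        unfolding y_def by (cases "Z \<omega> \<ge> 0") (auto simp: add_increasing add_increasing2)
      finally show ?thesis using s'0 by (simp add: y_def mult_left_mono)
    qed
    have "(\<integral>\<omega>. \<bar>Z \<omega>\<bar> powr r \<partial>M) \<le> (\<integral>\<omega>. (s' * r) powr r * (exp (1 / s' * Z \<omega>) + exp (- 1 / s' * Z \<omega>)) \<partial>M)"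
      using Z r pw I[of "1 / s'"] I[of "- 1 / s'"] s'0
      by (intro integral_mono integrable_Bdd[OF Bdd_powr] integrable_mult_right Bochner_Integration.integrable_add) auto
    also have "\<dots> = (s' * r) powr r * (expectation (\<lambda>\<omega>. exp (1 / s' * Z \<omega>)) + expectation (\<lambda>\<omega>. exp (- 1 / s' * Z \<omega>)))"
      using I[of "1 / s'"] I[of "- 1 / s'"] s'0 by simp
    also have "\<dots> \<le> (s' * r) powr r * (2 + 2)"
      using E[of "1 / s'"] E[of "- 1 / s'"] s'0 by (intro mult_left_mono add_mono) auto
    also have "\<dots> \<le> (s' * r) powr r * 4 powr r"
      using powr_mono[of 1 r 4] r by (intro mult_left_mono) auto
    also have "\<dots> = (4 * r * s') powr r" using r s'0 by (simp add: powr_mult mult_ac)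
    finally show ?thesis using r s'0 by (subst Lr_le_iff) auto
  qed
  show ?thesis
  proof (rule field_le_epsilon)
    fix e :: real assume e: "e > 0"
    have "Lr_norm M r Z \<le> 4 * r * (s + e / (4 * r))" using main[of "s + e / (4 * r)"] e r by simp
    also have "\<dots> = 4 * r * s + e" using r by (simp add: distrib_left)
    finally show "Lr_norm M r Z \<le> 4 * r * s + e" .
  qed
qed

end

end

section \<open>Measurability in the parameter of a family of kernels\<close>

text \<open>The image of \<open>L x\<close> under \<open>y \<mapsto> (x, y)\<close> is again a kernel, and against it the integrand no longer
  depends on \<open>x\<close>.\<close>

lemma integral_kernel_measurable:
  fixes f :: "'b \<Rightarrow> 'c \<Rightarrow> real"
  assumes f [measurable]: "(\<lambda>(x, y). f x y) \<in> borel_measurable (T \<Otimes>\<^sub>M S)"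
    and L: "L \<in> T \<rightarrow>\<^sub>M prob_algebra S"
  shows "(\<lambda>x. \<integral>y. f x y \<partial>L x) \<in> borel_measurable T"
proof -
  have "(\<lambda>x. distr (L x) (T \<Otimes>\<^sub>M S) (Pair x)) \<in> T \<rightarrow>\<^sub>M subprob_algebra (T \<Otimes>\<^sub>M S)"
    by (rule measurable_distr2[OF _ measurable_prob_algebraD[OF L]]) simp
  from measurable_compose[OF this integral_measurable_subprob_algebra[OF f]]
  have "(\<lambda>x. \<integral>p. (case p of (x, y) \<Rightarrow> f x y) \<partial>distr (L x) (T \<Otimes>\<^sub>M S) (Pair x)) \<in> borel_measurable T" .
  also have "?this \<longleftrightarrow> (\<lambda>x. \<integral>y. f x y \<partial>L x) \<in> borel_measurable T"
  proof (rule measurable_cong)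
    fix x assume x: "x \<in> space T"
    have "Pair x \<in> L x \<rightarrow>\<^sub>M T \<Otimes>\<^sub>M S"
      using measurable_Pair1'[OF x, of S] measurable_cong_sets[OF ProbD(2)[OF measurable_space[OF L x]] refl] by blast
    from integral_distr[OF this f] show "(\<integral>p. (case p of (x, y) \<Rightarrow> f x y) \<partial>distr (L x) (T \<Otimes>\<^sub>M S) (Pair x)) = (\<integral>y. f x y \<partial>L x)"
      by simp
  qed
  finally show ?thesis .
qed

text \<open>Contracting kernels \<open>K t\<close> depending measurably on a parameter, with their invariant laws
  \<open>\<rho> t\<close>. No measurability of \<open>\<rho>\<close> is assumed: contraction makes \<open>\<rho>\<close> a pointwise limit of
  measurable functions of the parameter.\<close>

locale kernel_family =
  fixes T :: "'t measure" and S :: "'a measure" and K :: "'t \<Rightarrow> 'a \<Rightarrow> 'a measure"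
    and N :: nat and b :: real and \<rho> :: "'t \<Rightarrow> 'a measure"
  assumes joint_kernel: "(\<lambda>(t, x). K t x) \<in> T \<Otimes>\<^sub>M S \<rightarrow>\<^sub>M prob_algebra S"
    and contracting: "\<And>t. t \<in> space T \<Longrightarrow> contracting_kernel S (K t) N b"
    and rho_Prob: "\<And>t. t \<in> space T \<Longrightarrow> \<rho> t \<in> Prob S"
    and rho_invariant: "\<And>t. t \<in> space T \<Longrightarrow> \<rho> t \<bind> K t = \<rho> t"
begin

lemma kernel_op_joint_measurable:
  assumes "(\<lambda>(t, x). g t x) \<in> borel_measurable (T \<Otimes>\<^sub>M S)"
  shows "(\<lambda>(t, x). kernel_op (K t) (g t) x) \<in> borel_measurable (T \<Otimes>\<^sub>M S)"
proof -
  have 1: "(\<lambda>(p, y). g (fst p) y) \<in> borel_measurable ((T \<Otimes>\<^sub>M S) \<Otimes>\<^sub>M S)"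
    using assms by measurable
  have "(\<lambda>p. \<integral>y. g (fst p) y \<partial>(case p of (t, x) \<Rightarrow> K t x)) \<in> borel_measurable (T \<Otimes>\<^sub>M S)"
    by (rule integral_kernel_measurable[OF 1 joint_kernel])
  then show ?thesis unfolding kernel_op_def by (simp add: split_beta')
qed

lemma pow_joint_measurable:
  assumes "f \<in> borel_measurable S"
  shows "(\<lambda>(t, x). (kernel_op (K t) ^^ m) f x) \<in> borel_measurable (T \<Otimes>\<^sub>M S)"
proof (induction m)
  case 0
  then show ?case using assms by simp
next
  case (Suc m)
  from kernel_op_joint_measurable[OF Suc] show ?case by simp
qed

lemma poisson_joint_measurable:
  assumes f: "f \<in> borel_measurable S" and z: "z \<in> space S"
  shows "(\<lambda>(t, x). poisson (K t) z m f x) \<in> borel_measurable (T \<Otimes>\<^sub>M S)"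
proof -
  have "(\<lambda>p. (kernel_op (K (fst p)) ^^ i) f (snd p)) \<in> borel_measurable (T \<Otimes>\<^sub>M S)" for i
    using pow_joint_measurable[OF f, of i] by (simp add: split_beta')
  moreover have "(\<lambda>p. (kernel_op (K (fst p)) ^^ i) f z) \<in> borel_measurable (T \<Otimes>\<^sub>M S)" for i
  proof -
    have "(\<lambda>p. (fst p, z)) \<in> T \<Otimes>\<^sub>M S \<rightarrow>\<^sub>M T \<Otimes>\<^sub>M S" using z by measurable
    from measurable_compose[OF this pow_joint_measurable[OF f, of i]] show ?thesis by simp
  qed
  ultimately show ?thesis unfolding poisson_def split_beta' by measurable
qed

lemma rho_integral_measurable:
  assumes f: "f \<in> Bdd S"
  shows "(\<lambda>t. \<integral>x. f x \<partial>\<rho> t) \<in> borel_measurable T"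
proof (cases "space T = {}")
  case False
  then obtain t0 where t0: "t0 \<in> space T" by auto
  then obtain z where z: "z \<in> space S" using ProbD(4)[OF rho_Prob] by blast
  interpret t0: contracting_kernel S "K t0" N b by (rule contracting[OF t0])
  obtain c where c: "\<And>x. x \<in> space S \<Longrightarrow> \<bar>f x\<bar> \<le> c" using f BddE by metis
  have fO: "f \<in> Osc_le S (2 * c)" by (rule Osc_le_of_bound[OF f c])
  show ?thesis
  proof (rule borel_measurable_LIMSEQ_real)
    fix j show "(\<lambda>t. (kernel_op (K t) ^^ (N * j)) f z) \<in> borel_measurable T"
      using measurable_compose[OF measurable_Pair2'[OF z, of T] pow_joint_measurable[OF Bdd_measurable[OF f]]]
      by simp
  next
    fix t assume t: "t \<in> space T"
    interpret t: contracting_kernel S "K t" N b by (rule contracting[OF t])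
    have "(\<lambda>j. b ^ j * (2 * c)) \<longlonglongrightarrow> 0 * (2 * c)"
      using t.b_nonneg t.b_less_1 by (intro tendsto_intros LIMSEQ_realpow_zero)
    then have null: "(\<lambda>j. b ^ j * (2 * c)) \<longlonglongrightarrow> 0" by simp
    have "\<forall>j. norm ((kernel_op (K t) ^^ (N * j)) f z - (\<integral>x. f x \<partial>\<rho> t)) \<le> b ^ j * (2 * c)"
      using t.pow_near_invariant[OF rho_Prob[OF t] rho_invariant[OF t] fO z] by simp
    from Lim_null_comparison[OF always_eventually[OF this] null]
    show "(\<lambda>j. (kernel_op (K t) ^^ (N * j)) f z) \<longlonglongrightarrow> (\<integral>x. f x \<partial>\<rho> t)"
      by (rule LIM_zero_cancel)
  qed
qed (simp add: measurable_def)

lemma rho_measurable: "\<rho> \<in> T \<rightarrow>\<^sub>M prob_algebra S"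
proof (rule measurable_prob_algebraI)
  show "prob_space (\<rho> t)" if "t \<in> space T" for t using ProbD(1)[OF rho_Prob[OF that]] .
  show "\<rho> \<in> T \<rightarrow>\<^sub>M subprob_algebra S"
  proof (rule measurable_subprob_algebra)
    fix A assume A: "A \<in> sets S"
    have "(\<lambda>x. indicator A x :: real) \<in> Bdd S" using A by (auto simp: Bdd_iff intro!: exI[of _ 1] split: split_indicator)
    from rho_integral_measurable[OF this]
    have "(\<lambda>t. ennreal (\<integral>x. indicator A x \<partial>\<rho> t)) \<in> borel_measurable T" by measurable
    also have "?this \<longleftrightarrow> (\<lambda>t. emeasure (\<rho> t) A) \<in> borel_measurable T"
    proof (rule measurable_cong)
      fix t assume t: "t \<in> space T"
      interpret prob_space "\<rho> t" using ProbD(1)[OF rho_Prob[OF t]] .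
      show "ennreal (\<integral>x. indicator A x \<partial>\<rho> t) = emeasure (\<rho> t) A"
        using A ProbD(2,3)[OF rho_Prob[OF t]] sets.sets_into_space[OF A] by (simp add: emeasure_eq_measure Int_absorb2)
    qed
    finally show "(\<lambda>t. emeasure (\<rho> t) A) \<in> borel_measurable T" .
  qed (use ProbD[OF rho_Prob] in \<open>auto intro!: prob_space_imp_subprob_space\<close>)
qed

end

section \<open>One step of a chain with random transitions\<close>

context prob_space
begin

text \<open>The conditional law of \<open>Y\<close> given \<open>F\<close> being \<open>L\<close>, events \<open>{Y \<in> A}\<close> can be replaced by
  functions of \<open>Y\<close> and of \<open>F\<close>-measurable quantities: both sides are integrals for the joint law of
  the identity (on \<open>F\<close>) and \<open>Y\<close>, and rectangles determine that law.\<close>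

lemma integral_conditional_law:
  assumes F: "subalgebra M F" and Y [measurable]: "Y \<in> M \<rightarrow>\<^sub>M S"
    and L: "L \<in> F \<rightarrow>\<^sub>M prob_algebra S"
    and law: "\<And>A. A \<in> sets S \<Longrightarrow>
      AE \<omega> in M. real_cond_exp M F (indicator (Y -` A \<inter> space M)) \<omega> = measure (L \<omega>) A"
    and H: "H \<in> borel_measurable (F \<Otimes>\<^sub>M S)"
  shows "(\<integral>\<^sup>+\<omega>. H (\<omega>, Y \<omega>) \<partial>M) = (\<integral>\<^sup>+\<omega>. (\<integral>\<^sup>+y. H (\<omega>, y) \<partial>L \<omega>) \<partial>M)"
proof -
  interpret finite_measure_subalgebra M F by unfold_locales (fact F)
  let ?R = "restr_to_subalg M F"
  let ?FS = "F \<Otimes>\<^sub>M S"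
  let ?\<kappa> = "\<lambda>\<omega>. distr (L \<omega>) ?FS (Pair \<omega>)"
  have sp: "space F = space M" using F by (simp add: subalgebra_def)
  have L': "L \<in> F \<rightarrow>\<^sub>M subprob_algebra S" by (rule measurable_prob_algebraD[OF L])
  have pairM [measurable]: "(\<lambda>\<omega>. (\<omega>, Y \<omega>)) \<in> M \<rightarrow>\<^sub>M ?FS"
    by (intro measurable_Pair measurable_from_subalg[OF F measurable_ident[unfolded id_def]] Y)
  have Lp: "prob_space (L \<omega>)" "sets (L \<omega>) = sets S" "space (L \<omega>) = space S" if "\<omega> \<in> space M" for \<omega>
    using ProbD[OF measurable_space[OF L]] that sp by auto
  have Pm: "Pair \<omega> \<in> L \<omega> \<rightarrow>\<^sub>M ?FS" if "\<omega> \<in> space M" for \<omega>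
    using measurable_Pair1'[of \<omega> F S] that sp measurable_cong_sets[OF Lp(2)[OF that] refl] by blast
  have \<kappa>F: "?\<kappa> \<in> F \<rightarrow>\<^sub>M subprob_algebra ?FS"
    by (rule measurable_distr2[OF _ L']) simp
  then have \<kappa>: "?\<kappa> \<in> ?R \<rightarrow>\<^sub>M subprob_algebra ?FS"
    using measurable_cong_sets[OF sets_restr_to_subalg[OF F] refl] by blast
  have Rne: "space ?R \<noteq> {}" using not_empty by (simp add: space_restr_to_subalg)
  let ?Q1 = "distr M ?FS (\<lambda>\<omega>. (\<omega>, Y \<omega>))" and ?Q2 = "?R \<bind> ?\<kappa>"
  have sets2: "sets ?Q2 = sets ?FS" by (rule sets_bind[OF _ Rne]) simp
  have "?Q1 = ?Q2"
  proof (rule measure_eqI_generator_eq[where \<Omega>="space F \<times> space S" and A="\<lambda>_. space F \<times> space S"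
        and E="{a \<times> b | a b. a \<in> sets F \<and> b \<in> sets S}"])
    show "Int_stable {a \<times> b | a b. a \<in> sets F \<and> b \<in> sets S}" by (rule Int_stable_pair_measure_generator)
    show "{a \<times> b | a b. a \<in> sets F \<and> b \<in> sets S} \<subseteq> Pow (space F \<times> space S)"
      by (rule pair_measure_closed)
    show "sets ?Q1 = sigma_sets (space F \<times> space S) {a \<times> b | a b. a \<in> sets F \<and> b \<in> sets S}"
      by (simp add: sets_pair_measure)
    show "sets ?Q2 = sigma_sets (space F \<times> space S) {a \<times> b | a b. a \<in> sets F \<and> b \<in> sets S}"
      unfolding sets2 by (simp add: sets_pair_measure)
    show "emeasure ?Q1 (space F \<times> space S) \<noteq> \<infinity>"
      by (subst emeasure_distr) (auto intro!: sets.top simp flip: space_pair_measure)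
    show "range (\<lambda>_. space F \<times> space S) \<subseteq> {a \<times> b | a b. a \<in> sets F \<and> b \<in> sets S}" by auto
    fix X assume "X \<in> {a \<times> b | a b. a \<in> sets F \<and> b \<in> sets S}"
    then obtain A B where X: "X = A \<times> B" and A: "A \<in> sets F" and B: "B \<in> sets S" by auto
    have AM: "A \<in> sets M" using A F by (auto simp: subalgebra_def)
    let ?I = "indicator (Y -` B \<inter> space M) :: _ \<Rightarrow> real"
    have IB: "Y -` B \<inter> space M \<in> sets M" using B by measurable
    have mB: "(\<lambda>\<omega>. measure (L \<omega>) B) \<in> borel_measurable F"
      using measurable_compose[OF L' measurable_measure_subprob_algebra[OF B]] .
    have mBM: "(\<lambda>\<omega>. measure (L \<omega>) B) \<in> borel_measurable M" by (rule measurable_from_subalg[OF F mB])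
    have "emeasure ?Q1 X = emeasure M (A \<inter> (Y -` B \<inter> space M))"
      unfolding X using A B AM sets.sets_into_space[OF AM]
      by (subst emeasure_distr) (auto intro!: arg_cong[where f="emeasure M"])
    also have "\<dots> = ennreal (\<integral>\<omega>\<in>A. ?I \<omega> \<partial>M)"
      using AM IB sets.sets_into_space[OF AM]
      by (simp add: set_lebesgue_integral_def emeasure_eq_measure Int_absorb2 flip: indicator_inter_arith)
    also have "(\<integral>\<omega>\<in>A. ?I \<omega> \<partial>M) = (\<integral>\<omega>\<in>A. real_cond_exp M F ?I \<omega> \<partial>M)"
      using IB A by (intro real_cond_exp_intA) (auto simp: integrable_indicator_iff emeasure_eq_measure)
    also have "\<dots> = (\<integral>\<omega>\<in>A. measure (L \<omega>) B \<partial>M)"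
      using law[OF B] mBM AM unfolding set_lebesgue_integral_def
      by (intro integral_cong_AE) (auto elim: eventually_mono intro: measurable_from_subalg[OF F])
    also have "ennreal \<dots> = (\<integral>\<^sup>+\<omega>. indicator A \<omega> * emeasure (L \<omega>) B \<partial>M)"
    proof -
      have "(\<integral>\<^sup>+\<omega>. indicator A \<omega> * emeasure (L \<omega>) B \<partial>M) = (\<integral>\<^sup>+\<omega>. ennreal (indicator A \<omega> *\<^sub>R measure (L \<omega>) B) \<partial>M)"
        using Lp(1) by (intro nn_integral_cong)
          (auto simp: finite_measure.emeasure_eq_measure prob_space.finite_measure split: split_indicator)
      also have "\<dots> = ennreal (\<integral>\<omega>. indicator A \<omega> *\<^sub>R measure (L \<omega>) B \<partial>M)"
      proof (rule nn_integral_eq_integral)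
        show "integrable M (\<lambda>\<omega>. indicator A \<omega> *\<^sub>R measure (L \<omega>) B)"
          using mBM AM Lp(1) by (intro integrable_const_bound[where B=1])
            (auto intro!: AE_I2 simp: prob_space.prob_le_1 split: split_indicator)
      qed auto
      finally show ?thesis by (simp add: set_lebesgue_integral_def)
    qed
    also have "\<dots> = (\<integral>\<^sup>+\<omega>. emeasure (?\<kappa> \<omega>) X \<partial>M)"
    proof (rule nn_integral_cong)
      fix \<omega> assume w: "\<omega> \<in> space M"
      have "emeasure (?\<kappa> \<omega>) X = emeasure (L \<omega>) (Pair \<omega> -` X \<inter> space (L \<omega>))"
        unfolding X using A B by (intro emeasure_distr Pm[OF w]) auto
      also have "Pair \<omega> -` X \<inter> space (L \<omega>) = (if \<omega> \<in> A then B else {})"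
        unfolding X Lp(3)[OF w] using sets.sets_into_space[OF B] by auto
      finally show "indicator A \<omega> * emeasure (L \<omega>) B = emeasure (?\<kappa> \<omega>) X" by simp
    qed
    also have "\<dots> = (\<integral>\<^sup>+\<omega>. emeasure (?\<kappa> \<omega>) X \<partial>?R)"
      using measurable_compose[OF \<kappa>F measurable_emeasure_subprob_algebra, of X] A B
      by (intro nn_integral_subalgebra2[OF F, symmetric]) (auto simp: X)
    also have "\<dots> = emeasure ?Q2 X"
      using A B by (intro emeasure_bind[OF Rne \<kappa>, symmetric]) (auto simp: X)
    finally show "emeasure ?Q1 X = emeasure ?Q2 X" .
  qed auto
  have "(\<integral>\<^sup>+\<omega>. H (\<omega>, Y \<omega>) \<partial>M) = (\<integral>\<^sup>+p. H p \<partial>?Q1)"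
    using H by (subst nn_integral_distr) auto
  also have "\<dots> = (\<integral>\<^sup>+p. H p \<partial>?Q2)" using \<open>?Q1 = ?Q2\<close> by simp
  also have "\<dots> = (\<integral>\<^sup>+\<omega>. (\<integral>\<^sup>+p. H p \<partial>?\<kappa> \<omega>) \<partial>?R)" by (rule nn_integral_bind[OF H \<kappa>])
  also have "\<dots> = (\<integral>\<^sup>+\<omega>. (\<integral>\<^sup>+p. H p \<partial>?\<kappa> \<omega>) \<partial>M)"
    using measurable_compose[OF \<kappa>F nn_integral_measurable_subprob_algebra[OF H]]
    by (intro nn_integral_subalgebra2[OF F])
  also have "\<dots> = (\<integral>\<^sup>+\<omega>. (\<integral>\<^sup>+y. H (\<omega>, y) \<partial>L \<omega>) \<partial>M)"
    using H by (intro nn_integral_cong nn_integral_distr Pm) auto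
  finally show ?thesis .
qed

end

text \<open>Hoeffding's lemma on the interval of length \<open>2 a\<close> around the mean, so that
  \<open>(2 a)\<^sup>2 / 8 = a\<^sup>2 / 2\<close>; it is extended from \<open>t > 0\<close> to all \<open>t\<close> by the symmetry \<open>f \<mapsto> - f\<close>.\<close>

lemma Hoeffding_Prob:
  assumes mu: "\<mu> \<in> Prob S" and f: "f \<in> Osc_le S a"
  shows "(\<integral>\<^sup>+x. ennreal (exp (t * (f x - (\<integral>y. f y \<partial>\<mu>)))) \<partial>\<mu>) \<le> ennreal (exp (t\<^sup>2 * a\<^sup>2 / 2))"
proof -
  interpret prob_space \<mu> using ProbD(1)[OF mu] .
  have pos: "(\<integral>\<^sup>+x. ennreal (exp (t * (f x - (\<integral>y. f y \<partial>\<mu>)))) \<partial>\<mu>) \<le> ennreal (exp (t\<^sup>2 * a\<^sup>2 / 2))"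
    if t: "t > 0" and f: "f \<in> Osc_le S a" for t f
  proof -
    let ?m = "\<integral>y. f y \<partial>\<mu>"
    have b: "\<bar>?m - f x\<bar> \<le> a" if "x \<in> space S" for x
      using Prob_integral_dist[OF mu Osc_leD(1)[OF f], of "f x" a] Osc_leD(2)[OF f] that by blast
    interpret interval_bounded_random_variable \<mu> f "?m - a" "?m + a"
    proof
      show "random_variable borel f"
        using Bdd_measurable[OF Osc_leD(1)[OF f]] measurable_cong_sets[OF ProbD(2)[OF mu] refl] by blast
      show "AE x in \<mu>. f x \<in> {?m - a..?m + a}"
        using b ProbD(3)[OF mu] by (intro AE_I2) (auto simp: abs_le_iff algebra_simps)
    qed
    have "(\<integral>\<^sup>+x. ennreal (exp (t * (f x - ?m))) \<partial>\<mu>) \<le> ennreal (exp (t\<^sup>2 * (?m + a - (?m - a))\<^sup>2 / 8))"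
      by (rule Hoeffdings_lemma_nn_integral[OF t])
    also have "t\<^sup>2 * (?m + a - (?m - a))\<^sup>2 / 8 = t\<^sup>2 * a\<^sup>2 / 2"
      by (simp add: power2_eq_square algebra_simps)
    finally show ?thesis .
  qed
  consider "t > 0" | "t = 0" | "t < 0" by linarith
  then show ?thesis
  proof cases
    case 1
    then show ?thesis using pos f by blast
  next
    case 2
    then show ?thesis by (simp add: emeasure_space_1)
  next
    case 3
    have "(\<lambda>x. (-1) * f x) \<in> Osc_le S (\<bar>-1\<bar> * a)" by (rule Osc_le_scale[OF f])
    then have "(\<lambda>x. - f x) \<in> Osc_le S a" by simp
    from pos[OF _ this, of "- t"] 3 show ?thesis by (simp add: algebra_simps)
  qed
qed

context prob_space
begin

text \<open>Conditionally on \<open>F\<close>, the function \<open>u \<omega>\<close> is fixed and \<open>Y\<close> has law \<open>L \<omega>\<close>, so Hoeffding's lemma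
  applies inside the conditional expectation.\<close>

lemma exp_martingale_step:
  assumes F: "subalgebra M F" and Y: "Y \<in> M \<rightarrow>\<^sub>M S"
    and L: "L \<in> F \<rightarrow>\<^sub>M prob_algebra S"
    and law: "\<And>A. A \<in> sets S \<Longrightarrow>
      AE \<omega> in M. real_cond_exp M F (indicator (Y -` A \<inter> space M)) \<omega> = measure (L \<omega>) A"
    and G: "G \<in> borel_measurable F"
    and u: "(\<lambda>(\<omega>, y). u \<omega> y) \<in> borel_measurable (F \<Otimes>\<^sub>M S)"
    and osc: "\<And>\<omega>. \<omega> \<in> space M \<Longrightarrow> u \<omega> \<in> Osc_le S a"
  shows "(\<integral>\<^sup>+\<omega>. G \<omega> * ennreal (exp (t * (u \<omega> (Y \<omega>) - (\<integral>y. u \<omega> y \<partial>L \<omega>)))) \<partial>M)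
      \<le> ennreal (exp (t\<^sup>2 * a\<^sup>2 / 2)) * (\<integral>\<^sup>+\<omega>. G \<omega> \<partial>M)"
proof -
  have sp: "space F = space M" using F by (simp add: subalgebra_def)
  have m [measurable]: "(\<lambda>\<omega>. \<integral>y. u \<omega> y \<partial>L \<omega>) \<in> borel_measurable F"
    by (rule integral_kernel_measurable[OF u L])
  note [measurable] = u G
  let ?H = "\<lambda>p. G (fst p) * ennreal (exp (t * (u (fst p) (snd p) - (\<integral>y. u (fst p) y \<partial>L (fst p)))))"
  have H: "?H \<in> borel_measurable (F \<Otimes>\<^sub>M S)" by measurable
  have "(\<integral>\<^sup>+\<omega>. G \<omega> * ennreal (exp (t * (u \<omega> (Y \<omega>) - (\<integral>y. u \<omega> y \<partial>L \<omega>)))) \<partial>M)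
      = (\<integral>\<^sup>+\<omega>. (\<integral>\<^sup>+y. G \<omega> * ennreal (exp (t * (u \<omega> y - (\<integral>y. u \<omega> y \<partial>L \<omega>)))) \<partial>L \<omega>) \<partial>M)"
    using integral_conditional_law[OF F Y L law H] by simp
  also have "\<dots> \<le> (\<integral>\<^sup>+\<omega>. ennreal (exp (t\<^sup>2 * a\<^sup>2 / 2)) * G \<omega> \<partial>M)"
  proof (rule nn_integral_mono)
    fix \<omega> assume w: "\<omega> \<in> space M"
    have Lw: "L \<omega> \<in> Prob S" using measurable_space[OF L] w sp by simp
    have "u \<omega> \<in> borel_measurable S" using osc[OF w] Osc_leD(1) Bdd_measurable by blast
    then have um: "u \<omega> \<in> borel_measurable (L \<omega>)" using measurable_cong_sets[OF ProbD(2)[OF Lw] refl] by blast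
    have "(\<integral>\<^sup>+y. G \<omega> * ennreal (exp (t * (u \<omega> y - (\<integral>y. u \<omega> y \<partial>L \<omega>)))) \<partial>L \<omega>)
        = G \<omega> * (\<integral>\<^sup>+y. ennreal (exp (t * (u \<omega> y - (\<integral>y. u \<omega> y \<partial>L \<omega>)))) \<partial>L \<omega>)"
      using um by (intro nn_integral_cmult) auto
    also have "\<dots> \<le> G \<omega> * ennreal (exp (t\<^sup>2 * a\<^sup>2 / 2))"
      by (intro mult_left_mono Hoeffding_Prob[OF Lw osc[OF w]]) auto
    finally show "(\<integral>\<^sup>+y. G \<omega> * ennreal (exp (t * (u \<omega> y - (\<integral>y. u \<omega> y \<partial>L \<omega>)))) \<partial>L \<omega>)
        \<le> ennreal (exp (t\<^sup>2 * a\<^sup>2 / 2)) * G \<omega>" by (simp add: mult.commute)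
  qed
  also have "\<dots> = ennreal (exp (t\<^sup>2 * a\<^sup>2 / 2)) * (\<integral>\<^sup>+\<omega>. G \<omega> \<partial>M)"
    by (intro nn_integral_cmult measurable_from_subalg[OF F G])
  finally show ?thesis .
qed

end

section \<open>Chains driven by slowly varying parameters\<close>

lemma sum_inverse_sqrt_le: "(\<Sum>p\<le>n. 1 / sqrt (real (p + 1))) \<le> 2 * sqrt (real (n + 1))"
proof (induction n)
  case (Suc n)
  define a b where "a = sqrt (real (n + 1))" and "b = sqrt (real (Suc n + 1))"
  have b: "b > 0" "a \<le> b" "a > 0" by (auto simp: a_def b_def)
  have "b * b - a * a = 1" by (simp add: a_def b_def)
  then have "(b - a) * (b + a) = 1" by (simp add: algebra_simps)
  moreover have "(b - a) * (b + a) \<le> (b - a) * (2 * b)" using b by (intro mult_left_mono) auto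
  ultimately have "1 \<le> 2 * (b - a) * b" by (simp only: mult_ac)
  then have "1 / b \<le> 2 * (b - a)" using b by (simp only: divide_le_eq if_True)
  then have "2 * a + 1 / b \<le> 2 * b" unfolding right_diff_distrib le_diff_eq by (simp only: add.commute)
  moreover have "(\<Sum>p\<le>Suc n. 1 / sqrt (real (p + 1))) = (\<Sum>p\<le>n. 1 / sqrt (real (p + 1))) + 1 / b"
    by (simp add: b_def)
  ultimately show ?case using Suc unfolding a_def[symmetric] b_def[symmetric] by linarith
qed simp

lemma inverse_le_inverse_sqrt: "1 / real (p + 2) \<le> 1 / sqrt (real (p + 1))"
proof -
  have "sqrt (real (p + 1)) \<le> real (p + 1)" by (rule real_le_lsqrt) (auto simp: power2_eq_square)
  then show ?thesis by (intro divide_left_mono) auto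
qed

lemma events_of_subset: "(\<And>n. Y n \<in> M \<rightarrow>\<^sub>M S) \<Longrightarrow> events_of M S Y J \<subseteq> sets M"
  by (auto simp: events_of_def intro: measurable_sets)

lemma events_of_mono: "I \<subseteq> J \<Longrightarrow> events_of M S Y I \<subseteq> events_of M S Y J"
  unfolding events_of_def by blast

lemma measurable_sigma_events:
  assumes "\<And>n. Y n \<in> M \<rightarrow>\<^sub>M S" "n \<in> J" "events_of M S Y J \<subseteq> A" "A \<subseteq> sets M"
  shows "Y n \<in> sigma (space M) A \<rightarrow>\<^sub>M S"
proof (rule measurableI)
  have A: "A \<subseteq> Pow (space M)" using assms(4) sets.space_closed by blast
  then have sp: "space (sigma (space M) A) = space M" by simp
  fix x assume "x \<in> space (sigma (space M) A)"
  then show "Y n x \<in> space S" using measurable_space[OF assms(1)] sp by simp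
next
  have A: "A \<subseteq> Pow (space M)" using assms(4) sets.space_closed by blast
  fix B assume B: "B \<in> sets S"
  have "Y n -` B \<inter> space M \<in> events_of M S Y J" using assms(2) B by (auto simp: events_of_def)
  then show "Y n -` B \<inter> space (sigma (space M) A) \<in> sets (sigma (space M) A)" using assms(3) A by auto
qed

text \<open>A chain whose transition at time \<open>n\<close> is \<open>K (\<theta> n)\<close>, where the parameters \<open>\<theta>\<close> are measurable in the
  environment \<open>E\<close> and move by \<open>O(1 / n)\<close> as seen by the kernels, which is the speed at which
  empirical measures move. The levels \<open>l \<ge> 1\<close> of the interacting system are of this kind, with the empirical
  measures of the level below as parameters; level \<open>0\<close> is the case of a constant parameter.\<close>

locale driven_chain = prob_space M + kernel_family T S K N b \<rho>
  for M :: "'w measure" and T :: "'t measure" and S :: "'a measure" and K N b \<rho> +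
  fixes E :: "'w set set" and \<nu> :: "'a measure" and Y :: "nat \<Rightarrow> 'w \<Rightarrow> 'a"
    and \<theta> :: "nat \<Rightarrow> 'w \<Rightarrow> 't" and d :: real
  assumes E_sets: "E \<subseteq> sets M"
    and chain: "markov_chain_given M E S \<nu> (\<lambda>n \<omega>. K (\<theta> n \<omega>)) Y"
    and theta_measurable: "\<And>n. \<theta> n \<in> sigma (space M) E \<rightarrow>\<^sub>M T"
    and d_nonneg: "0 \<le> d"
    and slow: "\<And>n \<omega> g a x. \<omega> \<in> space M \<Longrightarrow> g \<in> Osc_le S a \<Longrightarrow> x \<in> space S \<Longrightarrow>
      \<bar>kernel_op (K (\<theta> (Suc n) \<omega>)) g x - kernel_op (K (\<theta> n \<omega>)) g x\<bar> \<le> 2 * d / real (n + 2) * a"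
begin

definition past :: "nat \<Rightarrow> 'w measure" where
  "past n = sigma (space M) (E \<union> events_of M S Y {..n})"

lemma Y_measurable [measurable]: "Y n \<in> M \<rightarrow>\<^sub>M S"
  using chain by (simp add: markov_chain_given_def)

lemma past_generators: "E \<union> events_of M S Y {..n} \<subseteq> sets M"
  using E_sets events_of_subset[of Y M S "{..n}"] Y_measurable by blast

lemma past_generators_Pow: "E \<union> events_of M S Y {..n} \<subseteq> Pow (space M)"
  using past_generators sets.space_closed by blast

lemma space_past [simp]: "space (past n) = space M"
  unfolding past_def using past_generators_Pow by (simp add: space_measure_of)

lemma sets_past: "sets (past n) = sigma_sets (space M) (E \<union> events_of M S Y {..n})"
  unfolding past_def using past_generators_Pow by (simp add: sets_measure_of)

lemma subalgebra_past: "subalgebra M (past n)"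
  unfolding subalgebra_def sets_past using sets.sigma_sets_subset[OF past_generators] by simp

lemma past_mono: "m \<le> n \<Longrightarrow> sets (past m) \<subseteq> sets (past n)"
  unfolding sets_past by (intro sigma_sets_mono' Un_mono order_refl events_of_mono) simp

lemma measurable_past_mono: "f \<in> past m \<rightarrow>\<^sub>M L \<Longrightarrow> m \<le> n \<Longrightarrow> f \<in> past n \<rightarrow>\<^sub>M L"
  using past_mono[of m n] by (auto simp: measurable_def)

lemma Y_past: "m \<le> n \<Longrightarrow> Y m \<in> past n \<rightarrow>\<^sub>M S"
  unfolding past_def by (rule measurable_sigma_events[where J="{..n}"]) (use past_generators in auto)

lemma theta_past: "\<theta> m \<in> past n \<rightarrow>\<^sub>M T"
proof -
  have "E \<subseteq> Pow (space M)" using past_generators_Pow by blast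
  then have "sets (sigma (space M) E) \<subseteq> sets (past n)" "space (sigma (space M) E) = space (past n)"
    unfolding sets_past by (auto intro: sigma_sets_mono'[THEN subsetD])
  then show ?thesis using theta_measurable[of m] by (auto simp: measurable_def)
qed

lemma theta_M: "\<theta> m \<in> M \<rightarrow>\<^sub>M T"
  using measurable_from_subalg[OF subalgebra_past theta_past] .

lemma theta_space: "\<omega> \<in> space M \<Longrightarrow> \<theta> n \<omega> \<in> space T"
  using measurable_space[OF theta_M] .

lemma Y_space: "\<omega> \<in> space M \<Longrightarrow> Y n \<omega> \<in> space S"
  using measurable_space[OF Y_measurable] .

lemma transition_past: "(\<lambda>\<omega>. K (\<theta> n \<omega>) (Y n \<omega>)) \<in> past n \<rightarrow>\<^sub>M prob_algebra S"
  using measurable_compose[OF measurable_Pair[OF theta_past Y_past[OF order_refl]] joint_kernel] by simp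

lemma transition_law:
  assumes "A \<in> sets S"
  shows "AE \<omega> in M. real_cond_exp M (past n) (indicator (Y (Suc n) -` A \<inter> space M)) \<omega>
    = measure (K (\<theta> n \<omega>) (Y n \<omega>)) A"
  using chain assms unfolding markov_chain_given_def past_def by blast

lemma contracting_at: "\<omega> \<in> space M \<Longrightarrow> contracting_kernel S (K (\<theta> n \<omega>)) N b"
  by (rule contracting[OF theta_space])

lemma b_bounds: "0 \<le> b" "b < 1"
proof -
  obtain \<omega> where "\<omega> \<in> space M" using not_empty by auto
  then interpret contracting_kernel S "K (\<theta> 0 \<omega>)" N b by (rule contracting_at)
  show "0 \<le> b" "b < 1" by (rule b_nonneg, rule b_less_1)
qed

definition C where "C = real N / (1 - b)"

lemma C_facts: "0 \<le> C" "C \<le> C\<^sup>2"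
proof -
  obtain \<omega> where "\<omega> \<in> space M" using not_empty by auto
  then interpret c: contracting_kernel S "K (\<theta> 0 \<omega>)" N b by (rule contracting_at)
  show "0 \<le> C" "C \<le> C\<^sup>2" using c.C_nonneg c.C_le_square by (simp_all add: c.C_def C_def)
qed

text \<open>Induction along the filtration \<open>past\<close>. Measurability of the partial sums in \<open>past n\<close> is part of
  the induction, because the next step conditions on it.\<close>

lemma martingale_exp_moment:
  assumes u: "\<And>p. (\<lambda>(\<omega>, y). u p \<omega> y) \<in> borel_measurable (past p \<Otimes>\<^sub>M S)"
    and osc: "\<And>p \<omega>. \<omega> \<in> space M \<Longrightarrow> u p \<omega> \<in> Osc_le S a"
  shows "(\<integral>\<^sup>+\<omega>. ennreal (exp (t * (\<Sum>p<n. u p \<omega> (Y (Suc p) \<omega>) - kernel_op (K (\<theta> p \<omega>)) (u p \<omega>) (Y p \<omega>)))) \<partial>M)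
      \<le> ennreal (exp (t\<^sup>2 * (real n * a\<^sup>2) / 2))
    \<and> (\<lambda>\<omega>. \<Sum>p<n. u p \<omega> (Y (Suc p) \<omega>) - kernel_op (K (\<theta> p \<omega>)) (u p \<omega>) (Y p \<omega>)) \<in> borel_measurable (past n)"
    (is "(\<integral>\<^sup>+\<omega>. ennreal (exp (t * ?S n \<omega>)) \<partial>M) \<le> _ \<and> _")
proof (induction n)
  case 0
  show ?case by (simp add: emeasure_space_1)
next
  case (Suc n)
  let ?L = "\<lambda>\<omega>. K (\<theta> n \<omega>) (Y n \<omega>)"
  let ?D = "\<lambda>\<omega>. u n \<omega> (Y (Suc n) \<omega>) - (\<integral>y. u n \<omega> y \<partial>?L \<omega>)"
  have D: "u n \<omega> (Y (Suc n) \<omega>) - kernel_op (K (\<theta> n \<omega>)) (u n \<omega>) (Y n \<omega>) = ?D \<omega>" for \<omega>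
    by (simp add: kernel_op_def)
  have S: "?S n \<in> borel_measurable (past n)" using Suc by blast
  then have G: "(\<lambda>\<omega>. ennreal (exp (t * ?S n \<omega>))) \<in> borel_measurable (past n)" by measurable
  have "(\<integral>\<^sup>+\<omega>. ennreal (exp (t * ?S (Suc n) \<omega>)) \<partial>M) = (\<integral>\<^sup>+\<omega>. ennreal (exp (t * ?S n \<omega>)) * ennreal (exp (t * ?D \<omega>)) \<partial>M)"
    by (simp add: D distrib_left exp_add ennreal_mult)
  also have "\<dots> \<le> ennreal (exp (t\<^sup>2 * a\<^sup>2 / 2)) * (\<integral>\<^sup>+\<omega>. ennreal (exp (t * ?S n \<omega>)) \<partial>M)"
    by (rule exp_martingale_step[OF subalgebra_past Y_measurable transition_past transition_law G u osc])
  also have "\<dots> \<le> ennreal (exp (t\<^sup>2 * a\<^sup>2 / 2)) * ennreal (exp (t\<^sup>2 * (real n * a\<^sup>2) / 2))"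
    using Suc by (intro mult_left_mono) auto
  also have "\<dots> = ennreal (exp (t\<^sup>2 * (real (Suc n) * a\<^sup>2) / 2))"
    by (simp add: distrib_left add_divide_distrib exp_add mult_ac flip: ennreal_mult) (simp add: algebra_simps flip: exp_add ennreal_mult)
  finally have 1: "(\<integral>\<^sup>+\<omega>. ennreal (exp (t * ?S (Suc n) \<omega>)) \<partial>M) \<le> ennreal (exp (t\<^sup>2 * (real (Suc n) * a\<^sup>2) / 2))" .
  have u': "(\<lambda>\<omega>. u n \<omega> (Y (Suc n) \<omega>)) \<in> borel_measurable (past (Suc n))"
  proof -
    have "(\<lambda>\<omega>. \<omega>) \<in> past (Suc n) \<rightarrow>\<^sub>M past n" using past_mono[of n "Suc n"] by (auto simp: measurable_def)
    from measurable_compose[OF measurable_Pair[OF this Y_past[OF order_refl]] u[of n]] show ?thesis by simp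
  qed
  have "(\<lambda>\<omega>. \<integral>y. u n \<omega> y \<partial>?L \<omega>) \<in> borel_measurable (past n)"
    by (rule integral_kernel_measurable[OF u transition_past])
  from measurable_past_mono[OF this, of "Suc n"] measurable_past_mono[OF S, of "Suc n"] u'
  have "?S (Suc n) \<in> borel_measurable (past (Suc n))" by (simp add: D)
  with 1 show ?case by blast
qed

text \<open>Let \<open>u\<^sub>p\<close> be the truncated Poisson solution for the transition \<open>K\<^sub>p\<close> used at time \<open>p\<close>. Up to truncation,
  \<open>f(Y\<^sub>p) - \<rho>\<^sub>p(f) = [u\<^sub>p(Y\<^sub>p) - u\<^sub>p(Y\<^sub>p\<^sub>+\<^sub>1)] + [u\<^sub>p(Y\<^sub>p\<^sub>+\<^sub>1) - K\<^sub>p u\<^sub>p(Y\<^sub>p)]\<close>. The second bracket is a martingale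
  increment bounded by \<open>C\<close>, so its sum over \<open>p \<le> n\<close> has size \<open>C \<surd>(n + 1)\<close>. The first bracket
  telescopes, except for the drift \<open>u\<^sub>p\<^sub>+\<^sub>1 - u\<^sub>p = O(d C\<^sup>2 / p)\<close>, whose sum is at most of the order \<open>d C\<^sup>2 \<surd>(n + 1)\<close>. Since \<open>\<rho>\<^sub>p\<close> is
  the invariant law of the very transition that leads from \<open>Y\<^sub>p\<close> to \<open>Y\<^sub>p\<^sub>+\<^sub>1\<close>, no further error arises.\<close>

lemma average_error:
  assumes f: "f \<in> Osc_le S 1" and r: "r \<ge> 1"
  shows "Lr_norm M r (\<lambda>\<omega>. (\<Sum>p\<le>n. f (Y p \<omega>) - (\<integral>x. f x \<partial>\<rho> (\<theta> p \<omega>))) / real (n + 1))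
    \<le> (4 * r + 10) * ((1 + d) * C\<^sup>2) / sqrt (real (n + 1))"
proof -
  obtain \<omega>0 where w0: "\<omega>0 \<in> space M" using not_empty by auto
  define z where "z = Y 0 \<omega>0"
  have z: "z \<in> space S" unfolding z_def by (rule Y_space[OF w0])
  have fB: "f \<in> Bdd S" by (rule Osc_leD(1)[OF f])
  obtain c where c: "\<And>x. x \<in> space S \<Longrightarrow> \<bar>f x\<bar> \<le> c" using fB BddE by metis
  let ?Z = "\<lambda>\<omega>. \<Sum>p\<le>n. f (Y p \<omega>) - (\<integral>x. f x \<partial>\<rho> (\<theta> p \<omega>))"
  have fY: "(\<lambda>\<omega>. f (Y p \<omega>)) \<in> Bdd M" for p
    using c Y_space Bdd_measurable[OF fB] by (auto simp: Bdd_iff)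
  have f\<rho>: "(\<lambda>\<omega>. \<integral>x. f x \<partial>\<rho> (\<theta> p \<omega>)) \<in> Bdd M" for p
    unfolding Bdd_iff
  proof (intro conjI exI ballI)
    show "(\<lambda>\<omega>. \<integral>x. f x \<partial>\<rho> (\<theta> p \<omega>)) \<in> borel_measurable M"
      by (rule measurable_compose[OF theta_M rho_integral_measurable[OF fB]])
    fix \<omega> assume "\<omega> \<in> space M"
    then show "\<bar>\<integral>x. f x \<partial>\<rho> (\<theta> p \<omega>)\<bar> \<le> c"
      by (intro Prob_integral_abs_le[OF rho_Prob[OF theta_space] fB c])
  qed
  have ZB: "?Z \<in> Bdd M" using fY f\<rho> by (intro Bdd_sum Bdd_diff)
  let ?q = "sqrt (real (n + 1))"
  have q: "?q \<ge> 1" "?q > 0" "?q * ?q = real (n + 1)" by auto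
  \<comment> \<open>The terms with \<open>b ^ j\<close> come from cutting the Poisson series after \<open>N * j\<close> terms.\<close>
  have main: "Lr_norm M r ?Z \<le> (4 * r * C * ?q + 2 * C + 8 * d * C\<^sup>2 * ?q) + b ^ j * (2 * C * real n + real (n + 1))" for j
  proof -
    define u where "u p \<omega> = poisson (K (\<theta> p \<omega>)) z (N * j) f" for p \<omega>
    have uO: "u p \<omega> \<in> Osc_le S C" and uA: "\<And>x. x \<in> space S \<Longrightarrow> \<bar>u p \<omega> x\<bar> \<le> C"
      and ueq: "\<And>x. x \<in> space S \<Longrightarrow>
        \<bar>u p \<omega> x - kernel_op (K (\<theta> p \<omega>)) (u p \<omega>) x - (f x - (\<integral>x. f x \<partial>\<rho> (\<theta> p \<omega>)))\<bar> \<le> b ^ j"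
      if w: "\<omega> \<in> space M" for p \<omega>
    proof -
      interpret k: contracting_kernel S "K (\<theta> p \<omega>)" N b by (rule contracting_at[OF w])
      have kC: "k.C = C" by (simp add: k.C_def C_def)
      show "u p \<omega> \<in> Osc_le S C" unfolding u_def using k.poisson_Osc_le[OF f, of z j] kC by simp
      show "\<bar>u p \<omega> x\<bar> \<le> C" if "x \<in> space S" for x
        unfolding u_def using k.poisson_abs_le[OF f z that, of j] kC by simp
      show "\<bar>u p \<omega> x - kernel_op (K (\<theta> p \<omega>)) (u p \<omega>) x - (f x - (\<integral>x. f x \<partial>\<rho> (\<theta> p \<omega>)))\<bar> \<le> b ^ j"
        if x: "x \<in> space S" for x
        using poisson_equation[OF k.kernel fB x, of z "N * j"]
          k.pow_near_invariant[OF rho_Prob[OF theta_space[OF w]] rho_invariant[OF theta_space[OF w]] f x, of j]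
        unfolding u_def by linarith
    qed
    have um: "(\<lambda>(\<omega>, y). u p \<omega> y) \<in> borel_measurable (past p \<Otimes>\<^sub>M S)" for p
    proof -
      have "(\<lambda>q. (\<theta> p (fst q), snd q)) \<in> past p \<Otimes>\<^sub>M S \<rightarrow>\<^sub>M T \<Otimes>\<^sub>M S"
        using theta_past[of p p] by measurable
      from measurable_compose[OF this poisson_joint_measurable[OF Bdd_measurable[OF fB] z]]
      show ?thesis unfolding u_def by (simp add: split_beta')
    qed
    let ?Mn = "\<lambda>\<omega>. \<Sum>p<n+1. u p \<omega> (Y (Suc p) \<omega>) - kernel_op (K (\<theta> p \<omega>)) (u p \<omega>) (Y p \<omega>)"
    have Mn_bd: "\<bar>u p \<omega> (Y (Suc p) \<omega>) - kernel_op (K (\<theta> p \<omega>)) (u p \<omega>) (Y p \<omega>)\<bar> \<le> C" if w: "\<omega> \<in> space M" for p \<omega>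
    proof -
      interpret k: contracting_kernel S "K (\<theta> p \<omega>)" N b by (rule contracting_at[OF w])
      have "\<bar>kernel_op (K (\<theta> p \<omega>)) (u p \<omega>) (Y p \<omega>) - u p \<omega> (Y (Suc p) \<omega>)\<bar> \<le> C"
        unfolding kernel_op_def using Osc_leD[OF uO[OF w, of p]] Y_space[OF w]
        by (intro Prob_integral_dist[OF kernel_Prob[OF k.kernel Y_space[OF w]]]) auto
      then show ?thesis by linarith
    qed
    have MnB: "?Mn \<in> Bdd M"
      unfolding Bdd_iff
    proof (intro conjI exI ballI)
      show "?Mn \<in> borel_measurable M"
        using measurable_from_subalg[OF subalgebra_past] martingale_exp_moment[OF um uO] by blast
      fix \<omega> assume w: "\<omega> \<in> space M"
      show "\<bar>?Mn \<omega>\<bar> \<le> (\<Sum>p<n+1. C)"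
        by (rule order_trans[OF sum_abs]) (intro sum_mono Mn_bd[OF w])
    qed
    have "Lr_norm M r ?Mn \<le> 4 * r * (C * ?q)"
    proof (rule Lr_subgaussian[OF r MnB])
      show "0 \<le> C * ?q" using C_facts by simp
      fix t
      have e: "(C * ?q)\<^sup>2 = real (n + 1) * C\<^sup>2" by (simp add: power_mult_distrib)
      show "(\<integral>\<^sup>+\<omega>. ennreal (exp (t * ?Mn \<omega>)) \<partial>M) \<le> ennreal (exp (t\<^sup>2 * (C * ?q)\<^sup>2 / 2))"
        unfolding e using martingale_exp_moment[OF um uO] by blast
    qed
    moreover have "Lr_norm M r (\<lambda>\<omega>. ?Z \<omega> - ?Mn \<omega>)
        \<le> 2 * C + 8 * d * C\<^sup>2 * ?q + b ^ j * (2 * C * real n + real (n + 1))"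
    proof (rule Lr_bounded[OF r])
      show "(\<lambda>\<omega>. ?Z \<omega> - ?Mn \<omega>) \<in> Bdd M" using ZB MnB by (rule Bdd_diff)
      show "0 \<le> 2 * C + 8 * d * C\<^sup>2 * ?q + b ^ j * (2 * C * real n + real (n + 1))"
        using C_facts d_nonneg b_bounds by simp
      fix \<omega> assume w: "\<omega> \<in> space M"
      let ?x = "\<lambda>p. Y p \<omega>"
      \<comment> \<open>Summation by parts: two boundary terms and the drift of \<open>u\<close>.\<close>
      have tele: "(\<Sum>p<m+1. u p \<omega> (?x p) - u p \<omega> (?x (Suc p)))
          = u 0 \<omega> (?x 0) - u m \<omega> (?x (Suc m)) + (\<Sum>p<m. u (Suc p) \<omega> (?x (Suc p)) - u p \<omega> (?x (Suc p)))" for m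
        by (induction m) auto
      have "\<bar>\<Sum>p<n+1. u p \<omega> (?x p) - u p \<omega> (?x (Suc p))\<bar>
          \<le> 2 * C + (8 * d * C\<^sup>2 * ?q + b ^ j * (2 * C * real n))"
      proof -
        have "\<bar>u (Suc p) \<omega> (?x (Suc p)) - u p \<omega> (?x (Suc p))\<bar>
            \<le> 4 * d * C\<^sup>2 * (1 / sqrt (real (p + 1))) + 2 * C * b ^ j" for p
        proof -
          have "\<bar>u (Suc p) \<omega> (?x (Suc p)) - u p \<omega> (?x (Suc p))\<bar>
              \<le> 2 * (2 * d / real (p + 2)) * C\<^sup>2 + 2 * C * b ^ j"
            unfolding u_def C_def
            by (rule poisson_perturbation[OF contracting_at[OF w] contracting_at[OF w] f z Y_space[OF w] slow[OF w]])
          moreover have "4 * d * C\<^sup>2 * (1 / real (p + 2)) \<le> 4 * d * C\<^sup>2 * (1 / sqrt (real (p + 1)))"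
            using d_nonneg by (intro mult_left_mono inverse_le_inverse_sqrt) auto
          ultimately show ?thesis by (simp add: mult_ac)
        qed
        then have "\<bar>\<Sum>p<n. u (Suc p) \<omega> (?x (Suc p)) - u p \<omega> (?x (Suc p))\<bar>
            \<le> (\<Sum>p<n. 4 * d * C\<^sup>2 * (1 / sqrt (real (p + 1))) + 2 * C * b ^ j)"
          by (intro order_trans[OF sum_abs] sum_mono)
        also have "\<dots> = 4 * d * C\<^sup>2 * (\<Sum>p<n. 1 / sqrt (real (p + 1))) + b ^ j * (2 * C * real n)"
          by (simp add: sum.distrib sum_distrib_left mult_ac)
        also have "\<dots> \<le> 4 * d * C\<^sup>2 * (2 * ?q) + b ^ j * (2 * C * real n)"
        proof (intro add_mono mult_left_mono order_refl)
          have "(\<Sum>p<n. 1 / sqrt (real (p + 1))) \<le> (\<Sum>p\<le>n. 1 / sqrt (real (p + 1)))"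
            by (intro sum_mono2) auto
          then show "(\<Sum>p<n. 1 / sqrt (real (p + 1))) \<le> 2 * ?q" using sum_inverse_sqrt_le[of n] by linarith
        qed (use d_nonneg C_facts b_bounds in auto)
        finally show ?thesis
          unfolding tele using uA[OF w Y_space[OF w], of 0 0] uA[OF w Y_space[OF w], of n "Suc n"] by linarith
      qed
      moreover have "\<bar>?Z \<omega> - (\<Sum>p<n+1. u p \<omega> (?x p) - kernel_op (K (\<theta> p \<omega>)) (u p \<omega>) (?x p))\<bar> \<le> b ^ j * real (n + 1)"
      proof -
        have "?Z \<omega> - (\<Sum>p<n+1. u p \<omega> (?x p) - kernel_op (K (\<theta> p \<omega>)) (u p \<omega>) (?x p))
            = (\<Sum>p<n+1. f (?x p) - (\<integral>x. f x \<partial>\<rho> (\<theta> p \<omega>)) - (u p \<omega> (?x p) - kernel_op (K (\<theta> p \<omega>)) (u p \<omega>) (?x p)))"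
          by (simp only: sum_subtractf[symmetric] lessThan_Suc_atMost Suc_eq_plus1[symmetric])
        also have "\<bar>\<dots>\<bar> \<le> (\<Sum>p<n+1. b ^ j)"
          using ueq[OF w Y_space[OF w]] by (intro order_trans[OF sum_abs] sum_mono) (simp add: abs_minus_commute)
        finally show ?thesis by (simp add: mult.commute)
      qed
      moreover have "(\<Sum>p<n+1. u p \<omega> (?x p) - kernel_op (K (\<theta> p \<omega>)) (u p \<omega>) (?x p))
          = ?Mn \<omega> + (\<Sum>p<n+1. u p \<omega> (?x p) - u p \<omega> (?x (Suc p)))"
        unfolding sum.distrib[symmetric] by (rule sum.cong) auto
      ultimately show "\<bar>?Z \<omega> - ?Mn \<omega>\<bar> \<le> 2 * C + 8 * d * C\<^sup>2 * ?q + b ^ j * (2 * C * real n + real (n + 1))"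
        by (simp only: distrib_left)
    qed
    moreover have "Lr_norm M r (\<lambda>\<omega>. ?Mn \<omega> + (?Z \<omega> - ?Mn \<omega>)) \<le> Lr_norm M r ?Mn + Lr_norm M r (\<lambda>\<omega>. ?Z \<omega> - ?Mn \<omega>)"
      using ZB MnB by (intro Lr_add[OF r]) auto
    ultimately show ?thesis by (simp add: mult_ac)
  qed
  have "(\<lambda>j. (4 * r * C * ?q + 2 * C + 8 * d * C\<^sup>2 * ?q) + b ^ j * (2 * C * real n + real (n + 1)))
      \<longlonglongrightarrow> (4 * r * C * ?q + 2 * C + 8 * d * C\<^sup>2 * ?q) + 0 * (2 * C * real n + real (n + 1))"
    using b_bounds by (intro tendsto_intros LIMSEQ_realpow_zero)
  then have "Lr_norm M r ?Z \<le> (4 * r * C * ?q + 2 * C + 8 * d * C\<^sup>2 * ?q) + 0 * (2 * C * real n + real (n + 1))"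
    by (rule LIMSEQ_le_const) (use main in blast)
  also have "\<dots> \<le> (4 * r + 10) * ((1 + d) * C\<^sup>2) * ?q"
  proof -
    have "4 * r * C * ?q \<le> 4 * r * C\<^sup>2 * ?q" using C_facts r by (intro mult_right_mono mult_left_mono) auto
    moreover have "2 * C * 1 \<le> 2 * C\<^sup>2 * ?q" using C_facts q by (intro mult_mono) auto
    moreover have "0 \<le> 4 * r * d * C\<^sup>2 * ?q" "0 \<le> 8 * C\<^sup>2 * ?q" "0 \<le> 2 * d * C\<^sup>2 * ?q" using d_nonneg r by auto
    moreover have "(4 * r + 10) * ((1 + d) * C\<^sup>2) * ?q = 4 * r * C\<^sup>2 * ?q + 2 * C\<^sup>2 * ?q + 8 * d * C\<^sup>2 * ?q
        + (4 * r * d * C\<^sup>2 * ?q + 8 * C\<^sup>2 * ?q + 2 * d * C\<^sup>2 * ?q)" by (simp add: algebra_simps)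
    ultimately show ?thesis by linarith
  qed
  finally have 1: "Lr_norm M r ?Z \<le> (4 * r + 10) * ((1 + d) * C\<^sup>2) * ?q" .
  have "Lr_norm M r (\<lambda>\<omega>. ?Z \<omega> / real (n + 1)) = Lr_norm M r ?Z / real (n + 1)"
    using Lr_scale[OF r, of "1 / real (n + 1)" ?Z] by simp
  also have "\<dots> \<le> (4 * r + 10) * ((1 + d) * C\<^sup>2) * ?q / real (n + 1)"
    using 1 by (intro divide_right_mono) auto
  also have "\<dots> = (4 * r + 10) * ((1 + d) * C\<^sup>2) * ?q / (?q * ?q)" by (simp only: q(3))
  also have "\<dots> = (4 * r + 10) * ((1 + d) * C\<^sup>2) / ?q"
    by (rule nonzero_mult_divide_mult_cancel_right) (use q(2) in simp)
  finally show ?thesis .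
qed

end

section \<open>Averages of measures and comparison of kernels\<close>

text \<open>An average of measures is the law of a measure picked uniformly at random; integrals against it
  then come from the monad laws.\<close>

lemma avg_measure_eq_bind:
  assumes mu: "\<And>p. \<mu> p \<in> Prob S"
  shows "avg_measure S n \<mu> = measure_pmf (pmf_of_set {..n}) \<bind> \<mu>"
proof (rule measure_eqI)
  have \<mu>: "\<mu> \<in> measure_pmf (pmf_of_set {..n}) \<rightarrow>\<^sub>M subprob_algebra S"
    using mu by (auto simp: measurable_def space_subprob_algebra space_prob_algebra prob_space_imp_subprob_space)
  show "sets (avg_measure S n \<mu>) = sets (measure_pmf (pmf_of_set {..n}) \<bind> \<mu>)"
    using mu by (subst sets_bind[where N=S]) (auto simp: ProbD)
  fix A assume "A \<in> sets (avg_measure S n \<mu>)"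
  then have A: "A \<in> sets S" by simp
  have "emeasure (measure_pmf (pmf_of_set {..n}) \<bind> \<mu>) A = (\<integral>\<^sup>+p. emeasure (\<mu> p) A \<partial>measure_pmf (pmf_of_set {..n}))"
    using \<mu> A by (intro emeasure_bind) auto
  also have "\<dots> = (\<Sum>p\<le>n. emeasure (\<mu> p) A) / of_nat (n + 1)"
    by (subst nn_integral_pmf_of_set) auto
  finally show "emeasure (avg_measure S n \<mu>) A = emeasure (measure_pmf (pmf_of_set {..n}) \<bind> \<mu>) A"
    using emeasure_avg_measure[of n \<mu> S A] mu A by (simp add: ProbD(2))
qed

lemma integral_avg_measure:
  assumes mu: "\<And>p. \<mu> p \<in> Prob S" and f: "f \<in> Bdd S"
  shows "(\<integral>x. f x \<partial>avg_measure S n \<mu>) = (\<Sum>p\<le>n. \<integral>x. f x \<partial>\<mu> p) / real (n + 1)"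
proof -
  have \<mu>: "\<mu> \<in> measure_pmf (pmf_of_set {..n}) \<rightarrow>\<^sub>M subprob_algebra S"
    using mu by (auto simp: measurable_def space_subprob_algebra space_prob_algebra prob_space_imp_subprob_space)
  obtain c where c: "\<And>x. x \<in> space S \<Longrightarrow> \<bar>f x\<bar> \<le> c" using f BddE by metis
  have "(\<integral>x. f x \<partial>avg_measure S n \<mu>) = (\<integral>p. (\<integral>x. f x \<partial>\<mu> p) \<partial>measure_pmf (pmf_of_set {..n}))"
    unfolding avg_measure_eq_bind[OF mu]
    by (rule integral_bind[where B=c and B'=1 and K=S])
      (use c \<mu> f mu ProbD(1)[OF mu] in \<open>auto intro!: measure_pmf.finite_measure_axioms simp: Bdd_measurable prob_space.emeasure_space_1\<close>)
  also have "\<dots> = (\<Sum>p\<le>n. \<integral>x. f x \<partial>\<mu> p) / real (n + 1)"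
    by (subst integral_pmf_of_set) auto
  finally show ?thesis .
qed

lemma avg_measure_const:
  assumes "\<mu> \<in> Prob S" shows "avg_measure S n (\<lambda>_. \<mu>) = \<mu>"
proof -
  have "avg_measure S n (\<lambda>_. \<mu>) = measure_pmf (pmf_of_set {..n}) \<bind> (\<lambda>_. \<mu>)"
    by (rule avg_measure_eq_bind[OF assms])
  also have "\<dots> = \<mu>"
    using ProbD(1)[OF assms] by (intro bind_const' measure_pmf.prob_space_axioms prob_space_imp_subprob_space)
  finally show ?thesis .
qed

lemma avg_measure_measurable:
  assumes mu: "\<And>p. \<mu> p \<in> F \<rightarrow>\<^sub>M prob_algebra S"
  shows "(\<lambda>\<omega>. avg_measure S n (\<lambda>p. \<mu> p \<omega>)) \<in> F \<rightarrow>\<^sub>M prob_algebra S"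
proof (rule measurable_prob_algebraI)
  have P: "\<mu> p \<omega> \<in> Prob S" if "\<omega> \<in> space F" for p \<omega> by (rule measurable_space[OF mu that])
  have avg: "avg_measure S n (\<lambda>p. \<mu> p \<omega>) \<in> Prob S" if "\<omega> \<in> space F" for \<omega>
    using P[OF that] by (rule avg_measure_in_Prob)
  then show "prob_space (avg_measure S n (\<lambda>p. \<mu> p \<omega>))" if "\<omega> \<in> space F" for \<omega>
    using ProbD(1) that by blast
  then show "(\<lambda>\<omega>. avg_measure S n (\<lambda>p. \<mu> p \<omega>)) \<in> F \<rightarrow>\<^sub>M subprob_algebra S"
  proof (intro measurable_subprob_algebra)
    fix A assume A: "A \<in> sets S"
    have m: "(\<lambda>\<omega>. emeasure (\<mu> p \<omega>) A) \<in> borel_measurable F" for p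
      using measurable_compose[OF measurable_prob_algebraD[OF mu] measurable_emeasure_subprob_algebra[OF A]] .
    have "(\<lambda>\<omega>. (\<Sum>p\<le>n. emeasure (\<mu> p \<omega>) A) / of_nat (n + 1)) \<in> borel_measurable F"
      using m by measurable
    also have "?this \<longleftrightarrow> (\<lambda>\<omega>. emeasure (avg_measure S n (\<lambda>p. \<mu> p \<omega>)) A) \<in> borel_measurable F"
      by (rule measurable_cong, subst emeasure_avg_measure) (use A ProbD(2)[OF P] in auto)
    finally show "(\<lambda>\<omega>. emeasure (avg_measure S n (\<lambda>p. \<mu> p \<omega>)) A) \<in> borel_measurable F" .
  qed (auto intro: prob_space_imp_subprob_space)
qed

lemma return_Prob: "x \<in> space S \<Longrightarrow> return S x \<in> Prob S"
  by (simp add: space_prob_algebra prob_space_return)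

lemma empirical_Prob: "(\<And>p. x p \<in> space S) \<Longrightarrow> empirical S x n \<in> Prob S"
  unfolding empirical_def by (intro avg_measure_in_Prob return_Prob)

lemma integral_empirical:
  assumes "\<And>p. x p \<in> space S" "f \<in> Bdd S"
  shows "(\<integral>y. f y \<partial>empirical S x n) = (\<Sum>p\<le>n. f (x p)) / real (n + 1)"
  unfolding empirical_def using assms
  by (subst integral_avg_measure) (auto intro: return_Prob simp: integral_return Bdd_measurable)

lemma empirical_measurable:
  assumes "\<And>p. X p \<in> F \<rightarrow>\<^sub>M S"
  shows "(\<lambda>\<omega>. empirical S (\<lambda>p. X p \<omega>) n) \<in> F \<rightarrow>\<^sub>M prob_algebra S"
  unfolding empirical_def
  by (intro avg_measure_measurable measurable_compose[OF assms measurable_return_prob_space])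

text \<open>One new point of weight \<open>1 / (n + 2)\<close> replaces the same amount of mass of the old measure.\<close>

lemma tv_dist_empirical_Suc:
  assumes x: "\<And>p. x p \<in> space S"
  shows "tv_dist S (empirical S x (Suc n)) (empirical S x n) \<le> 2 / real (n + 2)"
proof (rule tv_dist_least)
  show "space S \<noteq> {}" using x by blast
  fix f assume f: "f \<in> Bdd1 S"
  have fB: "f \<in> Bdd S" by (rule Bdd1D(1)[OF f])
  let ?m = "\<integral>y. f y \<partial>empirical S x n"
  have m: "\<bar>?m\<bar> \<le> 1" using Bdd1D[OF f] by (intro Prob_integral_abs_le[OF empirical_Prob[OF x]])
  have "(\<Sum>p\<le>n. f (x p)) = real (n + 1) * ?m" using integral_empirical[OF x fB, where n=n] by simp
  then have "(\<integral>y. f y \<partial>empirical S x (Suc n)) = (real (n + 1) * ?m + f (x (Suc n))) / real (n + 2)"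
    using integral_empirical[OF x fB, where n="Suc n"] by simp
  also have "\<dots> - ?m = (f (x (Suc n)) - ?m) / real (n + 2)"
    by (simp add: field_simps)
  also have "\<bar>\<dots>\<bar> \<le> 2 / real (n + 2)"
    using m Bdd1D(2)[OF f x, of "Suc n"] by (simp add: abs_divide divide_right_mono)
  finally show "\<bar>(\<integral>y. f y \<partial>empirical S x (Suc n)) - ?m\<bar> \<le> 2 / real (n + 2)" .
qed

text \<open>Constants cancel in the difference of two Markov operators, so \<open>g\<close> may be replaced by
  \<open>g - g x\<close>, whose sup norm is at most the oscillation of \<open>g\<close>.\<close>

lemma kernel_op_dist_le_op_norm:
  assumes K: "K \<in> S \<rightarrow>\<^sub>M prob_algebra S" and L: "L \<in> S \<rightarrow>\<^sub>M prob_algebra S"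
    and g: "g \<in> Osc_le S a" and x: "x \<in> space S"
  shows "\<bar>kernel_op K g x - kernel_op L g x\<bar> \<le> op_norm S (\<lambda>f x. kernel_op K f x - kernel_op L f x) * a"
proof -
  have gB: "g \<in> Bdd S" by (rule Osc_leD(1)[OF g])
  have a: "0 \<le> a" using g x Osc_le_nonneg by blast
  let ?T = "\<lambda>f x. kernel_op K f x - kernel_op L f x"
  have shift: "?T (\<lambda>y. g y - g x) x = ?T g x"
    using kernel_op_minus_const[OF K gB x] kernel_op_minus_const[OF L gB x] by simp
  show ?thesis
  proof (cases "a = 0")
    case True
    then have "kernel_op J (\<lambda>y. g y - g x) x = kernel_op J (\<lambda>_. 0) x" if "J \<in> S \<rightarrow>\<^sub>M prob_algebra S" for J
      using Osc_leD(2)[OF g _ x] by (intro kernel_op_cong[OF that x]) auto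
    from this[OF K] this[OF L] shift True show ?thesis by (simp add: kernel_op_def)
  next
    case False
    then have a: "a > 0" using a by simp
    let ?h = "\<lambda>y. (g y - g x) / a"
    have h: "?h \<in> Bdd1 S" by (rule Osc_le_imp_Bdd1[OF g a x])
    have TB: "?T f \<in> Bdd S" if "f \<in> Bdd S" for f
      using kernel_op_Bdd[OF K that] kernel_op_Bdd[OF L that] by (rule Bdd_diff)
    have "\<bar>?T ?h x\<bar> \<le> sup_norm S (?T ?h)" by (rule sup_norm_upper[OF TB[OF Bdd1D(1)[OF h]] x])
    also have "\<dots> \<le> op_norm S ?T"
      unfolding op_norm_def
    proof (rule cSUP_upper[OF h], rule bdd_aboveI2)
      fix f assume f: "f \<in> Bdd1 S"
      show "sup_norm S (?T f) \<le> 2"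
      proof (rule sup_norm_least)
        show "space S \<noteq> {}" using x by blast
        fix y assume y: "y \<in> space S"
        have "\<bar>kernel_op J f y\<bar> \<le> 1" if J: "J \<in> S \<rightarrow>\<^sub>M prob_algebra S" for J
          unfolding kernel_op_def using Bdd1D[OF f] by (intro Prob_integral_abs_le[OF kernel_Prob[OF J y]])
        from this[OF K] this[OF L] show "\<bar>?T f y\<bar> \<le> 2" by linarith
      qed
    qed
    finally have "\<bar>?T ?h x\<bar> \<le> op_norm S ?T" .
    moreover have "?T ?h x = ?T g x / a"
      using shift kernel_op_scale[of K "1 / a" "\<lambda>y. g y - g x" x] kernel_op_scale[of L "1 / a" "\<lambda>y. g y - g x" x]
      by (simp flip: diff_divide_distrib)
    ultimately show ?thesis using a by (simp add: abs_divide divide_le_eq)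
  qed
qed

lemma flow_dist_upper:
  assumes "\<And>n. \<eta> n \<in> Prob S" "\<And>n. \<mu> n \<in> Prob S"
  shows "tv_dist S (\<eta> n) (\<mu> n) \<le> flow_dist S \<eta> \<mu>"
  unfolding flow_dist_def using tv_dist_le_2[OF assms]
  by (intro cSUP_upper bdd_aboveI2[where M=2]) auto

lemma Phi_bar_comp_0: "Phi_bar_comp S \<Phi> l (l + 1) \<eta> = \<eta>"
  by (simp add: Phi_bar_comp_def)

lemma Phi_bar_comp_Suc:
  "Phi_bar_comp S \<Phi> (l + Suc k) (l + 1) \<eta> = Phi_bar S \<Phi> (Suc (l + k)) (Phi_bar_comp S \<Phi> (l + k) (l + 1) \<eta>)"
  by (simp add: Phi_bar_comp_def)

section \<open>Error of one level\<close>

context regular_interacting_mcmc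
begin

lemma S_nonempty: "space (S l) \<noteq> {}"
  by (rule ProbD(4)[OF nu_Prob])

lemma pi_Prob: "\<pi> l \<in> Prob (S l)"
  by (induction l) (simp_all add: pi_0 pi_Suc Phi_Prob)

lemma X_measurable: "X k p \<in> \<Omega> \<rightarrow>\<^sub>M S k"
  using chain_0 chain_Suc by (cases k) (auto simp: markov_chain_given_def)

lemma X_space: "\<omega> \<in> space \<Omega> \<Longrightarrow> X k p \<omega> \<in> space (S k)"
  by (rule measurable_space[OF X_measurable])

lemma M_Suc_kernel: "\<mu> \<in> Prob (S l) \<Longrightarrow> M (Suc l) \<mu> \<in> S (Suc l) \<rightarrow>\<^sub>M prob_algebra (S (Suc l))"
  using measurable_compose[OF measurable_Pair1' M_kernel, of \<mu> l] by simp

lemma M_level_kernel: "\<mu> \<in> Prob (S (l - 1)) \<Longrightarrow> M l \<mu> \<in> S l \<rightarrow>\<^sub>M prob_algebra (S l)"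
  using M_Suc_kernel M0_kernel by (cases l) (auto simp: M_0)

abbreviation contr :: "nat \<Rightarrow> real" where "contr l \<equiv> b_coeff S M l (nn l)"

lemma contracting_level:
  assumes mu: "\<mu> \<in> Prob (S (l - 1))"
  shows "contracting_kernel (S l) (M l \<mu>) (nn l) (contr l)"
proof
  show K: "M l \<mu> \<in> S l \<rightarrow>\<^sub>M prob_algebra (S l)" by (rule M_level_kernel[OF mu])
  show ne: "space (S l) \<noteq> {}" by (rule S_nonempty)
  have bd: "bdd_above ((\<lambda>\<mu>. dobrushin (S l) (kernel_op (M l \<mu>) ^^ nn l)) ` Prob (S (l - 1)))"
    using dobrushin_le_1[OF M_level_kernel ne] by (intro bdd_aboveI2)
  show le: "dobrushin (S l) (kernel_op (M l \<mu>) ^^ nn l) \<le> contr l"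
    unfolding b_coeff_def by (rule cSUP_upper[OF mu bd])
  then show "0 \<le> contr l" using dobrushin_nonneg[OF K ne, of "nn l"] by linarith
  show "contr l < 1" by (rule R2_contraction)
qed

lemma family_Suc: "kernel_family (prob_algebra (S l)) (S (Suc l)) (M (Suc l)) (nn (Suc l)) (contr (Suc l)) (\<Phi> (Suc l))"
  by (intro kernel_family.intro M_kernel M_invariant Phi_Prob) (use contracting_level[of _ "Suc l"] in auto)

lemma family_0: "kernel_family (prob_algebra (S 0)) (S 0) (\<lambda>_. M0) (nn 0) (contr 0) (\<lambda>_. \<pi> 0)"
proof (intro kernel_family.intro M0_invariant pi_0)
  show "(\<lambda>(t, x). M0 x) \<in> prob_algebra (S 0) \<Otimes>\<^sub>M S 0 \<rightarrow>\<^sub>M prob_algebra (S 0)"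
    using measurable_compose[OF measurable_snd M0_kernel] by (simp add: split_beta')
  show "contracting_kernel (S 0) M0 (nn 0) (contr 0)" if "t \<in> Prob (S 0)" for t
    using contracting_level[of t 0] that by (simp add: M_0)
qed

lemma Phi_measurable: "\<Phi> (Suc l) \<in> prob_algebra (S l) \<rightarrow>\<^sub>M prob_algebra (S (Suc l))"
  by (rule kernel_family.rho_measurable[OF family_Suc])

abbreviation emp :: "nat \<Rightarrow> nat \<Rightarrow> 'w \<Rightarrow> 'a measure" where
  "emp l n \<omega> \<equiv> empirical (S l) (\<lambda>p. X l p \<omega>) n"

definition level_constant :: "nat \<Rightarrow> real" where
  "level_constant l = (1 + c l) * (real (nn l) / (1 - contr l))\<^sup>2"

text \<open>Random flows of distributions on level \<open>l\<close>, and the distance in which errors are measured: the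
  decay \<open>C / \<surd>(n + 1)\<close> in the time \<open>n\<close> is built in, because it is reproduced by time averaging.\<close>

definition flow_on :: "nat \<Rightarrow> (nat \<Rightarrow> 'w \<Rightarrow> 'a measure) \<Rightarrow> bool" where
  "flow_on l \<zeta> \<longleftrightarrow> (\<forall>n. \<zeta> n \<in> \<Omega> \<rightarrow>\<^sub>M prob_algebra (S l))"

definition flows_close :: "real \<Rightarrow> nat \<Rightarrow> (nat \<Rightarrow> 'w \<Rightarrow> 'a measure) \<Rightarrow> (nat \<Rightarrow> 'w \<Rightarrow> 'a measure) \<Rightarrow> real \<Rightarrow> bool" where
  "flows_close r l \<zeta> \<zeta>' C \<longleftrightarrow> (\<forall>n. \<forall>f\<in>Osc1 (S l).
     Lr_norm \<Omega> r (\<lambda>\<omega>. (\<integral>x. f x \<partial>\<zeta> n \<omega>) - (\<integral>x. f x \<partial>\<zeta>' n \<omega>)) \<le> C / sqrt (real (n + 1)))"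

definition push :: "nat \<Rightarrow> (nat \<Rightarrow> 'w \<Rightarrow> 'a measure) \<Rightarrow> nat \<Rightarrow> 'w \<Rightarrow> 'a measure" where
  "push l \<zeta> n \<omega> = Phi_bar S \<Phi> (Suc l) (\<lambda>m. \<zeta> m \<omega>) n"

lemma flow_Prob: "flow_on l \<zeta> \<Longrightarrow> \<omega> \<in> space \<Omega> \<Longrightarrow> \<zeta> n \<omega> \<in> Prob (S l)"
  by (rule measurable_space[of "\<zeta> n" \<Omega>]) (simp_all add: flow_on_def)

lemma flow_emp: "flow_on l (emp l)"
  unfolding flow_on_def by (intro allI empirical_measurable X_measurable)

lemma flow_const: "flow_on l (\<lambda>_ _. \<pi> l)"
  unfolding flow_on_def using pi_Prob by auto

lemma flow_Phi: "flow_on l \<zeta> \<Longrightarrow> flow_on (Suc l) (\<lambda>n \<omega>. \<Phi> (Suc l) (\<zeta> n \<omega>))"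
  unfolding flow_on_def by (blast intro: measurable_compose[OF _ Phi_measurable])

lemma flow_push: "flow_on l \<zeta> \<Longrightarrow> flow_on (Suc l) (push l \<zeta>)"
  unfolding flow_on_def push_def[abs_def] Phi_bar_def
  by (intro allI avg_measure_measurable) (blast intro: measurable_compose[OF _ Phi_measurable])

lemma flow_integral_Bdd:
  assumes z: "flow_on l \<zeta>" and f: "f \<in> Bdd (S l)"
  shows "(\<lambda>\<omega>. \<integral>x. f x \<partial>\<zeta> n \<omega>) \<in> Bdd \<Omega>"
proof -
  obtain c where c: "\<And>x. x \<in> space (S l) \<Longrightarrow> \<bar>f x\<bar> \<le> c" using f BddE by metis
  have "\<zeta> n \<in> \<Omega> \<rightarrow>\<^sub>M subprob_algebra (S l)"
    using z unfolding flow_on_def by (intro measurable_prob_algebraD) blast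
  from measurable_compose[OF this integral_measurable_subprob_algebra[OF Bdd_measurable[OF f]]]
    Prob_integral_abs_le[OF flow_Prob[OF z] f c]
  show ?thesis by (auto simp: Bdd_iff)
qed

lemma integral_push:
  assumes z: "flow_on l \<zeta>" and f: "f \<in> Bdd (S (Suc l))" and w: "\<omega> \<in> space \<Omega>"
  shows "(\<integral>x. f x \<partial>push l \<zeta> n \<omega>) = (\<Sum>p\<le>n. \<integral>x. f x \<partial>\<Phi> (Suc l) (\<zeta> p \<omega>)) / real (n + 1)"
  unfolding push_def Phi_bar_def
  by (intro integral_avg_measure Phi_Prob flow_Prob[OF z w] f)

text \<open>The chain of level \<open>l + 1\<close> follows the invariant laws \<open>\<Phi>\<^sub>l\<^sub>+\<^sub>1(\<eta>\<^sub>p)\<close> of its transitions, hence the time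
  averaged image of the empirical flow of level \<open>l\<close>. Assumption (R2) and the slow motion of
  empirical measures make it a driven chain.\<close>

lemma close_emp_push:
  assumes r: "r \<ge> 1"
  shows "flows_close r (Suc l) (emp (Suc l)) (push l (emp l)) ((4 * r + 10) * level_constant (Suc l))"
  unfolding flows_close_def
proof (intro allI ballI)
  fix n f assume "f \<in> Osc1 (S (Suc l))"
  then have f: "f \<in> Osc_le (S (Suc l)) 1" using Osc1_eq[OF S_nonempty] by blast
  have fB: "f \<in> Bdd (S (Suc l))" by (rule Osc_leD(1)[OF f])
  let ?E = "events_of \<Omega> (S l) (X l) UNIV"
  interpret driven_chain \<Omega> "prob_algebra (S l)" "S (Suc l)" "M (Suc l)" "nn (Suc l)" "contr (Suc l)" "\<Phi> (Suc l)"
    ?E "\<nu> (Suc l)" "X (Suc l)" "emp l" "c (Suc l)"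
  proof (intro driven_chain.intro driven_chain_axioms.intro prob_space_axioms family_Suc chain_Suc c_nonneg)
    show E: "?E \<subseteq> sets \<Omega>" by (rule events_of_subset[OF X_measurable])
    show "emp l n \<in> sigma (space \<Omega>) ?E \<rightarrow>\<^sub>M prob_algebra (S l)" for n
      by (rule empirical_measurable, rule measurable_sigma_events[OF X_measurable UNIV_I order_refl E])
    fix n \<omega> g a x
    assume w: "\<omega> \<in> space \<Omega>" and g: "g \<in> Osc_le (S (Suc l)) a" and x: "x \<in> space (S (Suc l))"
    let ?\<mu> = "emp l (Suc n) \<omega>" and ?\<mu>' = "emp l n \<omega>"
    have P: "?\<mu> \<in> Prob (S l)" "?\<mu>' \<in> Prob (S l)" using flow_Prob[OF flow_emp w] by auto
    have a: "0 \<le> a" by (rule Osc_le_nonneg[OF g S_nonempty])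
    have "\<bar>kernel_op (M (Suc l) ?\<mu>) g x - kernel_op (M (Suc l) ?\<mu>') g x\<bar>
        \<le> op_norm (S (Suc l)) (\<lambda>f x. kernel_op (M (Suc l) ?\<mu>) f x - kernel_op (M (Suc l) ?\<mu>') f x) * a"
      by (rule kernel_op_dist_le_op_norm[OF M_Suc_kernel[OF P(1)] M_Suc_kernel[OF P(2)] g x])
    also have "\<dots> \<le> (c (Suc l) * tv_dist (S l) ?\<mu> ?\<mu>') * a"
      using R2_Lipschitz[of ?\<mu> "Suc l" ?\<mu>'] P a by (intro mult_right_mono) auto
    also have "\<dots> \<le> (c (Suc l) * (2 / real (n + 2))) * a"
      using a c_nonneg by (intro mult_right_mono mult_left_mono tv_dist_empirical_Suc X_space w)
    finally show "\<bar>kernel_op (M (Suc l) ?\<mu>) g x - kernel_op (M (Suc l) ?\<mu>') g x\<bar> \<le> 2 * c (Suc l) / real (n + 2) * a"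
      by (simp add: mult_ac)
  qed
  have "Lr_norm \<Omega> r (\<lambda>\<omega>. (\<integral>x. f x \<partial>emp (Suc l) n \<omega>) - (\<integral>x. f x \<partial>push l (emp l) n \<omega>))
      = Lr_norm \<Omega> r (\<lambda>\<omega>. (\<Sum>p\<le>n. f (X (Suc l) p \<omega>) - (\<integral>x. f x \<partial>\<Phi> (Suc l) (emp l p \<omega>))) / real (n + 1))"
    by (rule Lr_cong[OF r])
      (simp add: integral_empirical[OF X_space fB] integral_push[OF flow_emp fB] sum_subtractf diff_divide_distrib)
  also have "\<dots> \<le> (4 * r + 10) * ((1 + c (Suc l)) * C\<^sup>2) / sqrt (real (n + 1))"
    by (rule average_error[OF f r])
  finally show "Lr_norm \<Omega> r (\<lambda>\<omega>. (\<integral>x. f x \<partial>emp (Suc l) n \<omega>) - (\<integral>x. f x \<partial>push l (emp l) n \<omega>))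
      \<le> (4 * r + 10) * level_constant (Suc l) / sqrt (real (n + 1))"
    by (simp add: level_constant_def C_def)
qed

lemma close_emp_0:
  assumes r: "r \<ge> 1"
  shows "flows_close r 0 (emp 0) (\<lambda>_ _. \<pi> 0) ((4 * r + 10) * level_constant 0)"
  unfolding flows_close_def
proof (intro allI ballI)
  fix n f assume "f \<in> Osc1 (S 0)"
  then have f: "f \<in> Osc_le (S 0) 1" using Osc1_eq[OF S_nonempty] by blast
  have fB: "f \<in> Bdd (S 0)" by (rule Osc_leD(1)[OF f])
  interpret driven_chain \<Omega> "prob_algebra (S 0)" "S 0" "\<lambda>_. M0" "nn 0" "contr 0" "\<lambda>_. \<pi> 0"
    "{}" "\<nu> 0" "X 0" "\<lambda>_ _. \<pi> 0" "c 0"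
  proof (intro driven_chain.intro driven_chain_axioms.intro prob_space_axioms family_0 chain_0 c_nonneg)
    fix n \<omega> g a x assume "g \<in> Osc_le (S 0) a"
    from Osc_le_nonneg[OF this S_nonempty]
    show "\<bar>kernel_op M0 g x - kernel_op M0 g x\<bar> \<le> 2 * c 0 / real (n + 2) * a" using c_nonneg[of 0] by simp
  qed (use pi_0 in auto)
  have "Lr_norm \<Omega> r (\<lambda>\<omega>. (\<integral>x. f x \<partial>emp 0 n \<omega>) - (\<integral>x. f x \<partial>\<pi> 0))
      = Lr_norm \<Omega> r (\<lambda>\<omega>. (\<Sum>p\<le>n. f (X 0 p \<omega>) - (\<integral>x. f x \<partial>\<pi> 0)) / real (n + 1))"
    by (rule Lr_cong[OF r])
      (simp add: integral_empirical[OF X_space fB] sum_subtractf diff_divide_distrib)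
  also have "\<dots> \<le> (4 * r + 10) * ((1 + c 0) * C\<^sup>2) / sqrt (real (n + 1))"
    by (rule average_error[OF f r])
  finally show "Lr_norm \<Omega> r (\<lambda>\<omega>. (\<integral>x. f x \<partial>emp 0 n \<omega>) - (\<integral>x. f x \<partial>\<pi> 0))
      \<le> (4 * r + 10) * level_constant 0 / sqrt (real (n + 1))"
    by (simp add: level_constant_def C_def)
qed

end

section \<open>Propagation of errors through the levels\<close>

context regular_interacting_mcmc
begin

lemma flow_difference_Bdd:
  assumes "flow_on l \<zeta>" "flow_on l \<zeta>'" "f \<in> Bdd (S l)"
  shows "(\<lambda>\<omega>. (\<integral>x. f x \<partial>\<zeta> n \<omega>) - (\<integral>x. f x \<partial>\<zeta>' n \<omega>)) \<in> Bdd \<Omega>"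
  by (rule Bdd_diff[OF flow_integral_Bdd[OF assms(1,3)] flow_integral_Bdd[OF assms(2,3)]])

text \<open>Minkowski's inequality applied to (R1). Two normalisations cancel, so that the factor is
  exactly \<open>\<Lambda>\<close>: \<open>f\<close> can be centred to have sup norm at most \<open>1 / 2\<close>, while \<open>g\<close> must be divided by
  \<open>2 \<parallel>g\<parallel>\<close> to have oscillation at most \<open>1\<close>. The measure \<open>\<Gamma>(f, dg)\<close> may be infinite, but
  \<open>Q(dg) = \<parallel>g\<parallel> \<Gamma>(f, dg)\<close> is finite by (R1), and the functions \<open>g\<close> with \<open>\<parallel>g\<parallel> = 0\<close>, which \<open>Q\<close>
  forgets, contribute nothing. On the set \<open>A\<close>, which carries \<open>\<Gamma>(f, dg)\<close>, the evaluation of \<open>g\<close> at random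
  points is jointly measurable, as Fubini requires.\<close>

lemma Phi_difference_Lr:
  assumes r: "r \<ge> 1" and z: "flow_on l \<zeta>" "flow_on l \<zeta>'"
    and close: "\<And>g. g \<in> Osc1 (S l) \<Longrightarrow> Lr_norm \<Omega> r (\<lambda>\<omega>. (\<integral>x. g x \<partial>\<zeta> p \<omega>) - (\<integral>x. g x \<partial>\<zeta>' p \<omega>)) \<le> D"
    and f: "f \<in> Osc_le (S (Suc l)) 1"
  shows "Lr_norm \<Omega> r (\<lambda>\<omega>. (\<integral>x. f x \<partial>\<Phi> (Suc l) (\<zeta> p \<omega>)) - (\<integral>x. f x \<partial>\<Phi> (Suc l) (\<zeta>' p \<omega>))) \<le> \<Lambda> (Suc l) * D"
proof -
  let ?T = "S (Suc l)" and ?U = "S l"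
  obtain m where m: "\<And>x. x \<in> space ?T \<Longrightarrow> \<bar>f x - m\<bar> \<le> 1 / 2"
    using Osc_le_midpoint[OF f S_nonempty] by blast
  define f' where "f' x = f x - m" for x
  have fB: "f \<in> Bdd ?T" by (rule Osc_leD(1)[OF f])
  have f'B: "f' \<in> Bdd ?T" unfolding f'_def[abs_def] by (rule Bdd_diff[OF fB Bdd_const])
  have f'n: "sup_norm ?T f' \<le> 1 / 2" unfolding f'_def[abs_def] by (rule sup_norm_least[OF S_nonempty m])
  have D0: "0 \<le> D"
  proof -
    have "(\<lambda>_. 0) \<in> Osc1 ?U" unfolding Osc1_eq[OF S_nonempty] by simp
    from order_trans[OF Lr_nonneg[OF r] close[OF this]] show ?thesis .
  qed
  note FK = R1_kernel[of l, unfolded function_kernel_def]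
  let ?\<Gamma> = "\<Gamma> (Suc l) f'"
  obtain A where A: "A \<in> sets (G l)" "emeasure ?\<Gamma> (space (G l) - A) = 0"
    and eval: "(\<lambda>(g, x). g x) \<in> borel_measurable (restrict_space (G l) A \<Otimes>\<^sub>M ?U)"
    using FK f'B by blast
  have setsG: "sets ?\<Gamma> = sets (G l)" and spG: "space (G l) = Bdd ?U"
    and normm: "sup_norm ?U \<in> borel_measurable (G l)" using FK f'B by auto
  have sp\<Gamma>: "space ?\<Gamma> = Bdd ?U" using sets_eq_imp_space_eq[OF setsG] spG by simp
  let ?R = "restrict_space ?\<Gamma> A"
  have spR: "space ?R = A" "A \<subseteq> Bdd ?U"
    using sets.sets_into_space[OF A(1)] spG sp\<Gamma> by (auto simp: space_restrict_space)
  have setsR: "sets ?R = sets (restrict_space (G l) A)" by (rule sets_restrict_space_cong[OF setsG])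
  define w where "w = sup_norm ?U"
  have wR: "w \<in> borel_measurable ?R" unfolding w_def
    using measurable_restrict_space1[OF normm] measurable_cong_sets[OF setsR refl] by blast
  define diff where "diff g \<omega> = (\<integral>x. g x \<partial>\<zeta> p \<omega>) - (\<integral>x. g x \<partial>\<zeta>' p \<omega>)" for g :: "'a \<Rightarrow> real" and \<omega>
  define h where "h g \<omega> = \<bar>diff g \<omega>\<bar> / w g" for g \<omega>
  define Q where "Q = density ?R (\<lambda>g. ennreal (w g))"
  have spQ: "space Q = A" and setsQ: "sets Q = sets (restrict_space (G l) A)"
    by (simp_all add: Q_def spR setsR)
  have w_abs: "\<bar>g x\<bar> \<le> w g" if "g \<in> A" "x \<in> space ?U" for g x
    unfolding w_def using that spR(2) by (intro sup_norm_upper) auto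
  have w0: "0 \<le> w g" if "g \<in> A" for g
    using w_abs[OF that] S_nonempty[of l] by (meson abs_ge_zero all_not_in_conv order_trans)
  have diff_le: "\<bar>diff g \<omega>\<bar> \<le> 2 * w g" if "g \<in> A" "\<omega> \<in> space \<Omega>" for g \<omega>
  proof -
    have "\<bar>\<integral>x. g x \<partial>\<zeta> p \<omega>\<bar> \<le> w g" "\<bar>\<integral>x. g x \<partial>\<zeta>' p \<omega>\<bar> \<le> w g"
      using that spR(2) by (auto intro!: Prob_integral_abs_le[OF flow_Prob] z w_abs)
    then show ?thesis unfolding diff_def by linarith
  qed
  have evalQ: "(\<lambda>(q, x). fst q x) \<in> borel_measurable ((Q \<Otimes>\<^sub>M \<Omega>) \<Otimes>\<^sub>M ?U)"
  proof -
    have "(\<lambda>q. (fst (fst q), snd q)) \<in> (Q \<Otimes>\<^sub>M \<Omega>) \<Otimes>\<^sub>M ?U \<rightarrow>\<^sub>M Q \<Otimes>\<^sub>M ?U" by measurable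
    moreover have "Q \<Otimes>\<^sub>M ?U \<rightarrow>\<^sub>M borel = restrict_space (G l) A \<Otimes>\<^sub>M ?U \<rightarrow>\<^sub>M (borel :: real measure)"
      by (intro measurable_cong_sets sets_pair_measure_cong setsQ refl)
    ultimately have "(\<lambda>q. case (fst (fst q), snd q) of (g, x) \<Rightarrow> g x) \<in> borel_measurable ((Q \<Otimes>\<^sub>M \<Omega>) \<Otimes>\<^sub>M ?U)"
      using measurable_compose eval by blast
    then show ?thesis by (simp add: split_beta')
  qed
  have int_meas: "(\<lambda>q. \<integral>x. fst q x \<partial>\<xi> p (snd q)) \<in> borel_measurable (Q \<Otimes>\<^sub>M \<Omega>)" if "flow_on l \<xi>" for \<xi>
    using that unfolding flow_on_def
    by (intro integral_kernel_measurable[OF evalQ] measurable_compose[OF measurable_snd]) blast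
  have hm: "(\<lambda>(g, \<omega>). h g \<omega>) \<in> borel_measurable (Q \<Otimes>\<^sub>M \<Omega>)"
  proof -
    have "w \<in> borel_measurable Q" using wR measurable_cong_sets[of Q ?R] setsQ setsR by blast
    from measurable_compose[OF measurable_fst this] int_meas[OF z(1)] int_meas[OF z(2)]
    show ?thesis unfolding h_def diff_def split_beta' by measurable
  qed
  have mass: "emeasure Q (space Q) \<le> ennreal (\<Lambda> (Suc l) / 2)"
  proof -
    have "emeasure Q (space Q) = (\<integral>\<^sup>+g. ennreal (w g) \<partial>?R)"
      unfolding Q_def using wR by (simp add: emeasure_density nn_integral_set_ennreal cong: nn_integral_cong)
    also have "\<dots> = (\<integral>\<^sup>+g. ennreal (w g) * indicator A g \<partial>?\<Gamma>)"
      using A(1) setsG by (intro nn_integral_restrict_space) auto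
    also have "\<dots> \<le> (\<integral>\<^sup>+g. ennreal (w g) \<partial>?\<Gamma>)"
      by (intro nn_integral_mono) (auto split: split_indicator)
    also have "\<dots> \<le> ennreal (\<Lambda> (Suc l) * sup_norm ?T f')" unfolding w_def by (rule R1_bound[OF f'B])
    also have "\<dots> \<le> ennreal (\<Lambda> (Suc l) / 2)"
      using mult_left_mono[OF f'n Lambda_nonneg[of l]] by (intro ennreal_leI) simp
    finally show ?thesis .
  qed
  have finQ: "finite_measure Q"
    using mass by (intro finite_measureI) (metis ennreal_less_top infinity_ennreal_def not_le top.extremum_unique)
  interpret Q: finite_measure Q by (rule finQ)
  have massQ: "measure Q (space Q) \<le> \<Lambda> (Suc l) / 2"
    using mass Lambda_nonneg[of l] by (simp add: Q.emeasure_eq_measure)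
  define Z where "Z \<omega> = (\<integral>x. f x \<partial>\<Phi> (Suc l) (\<zeta> p \<omega>)) - (\<integral>x. f x \<partial>\<Phi> (Suc l) (\<zeta>' p \<omega>))" for \<omega>
  have ZB: "Z \<in> Bdd \<Omega>"
    unfolding Z_def[abs_def] by (rule flow_difference_Bdd[OF flow_Phi[OF z(1)] flow_Phi[OF z(2)] fB])
  have Zh: "\<bar>Z \<omega>\<bar> \<le> (\<integral>g. h g \<omega> \<partial>Q)" if \<omega>: "\<omega> \<in> space \<Omega>" for \<omega>
  proof -
    note P = flow_Prob[OF z(1) \<omega>, of p] flow_Prob[OF z(2) \<omega>, of p]
    have h\<omega>: "(\<lambda>g. h g \<omega>) \<in> borel_measurable Q"
      using measurable_compose[OF measurable_Pair2'[OF \<omega>] hm] by simp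
    have hb: "0 \<le> h g \<omega>" "h g \<omega> \<le> 2" if "g \<in> A" for g
      using diff_le[OF that \<omega>] w0[OF that] by (auto simp: h_def divide_le_eq)
    have "Z \<omega> = (\<integral>x. f' x \<partial>\<Phi> (Suc l) (\<zeta> p \<omega>)) - (\<integral>x. f' x \<partial>\<Phi> (Suc l) (\<zeta>' p \<omega>))"
      unfolding Z_def f'_def using Prob_integral_minus_const[OF Phi_Prob[OF P(1)] fB]
        Prob_integral_minus_const[OF Phi_Prob[OF P(2)] fB] by simp
    then have "ennreal \<bar>Z \<omega>\<bar> \<le> (\<integral>\<^sup>+g. ennreal \<bar>diff g \<omega>\<bar> \<partial>?\<Gamma>)"
      using R1_Lipschitz[OF f'B P] by (simp add: diff_def)
    also have "\<dots> = (\<integral>\<^sup>+g. ennreal \<bar>diff g \<omega>\<bar> * indicator A g \<partial>?\<Gamma>)"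
    proof (rule nn_integral_cong_AE)
      have "AE g in ?\<Gamma>. g \<in> A"
      proof (rule AE_I[where N="space (G l) - A"])
        show "space (G l) - A \<in> sets ?\<Gamma>" using sets.compl_sets[OF A(1)] setsG by simp
      qed (use A sp\<Gamma> spG in auto)
      then show "AE g in ?\<Gamma>. ennreal \<bar>diff g \<omega>\<bar> = ennreal \<bar>diff g \<omega>\<bar> * indicator A g"
        by eventually_elim simp
    qed
    also have "\<dots> = (\<integral>\<^sup>+g. ennreal \<bar>diff g \<omega>\<bar> \<partial>?R)"
      using A(1) setsG by (intro nn_integral_restrict_space[symmetric]) auto
    also have "\<dots> = (\<integral>\<^sup>+g. ennreal (w g) * ennreal (h g \<omega>) \<partial>?R)"
    proof (rule nn_integral_cong)
      fix g assume "g \<in> space ?R"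
      then have g: "g \<in> A" using spR by simp
      have "\<bar>diff g \<omega>\<bar> = w g * h g \<omega>" using diff_le[OF g \<omega>] by (cases "w g = 0") (auto simp: h_def)
      then show "ennreal \<bar>diff g \<omega>\<bar> = ennreal (w g) * ennreal (h g \<omega>)"
        using w0[OF g] hb[OF g] by (simp add: ennreal_mult)
    qed
    also have "\<dots> = (\<integral>\<^sup>+g. ennreal (h g \<omega>) \<partial>Q)"
    proof -
      have "(\<lambda>g. h g \<omega>) \<in> borel_measurable ?R" using h\<omega> measurable_cong_sets[of Q ?R] setsQ setsR by blast
      then show ?thesis unfolding Q_def using wR by (intro nn_integral_density[symmetric]) auto
    qed
    also have "\<dots> = ennreal (\<integral>g. h g \<omega> \<partial>Q)"
      using hb h\<omega> by (intro nn_integral_eq_integral Q.integrable_const_bound[where B=2]) (auto simp: spQ)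
    finally have "ennreal \<bar>Z \<omega>\<bar> \<le> ennreal (\<integral>g. h g \<omega> \<partial>Q)" .
    moreover have "0 \<le> (\<integral>g. h g \<omega> \<partial>Q)" using hb by (intro integral_nonneg_AE AE_I2) (simp add: spQ)
    ultimately show ?thesis by (simp add: ennreal_le_iff)
  qed
  have "Lr_norm \<Omega> r Z \<le> measure Q (space Q) * (2 * D)"
  proof (rule Lr_integral_average[OF r finQ hm _ _ _ ZB Zh])
    show "0 \<le> h g \<omega> \<and> h g \<omega> \<le> 2" if "g \<in> space Q" "\<omega> \<in> space \<Omega>" for g \<omega>
      using diff_le[of g \<omega>] w0[of g] that by (auto simp: h_def divide_le_eq spQ)
    show "0 \<le> 2 * D" using D0 by simp
    fix g assume "g \<in> space Q"
    then have g: "g \<in> A" by (simp add: spQ)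
    then have gB: "g \<in> Bdd ?U" using spR by blast
    show "Lr_norm \<Omega> r (h g) \<le> 2 * D"
    proof (cases "w g = 0")
      case True
      then have "h g = (\<lambda>_. 0)" by (simp add: h_def fun_eq_iff)
      moreover have "Lr_norm \<Omega> r (\<lambda>_. 0) \<le> 0" by (rule Lr_bounded[OF r]) auto
      ultimately show ?thesis using D0 by simp
    next
      case False
      then have w: "w g > 0" using w0[OF g] by simp
      let ?g = "\<lambda>x. (1 / (2 * w g)) * g x"
      have "?g \<in> Osc_le ?U (\<bar>1 / (2 * w g)\<bar> * (2 * w g))"
        by (intro Osc_le_scale Osc_le_of_bound gB w_abs[OF g])
      then have "?g \<in> Osc1 ?U" using w Osc1_eq[OF S_nonempty] by simp
      from close[OF this] have "Lr_norm \<Omega> r (\<lambda>\<omega>. (1 / (2 * w g)) * diff g \<omega>) \<le> D"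
        unfolding diff_def by (simp add: diff_divide_distrib)
      moreover have "Lr_norm \<Omega> r (h g) = Lr_norm \<Omega> r (\<lambda>\<omega>. 2 * ((1 / (2 * w g)) * diff g \<omega>))"
        unfolding Lr_norm_def h_def using w by (simp add: abs_mult)
      moreover note Lr_scale[OF r, of 2 "\<lambda>\<omega>. (1 / (2 * w g)) * diff g \<omega>"]
      ultimately show ?thesis by linarith
    qed
  qed
  also have "\<dots> \<le> (\<Lambda> (Suc l) / 2) * (2 * D)" using massQ D0 by (intro mult_right_mono) auto
  finally show ?thesis unfolding Z_def by simp
qed

text \<open>The factor \<open>2\<close> in \<open>B\<close> comes from time averaging: \<open>(\<Sum>p\<le>n. 1 / \<surd>(p + 1)) / (n + 1) \<le> 2 / \<surd>(n + 1)\<close>.\<close>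

lemma close_push:
  assumes r: "r \<ge> 1" and z: "flow_on l \<zeta>" "flow_on l \<zeta>'" and close: "flows_close r l \<zeta> \<zeta>' D"
    and D: "0 \<le> D" and B: "2 * \<Lambda> (Suc l) \<le> B"
  shows "flows_close r (Suc l) (push l \<zeta>) (push l \<zeta>') (B * D)"
  unfolding flows_close_def
proof (intro allI ballI)
  fix n f assume "f \<in> Osc1 (S (Suc l))"
  then have f: "f \<in> Osc_le (S (Suc l)) 1" using Osc1_eq[OF S_nonempty] by blast
  have fB: "f \<in> Bdd (S (Suc l))" by (rule Osc_leD(1)[OF f])
  let ?q = "sqrt (real (n + 1))"
  let ?d = "\<lambda>p \<omega>. (\<integral>x. f x \<partial>\<Phi> (Suc l) (\<zeta> p \<omega>)) - (\<integral>x. f x \<partial>\<Phi> (Suc l) (\<zeta>' p \<omega>))"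
  have dB: "?d p \<in> Bdd \<Omega>" for p
    by (rule flow_difference_Bdd[OF flow_Phi[OF z(1)] flow_Phi[OF z(2)] fB])
  have d: "Lr_norm \<Omega> r (?d p) \<le> \<Lambda> (Suc l) * (D / sqrt (real (p + 1)))" for p
    using close by (intro Phi_difference_Lr[OF r z _ f]) (auto simp: flows_close_def)
  have "Lr_norm \<Omega> r (\<lambda>\<omega>. (\<integral>x. f x \<partial>push l \<zeta> n \<omega>) - (\<integral>x. f x \<partial>push l \<zeta>' n \<omega>))
      = Lr_norm \<Omega> r (\<lambda>\<omega>. (1 / real (n + 1)) * (\<Sum>p\<le>n. ?d p \<omega>))"
    by (rule Lr_cong[OF r]) (simp add: integral_push[OF z(1) fB] integral_push[OF z(2) fB] sum_subtractf diff_divide_distrib)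
  also have "\<dots> = (1 / real (n + 1)) * Lr_norm \<Omega> r (\<lambda>\<omega>. \<Sum>p\<le>n. ?d p \<omega>)"
    using Lr_scale[OF r, of "1 / real (n + 1)" "\<lambda>\<omega>. \<Sum>p\<le>n. ?d p \<omega>"] by simp
  also have "\<dots> \<le> (1 / real (n + 1)) * (\<Sum>p\<le>n. Lr_norm \<Omega> r (?d p))"
    by (intro mult_left_mono Lr_sum[OF r] dB) auto
  also have "\<dots> \<le> (1 / real (n + 1)) * (\<Sum>p\<le>n. \<Lambda> (Suc l) * (D / sqrt (real (p + 1))))"
    by (intro mult_left_mono sum_mono d) auto
  also have "\<dots> = (1 / real (n + 1)) * (\<Lambda> (Suc l) * D * (\<Sum>p\<le>n. 1 / sqrt (real (p + 1))))"
    by (simp add: sum_distrib_left)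
  also have "\<dots> \<le> (1 / real (n + 1)) * (\<Lambda> (Suc l) * D * (2 * ?q))"
    using D Lambda_nonneg[of l] by (intro mult_left_mono sum_inverse_sqrt_le) auto
  also have "\<dots> = 2 * \<Lambda> (Suc l) * D * (?q / real (n + 1))" by simp
  also have "?q / real (n + 1) = 1 / ?q" by (rule sqrt_divide_self_eq[unfolded inverse_eq_divide]) simp
  also have "2 * \<Lambda> (Suc l) * D * (1 / ?q) \<le> B * D / ?q"
    using mult_right_mono[OF B D] by (simp add: divide_right_mono)
  finally show "Lr_norm \<Omega> r (\<lambda>\<omega>. (\<integral>x. f x \<partial>push l \<zeta> n \<omega>) - (\<integral>x. f x \<partial>push l \<zeta>' n \<omega>)) \<le> B * D / ?q" .
qed

lemma flows_close_trans:
  assumes r: "r \<ge> 1" and z: "flow_on l \<zeta>1" "flow_on l \<zeta>2" "flow_on l \<zeta>3"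
    and 12: "flows_close r l \<zeta>1 \<zeta>2 C" and 23: "flows_close r l \<zeta>2 \<zeta>3 D"
  shows "flows_close r l \<zeta>1 \<zeta>3 (C + D)"
  unfolding flows_close_def
proof (intro allI ballI)
  fix n f assume f: "f \<in> Osc1 (S l)"
  then have fB: "f \<in> Bdd (S l)" by (simp add: Osc1_def)
  let ?d = "\<lambda>(\<zeta> :: nat \<Rightarrow> 'w \<Rightarrow> 'a measure) (\<zeta>' :: nat \<Rightarrow> 'w \<Rightarrow> 'a measure) \<omega>. (\<integral>x. f x \<partial>\<zeta> n \<omega>) - (\<integral>x. f x \<partial>\<zeta>' n \<omega>)"
  have "Lr_norm \<Omega> r (\<lambda>\<omega>. ?d \<zeta>1 \<zeta>2 \<omega> + ?d \<zeta>2 \<zeta>3 \<omega>) \<le> Lr_norm \<Omega> r (?d \<zeta>1 \<zeta>2) + Lr_norm \<Omega> r (?d \<zeta>2 \<zeta>3)"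
    by (rule Lr_add[OF r flow_difference_Bdd[OF z(1,2) fB] flow_difference_Bdd[OF z(2,3) fB]])
  also have "\<dots> \<le> C / sqrt (real (n + 1)) + D / sqrt (real (n + 1))"
    using 12 23 f unfolding flows_close_def by (intro add_mono) auto
  finally show "Lr_norm \<Omega> r (?d \<zeta>1 \<zeta>3) \<le> (C + D) / sqrt (real (n + 1))"
    by (simp add: add_divide_distrib)
qed

lemma level_constant_nonneg: "0 \<le> level_constant l"
  unfolding level_constant_def using c_nonneg[of l] by simp

text \<open>The empirical flow of level \<open>l\<close>, transported to level \<open>l + k\<close> by the time averaged semigroup.\<close>

definition evolved :: "nat \<Rightarrow> nat \<Rightarrow> nat \<Rightarrow> 'w \<Rightarrow> 'a measure" where
  "evolved l k n \<omega> = Phi_bar_comp S \<Phi> (l + k) (l + 1) (\<lambda>m. emp l m \<omega>) n"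

lemma evolved_Suc: "evolved l (Suc k) = push (l + k) (evolved l k)"
  unfolding evolved_def[abs_def] push_def[abs_def] Phi_bar_comp_Suc ..

lemma flow_evolved: "flow_on (l + k) (evolved l k)"
proof (induction k)
  case 0
  have "evolved l 0 = emp l" unfolding evolved_def[abs_def] using Phi_bar_comp_0[of S \<Phi> l] by simp
  then show ?case using flow_emp by simp
next
  case (Suc k)
  from flow_push[OF this] show ?case by (simp add: evolved_Suc)
qed

lemma Phi_bar_comp_pi: "Phi_bar_comp S \<Phi> (l + k) (l + 1) (\<lambda>_. \<pi> l) = (\<lambda>_. \<pi> (l + k))"
proof (induction k)
  case 0
  show ?case using Phi_bar_comp_0[of S \<Phi> l] by simp
next
  case (Suc k)
  have "Phi_bar S \<Phi> (Suc (l + k)) (\<lambda>_. \<pi> (l + k)) = (\<lambda>_. \<pi> (Suc (l + k)))"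
    unfolding Phi_bar_def pi_Suc using Phi_Prob[OF pi_Prob] by (simp add: avg_measure_const)
  then show ?case unfolding Phi_bar_comp_Suc Suc.IH by simp
qed

context
  fixes r A B :: real
  assumes r: "r \<ge> 1" and A: "\<And>l. level_constant l \<le> A" and B: "\<And>l. 2 * \<Lambda> (Suc l) \<le> B"
begin

lemma A_nonneg: "0 \<le> A"
  using A[of 0] level_constant_nonneg[of 0] by linarith

lemma B_nonneg: "0 \<le> B"
  using B[of 0] Lambda_nonneg[of 0] by linarith

lemma close_emp_push_uniform:
  "flows_close r (Suc l) (emp (Suc l)) (push l (emp l)) ((4 * r + 10) * A)"
  unfolding flows_close_def
proof (intro allI ballI)
  fix n f assume "f \<in> Osc1 (S (Suc l))"
  then have "Lr_norm \<Omega> r (\<lambda>\<omega>. (\<integral>x. f x \<partial>emp (Suc l) n \<omega>) - (\<integral>x. f x \<partial>push l (emp l) n \<omega>))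
      \<le> (4 * r + 10) * level_constant (Suc l) / sqrt (real (n + 1))"
    using close_emp_push[OF r, of l] unfolding flows_close_def by blast
  also have "\<dots> \<le> (4 * r + 10) * A / sqrt (real (n + 1))"
    using A r by (intro divide_right_mono mult_left_mono) auto
  finally show "Lr_norm \<Omega> r (\<lambda>\<omega>. (\<integral>x. f x \<partial>emp (Suc l) n \<omega>) - (\<integral>x. f x \<partial>push l (emp l) n \<omega>))
      \<le> (4 * r + 10) * A / sqrt (real (n + 1))" .
qed

text \<open>The recursion behind the geometric sum: each level adds the same error of its own and
  multiplies the inherited one by \<open>B\<close>.\<close>

lemma close_iterate:
  assumes "flow_on l \<zeta>" "flows_close r l (emp l) \<zeta> ((4 * r + 10) * A * s)" "0 \<le> s"
  shows "flows_close r (Suc l) (emp (Suc l)) (push l \<zeta>) ((4 * r + 10) * A * (1 + B * s))"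
proof -
  have "flows_close r (Suc l) (push l (emp l)) (push l \<zeta>) (B * ((4 * r + 10) * A * s))"
    using assms A_nonneg r by (intro close_push[OF r flow_emp assms(1,2) _ B]) auto
  from flows_close_trans[OF r flow_emp flow_push[OF flow_emp] flow_push[OF assms(1)] close_emp_push_uniform this]
  show ?thesis by (simp add: algebra_simps)
qed

lemma geometric_Suc: "(\<Sum>j<Suc k. B ^ j) = 1 + B * (\<Sum>j<k. B ^ j)"
  by (simp add: sum.lessThan_Suc_shift sum_distrib_left del: sum.lessThan_Suc)

lemma close_emp_evolved:
  "flows_close r (l + k) (emp (l + k)) (evolved l k) ((4 * r + 10) * A * (\<Sum>j<k. B ^ j))"
proof (induction k)
  case 0
  have "evolved l 0 = emp l" unfolding evolved_def[abs_def] using Phi_bar_comp_0[of S \<Phi> l] by simp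
  then show ?case using Lr_bounded[OF r, of "\<lambda>_. 0" 0] by (simp add: flows_close_def)
next
  case (Suc k)
  have "0 \<le> (\<Sum>j<k. B ^ j)" using B_nonneg by (intro sum_nonneg) auto
  from close_iterate[OF flow_evolved Suc this] show ?case by (simp only: evolved_Suc geometric_Suc add_Suc_right)
qed

lemma close_emp_pi:
  "flows_close r l (emp l) (\<lambda>_ _. \<pi> l) ((4 * r + 10) * A * (\<Sum>j<Suc l. B ^ j))"
proof (induction l)
  case 0
  show ?case unfolding flows_close_def
  proof (intro allI ballI)
    fix n f assume "f \<in> Osc1 (S 0)"
    then have "Lr_norm \<Omega> r (\<lambda>\<omega>. (\<integral>x. f x \<partial>emp 0 n \<omega>) - (\<integral>x. f x \<partial>\<pi> 0))
        \<le> (4 * r + 10) * level_constant 0 / sqrt (real (n + 1))"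
      using close_emp_0[OF r] unfolding flows_close_def by blast
    also have "\<dots> \<le> (4 * r + 10) * A / sqrt (real (n + 1))"
      using A r by (intro divide_right_mono mult_left_mono) auto
    finally show "Lr_norm \<Omega> r (\<lambda>\<omega>. (\<integral>x. f x \<partial>emp 0 n \<omega>) - (\<integral>x. f x \<partial>\<pi> 0))
        \<le> (4 * r + 10) * A * (\<Sum>j<Suc 0. B ^ j) / sqrt (real (n + 1))" by simp
  qed
next
  case (Suc l)
  have "push l (\<lambda>_ _. \<pi> l) = (\<lambda>_ _. \<pi> (Suc l))"
    unfolding push_def[abs_def] Phi_bar_def pi_Suc using Phi_Prob[OF pi_Prob] by (simp add: avg_measure_const)
  moreover have "0 \<le> (\<Sum>j<Suc l. B ^ j)" using B_nonneg by (intro sum_nonneg) auto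
  ultimately show ?case using close_iterate[OF flow_const Suc] by (simp only: geometric_Suc[of "Suc l"])
qed

text \<open>For \<open>l \<ge> k\<close> the error is built up over the last \<open>k\<close> levels only, and the semigroup forgets the
  level \<open>l - k\<close> where this starts. For \<open>l < k\<close> the errors of all levels from \<open>0\<close> on are added.\<close>

lemma uniform_error:
  fixes k0 :: int and lam1 lam2 :: real
  assumes forget: "\<And>l \<eta> \<mu> (k :: nat). (\<forall>n. \<eta> n \<in> Prob (S l)) \<Longrightarrow> (\<forall>n. \<mu> n \<in> Prob (S l)) \<Longrightarrow> int k \<ge> k0 \<Longrightarrow>
         flow_dist (S (l + k)) (Phi_bar_comp S \<Phi> (l + k) (l + 1) \<eta>) (Phi_bar_comp S \<Phi> (l + k) (l + 1) \<mu>)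
           \<le> lam1 * exp (- lam2 * real k)"
    and lam1: "lam1 > 0" and k: "int k \<ge> k0" and f: "f \<in> Osc1 (S l)"
  shows "Lr_norm \<Omega> r (\<lambda>\<omega>. (\<integral>x. f x \<partial>emp l n \<omega>) - (\<integral>x. f x \<partial>\<pi> l))
    \<le> (4 * r + 10) * A * (\<Sum>j<k. B ^ j) / sqrt (real (n + 1)) + lam1 * exp (- lam2 * real k)"
proof (cases "l < k")
  case True
  have "Lr_norm \<Omega> r (\<lambda>\<omega>. (\<integral>x. f x \<partial>emp l n \<omega>) - (\<integral>x. f x \<partial>\<pi> l))
      \<le> (4 * r + 10) * A * (\<Sum>j<Suc l. B ^ j) / sqrt (real (n + 1))"
    using close_emp_pi f unfolding flows_close_def by blast
  also have "(\<Sum>j<Suc l. B ^ j) \<le> (\<Sum>j<k. B ^ j)" using True B_nonneg by (intro sum_mono2) auto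
  then have "(4 * r + 10) * A * (\<Sum>j<Suc l. B ^ j) / sqrt (real (n + 1)) \<le> (4 * r + 10) * A * (\<Sum>j<k. B ^ j) / sqrt (real (n + 1))"
    using A_nonneg r by (intro divide_right_mono mult_left_mono) auto
  also have "\<dots> \<le> (4 * r + 10) * A * (\<Sum>j<k. B ^ j) / sqrt (real (n + 1)) + lam1 * exp (- lam2 * real k)"
    using lam1 by simp
  finally show ?thesis .
next
  case False
  define i where "i = l - k"
  have l: "l = i + k" using False by (simp add: i_def)
  have f': "f \<in> Osc1 (S (i + k))" and fB: "f \<in> Bdd (S (i + k))" using f by (auto simp: l Osc1_def)
  let ?d1 = "\<lambda>\<omega>. (\<integral>x. f x \<partial>emp (i + k) n \<omega>) - (\<integral>x. f x \<partial>evolved i k n \<omega>)"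
  let ?d2 = "\<lambda>\<omega>. (\<integral>x. f x \<partial>evolved i k n \<omega>) - (\<integral>x. f x \<partial>\<pi> (i + k))"
  have d1B: "?d1 \<in> Bdd \<Omega>" by (rule flow_difference_Bdd[OF flow_emp flow_evolved fB])
  have d2B: "?d2 \<in> Bdd \<Omega>" using flow_difference_Bdd[OF flow_evolved flow_const fB] .
  have d1: "Lr_norm \<Omega> r ?d1 \<le> (4 * r + 10) * A * (\<Sum>j<k. B ^ j) / sqrt (real (n + 1))"
    using close_emp_evolved f' unfolding flows_close_def by blast
  have d2: "Lr_norm \<Omega> r ?d2 \<le> lam1 * exp (- lam2 * real k)"
  proof (rule Lr_bounded[OF r d2B])
    show "0 \<le> lam1 * exp (- lam2 * real k)" using lam1 by simp
    fix \<omega> assume w: "\<omega> \<in> space \<Omega>"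
    have P: "evolved i k m \<omega> \<in> Prob (S (i + k))" for m by (rule flow_Prob[OF flow_evolved w])
    have "\<bar>?d2 \<omega>\<bar> \<le> tv_dist (S (i + k)) (evolved i k n \<omega>) (\<pi> (i + k))"
      by (rule tv_dist_Osc1[OF P pi_Prob f'])
    also have "\<dots> \<le> flow_dist (S (i + k)) (\<lambda>m. evolved i k m \<omega>) (\<lambda>_. \<pi> (i + k))"
      using flow_dist_upper[of "\<lambda>m. evolved i k m \<omega>" "S (i + k)" "\<lambda>_. \<pi> (i + k)" n] P pi_Prob by blast
    also have "\<dots> = flow_dist (S (i + k)) (Phi_bar_comp S \<Phi> (i + k) (i + 1) (\<lambda>m. emp i m \<omega>)) (Phi_bar_comp S \<Phi> (i + k) (i + 1) (\<lambda>_. \<pi> i))"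
      unfolding Phi_bar_comp_pi evolved_def ..
    also have "\<dots> \<le> lam1 * exp (- lam2 * real k)"
      using flow_Prob[OF flow_emp w] pi_Prob k by (intro forget) auto
    finally show "\<bar>?d2 \<omega>\<bar> \<le> lam1 * exp (- lam2 * real k)" .
  qed
  have "Lr_norm \<Omega> r (\<lambda>\<omega>. ?d1 \<omega> + ?d2 \<omega>) \<le> Lr_norm \<Omega> r ?d1 + Lr_norm \<Omega> r ?d2"
    by (rule Lr_add[OF r d1B d2B])
  with d1 d2 show ?thesis by (simp add: l)
qed

end

end

section \<open>Choice of the number of levels\<close>

text \<open>The choice \<open>k \<approx> ln x / (2 \<kappa>)\<close>, with \<open>\<kappa> = \<lambda>\<^sub>2 + ln B\<close> and \<open>x = n + 1\<close>, balances the two error terms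
  \<open>B\<^sup>k / \<surd>x\<close> and \<open>exp (- \<lambda>\<^sub>2 k)\<close>; the lower bound on \<open>x\<close> is what makes this \<open>k\<close> at least \<open>k0\<close>.\<close>

lemma truncation_level:
  fixes x \<kappa> :: real and k0 :: int
  assumes "x \<ge> 1" "\<kappa> > 0" "x \<ge> exp (2 * \<kappa> * (real_of_int k0 + 1))"
  obtains k :: nat where "int k \<ge> k0" "real k \<le> ln x / (2 * \<kappa>)" "ln x / (2 * \<kappa>) < real k + 1"
proof -
  let ?y = "ln x / (2 * \<kappa>)"
  have y0: "0 \<le> ?y" using assms by simp
  have "2 * \<kappa> * (real_of_int k0 + 1) \<le> ln x" using assms by (simp add: ln_ge_iff)
  then have "real_of_int k0 + 1 \<le> ?y" using assms by (simp add: le_divide_eq mult_ac)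
  then have "k0 \<le> \<lfloor>?y\<rfloor>" by linarith
  then show ?thesis using y0 by (intro that[of "nat \<lfloor>?y\<rfloor>"]) linarith+
qed

lemma exp_level_le:
  fixes x \<kappa> :: real
  assumes "x \<ge> 1" "\<kappa> > 0" "\<beta> > 0" "ln x / (2 * \<kappa>) < real k + 1"
  shows "exp (- \<beta> * real k) \<le> exp \<beta> / x powr ((\<beta> / \<kappa>) / 2)"
proof -
  have "\<beta> * (ln x / (2 * \<kappa>)) \<le> \<beta> * (real k + 1)" using assms by (intro mult_left_mono) auto
  then have "- \<beta> * real k \<le> \<beta> - \<beta> / \<kappa> / 2 * ln x" by (simp add: algebra_simps)
  then have "exp (- \<beta> * real k) \<le> exp (\<beta> - \<beta> / \<kappa> / 2 * ln x)" by simp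
  also have "\<dots> = exp \<beta> / x powr ((\<beta> / \<kappa>) / 2)" using assms by (simp add: exp_diff powr_def)
  finally show ?thesis .
qed

lemma error_bound_B_eq_1:
  fixes x A E lam1 lam2 :: real
  assumes "x \<ge> 1" "lam1 > 0" "lam2 > 0" "A \<ge> 0" "E \<ge> 1"
    and k: "real k \<le> ln x / (2 * lam2)" "ln x / (2 * lam2) < real k + 1"
  shows "E * A * (\<Sum>j<k. 1 ^ j) / sqrt x + lam1 * exp (- lam2 * real k)
    \<le> E / sqrt x * (A * (1 + ln x / (2 * lam2)) + lam1 * exp lam2)"
proof -
  have "E * A * real k / sqrt x \<le> E * A * (1 + ln x / (2 * lam2)) / sqrt x"
    using assms by (intro divide_right_mono mult_left_mono) auto
  moreover have "lam1 * exp (- lam2 * real k) \<le> 1 * (lam1 * exp lam2 / sqrt x)"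
    using exp_level_le[OF assms(1,3,3) k(2)] assms by (simp add: powr_half_sqrt mult_left_mono flip: times_divide_eq_right)
  moreover have "1 * (lam1 * exp lam2 / sqrt x) \<le> E * (lam1 * exp lam2 / sqrt x)"
    using assms by (intro mult_right_mono) auto
  moreover have "E / sqrt x * (A * (1 + ln x / (2 * lam2)) + lam1 * exp lam2)
      = E * A * (1 + ln x / (2 * lam2)) / sqrt x + E * (lam1 * exp lam2 / sqrt x)"
  proof -
    have "E / q * (A * t + v) = E * A * t / q + E * (v / q)" for q t v :: real by (simp add: distrib_left)
    then show ?thesis .
  qed
  moreover have "(\<Sum>j<k. 1 ^ j) = real k" by simp
  ultimately show ?thesis by (simp only:)
qed

lemma error_bound_B_gt_1:
  fixes x A B E lam1 lam2 :: real
  assumes "x \<ge> 1" "lam1 > 0" "lam2 > 0" "A \<ge> 0" "E \<ge> 1" "B > 1"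
    and k: "real k \<le> ln x / (2 * (lam2 + ln B))" "ln x / (2 * (lam2 + ln B)) < real k + 1"
  shows "E * A * (\<Sum>j<k. B ^ j) / sqrt x + lam1 * exp (- lam2 * real k)
    \<le> E * (A * B / (B - 1) + lam1) * (exp lam2 / x powr ((lam2 / (lam2 + ln B)) / 2))"
proof -
  define \<kappa> where "\<kappa> = lam2 + ln B"
  have lB: "ln B > 0" using assms by simp
  have \<kappa>: "\<kappa> > 0" unfolding \<kappa>_def using lB assms(3) by (rule add_pos_pos[rotated])
  let ?a = "x powr ((lam2 / \<kappa>) / 2)"
  have a: "?a > 0" using assms by simp
  have "B ^ k = exp (real k * ln B)" using assms by (simp add: exp_of_nat_mult)
  also have "\<dots> \<le> exp (ln x / (2 * \<kappa>) * ln B)" 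
    using mult_right_mono[OF k(1), of "ln B"] lB by (simp only: \<kappa>_def exp_le_cancel_iff less_imp_le)
  also have "ln x / (2 * \<kappa>) * ln B = ln x / 2 - (lam2 / \<kappa>) / 2 * ln x"
  proof -
    have "ln B = \<kappa> - lam2" by (simp add: \<kappa>_def)
    moreover have "L / (2 * \<kappa>) * (\<kappa> - m) = L / 2 - (m / \<kappa>) / 2 * L" for L m
      using \<kappa> by (simp add: field_simps)
    ultimately show ?thesis by simp
  qed
  also have "exp \<dots> = sqrt x / ?a"
    using assms by (simp add: exp_diff powr_def powr_half_sqrt[symmetric])
  finally have Bk: "B ^ k \<le> sqrt x / ?a" .
  have "(\<Sum>j<k. B ^ j) = (B ^ k - 1) / (B - 1)" using assms by (simp add: geometric_sum)
  also have "\<dots> \<le> sqrt x / ?a / (B - 1)" using Bk assms by (intro divide_right_mono) auto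
  finally have "E * A * (\<Sum>j<k. B ^ j) / sqrt x \<le> E * A * (sqrt x / ?a / (B - 1)) / sqrt x"
    using assms by (intro divide_right_mono mult_left_mono) auto
  also have "\<dots> = E * (A / (B - 1)) * (1 / ?a)" using assms by simp
  also have "\<dots> \<le> E * (A * B / (B - 1)) * (exp lam2 / ?a)"
  proof (intro mult_mono)
    show "1 / ?a \<le> exp lam2 / ?a" using assms a by (intro divide_right_mono) auto
    show "A / (B - 1) \<le> A * B / (B - 1)"
      using assms mult_left_mono[of 1 B A] by (intro divide_right_mono) auto
  qed (use assms a in auto)
  finally have 1: "E * A * (\<Sum>j<k. B ^ j) / sqrt x \<le> E * (A * B / (B - 1)) * (exp lam2 / ?a)" .
  have "lam1 * exp (- lam2 * real k) \<le> lam1 * (exp lam2 / ?a)"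
    using exp_level_le[OF assms(1) \<kappa> assms(3) k(2)[folded \<kappa>_def]] assms by (intro mult_left_mono) auto
  also have "\<dots> \<le> E * lam1 * (exp lam2 / ?a)"
    using assms a by (intro mult_right_mono) auto
  finally have "lam1 * exp (- lam2 * real k) \<le> E * lam1 * (exp lam2 / ?a)" .
  with 1 have "E * A * (\<Sum>j<k. B ^ j) / sqrt x + lam1 * exp (- lam2 * real k)
      \<le> E * (A * B / (B - 1)) * (exp lam2 / ?a) + E * lam1 * (exp lam2 / ?a)" by (rule add_mono)
  also have "\<dots> = E * (A * B / (B - 1) + lam1) * (exp lam2 / ?a)" by (simp add: algebra_simps)
  finally show ?thesis unfolding \<kappa>_def .
qed

theorem theorem5p3:
  fixes r :: real
  assumes "r \<ge> 1"
  shows "\<exists>e :: real.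
    \<forall>(\<Omega> :: 'w measure) (S :: nat \<Rightarrow> 'a measure) \<pi> \<Phi> M0 M \<nu> X G \<Gamma> \<Lambda> nn c
      (lam1 :: real) (lam2 :: real) (k0 :: int) (A :: real) (B :: real).
      regular_interacting_mcmc \<Omega> S \<pi> \<Phi> M0 M \<nu> X G \<Gamma> \<Lambda> nn c \<longrightarrow>
      lam1 > 0 \<longrightarrow> lam2 > 0 \<longrightarrow>
      (\<forall>l \<eta> \<mu> (k :: nat). (\<forall>n. \<eta> n \<in> Prob (S l)) \<longrightarrow> (\<forall>n. \<mu> n \<in> Prob (S l)) \<longrightarrow> int k \<ge> k0 \<longrightarrow>
         flow_dist (S (l + k)) (Phi_bar_comp S \<Phi> (l + k) (l + 1) \<eta>) (Phi_bar_comp S \<Phi> (l + k) (l + 1) \<mu>)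
           \<le> lam1 * exp (- lam2 * real k)) \<longrightarrow>
      bdd_above (range (\<lambda>k. (1 + c k) * (real (nn k) / (1 - b_coeff S M k (nn k)))\<^sup>2)) \<longrightarrow>
      A = (SUP k. (1 + c k) * (real (nn k) / (1 - b_coeff S M k (nn k)))\<^sup>2) \<longrightarrow>
      bdd_above (\<Lambda> ` {1..}) \<longrightarrow>
      B = 2 * (SUP k\<in>{1..}. \<Lambda> k) \<longrightarrow>
      (B = 1 \<longrightarrow>
        (\<forall>(n :: nat) f. real (n + 1) \<ge> exp (2 * lam2 * (real_of_int k0 + 1)) \<longrightarrow>
          (\<forall>l. f l \<in> Osc1 (S l)) \<longrightarrow>
          (SUP l. ereal (Lr_norm \<Omega> r (\<lambda>\<omega>.
              (\<integral>x. f l x \<partial>empirical (S l) (\<lambda>p. X l p \<omega>) n) - (\<integral>x. f l x \<partial>\<pi> l))))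
          \<le> ereal (e / sqrt (real (n + 1)) *
              (A * (1 + ln (real (n + 1)) / (2 * lam2)) + lam1 * exp lam2)))) \<and>
      (B > 1 \<longrightarrow>
        (\<forall>(n :: nat) f. real (n + 1) \<ge> exp (2 * (lam2 + ln B) * (real_of_int k0 + 1)) \<longrightarrow>
          (\<forall>l. f l \<in> Osc1 (S l)) \<longrightarrow>
          (SUP l. ereal (Lr_norm \<Omega> r (\<lambda>\<omega>.
              (\<integral>x. f l x \<partial>empirical (S l) (\<lambda>p. X l p \<omega>) n) - (\<integral>x. f l x \<partial>\<pi> l))))
          \<le> ereal (e * (A * B / (B - 1) + lam1) *
              (exp lam2 / real (n + 1) powr ((lam2 / (lam2 + ln B)) / 2)))))"
proof -
  note r = assms
  show ?thesis
  proof (rule exI[of _ "4 * r + 10"], intro allI impI)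
    fix \<Omega> :: "'w measure" and S :: "nat \<Rightarrow> 'a measure" and \<pi> \<Phi> M0 M \<nu> X G \<Gamma> \<Lambda> nn c
      and lam1 lam2 :: real and k0 :: int and A B :: real
    assume R: "regular_interacting_mcmc \<Omega> S \<pi> \<Phi> M0 M \<nu> X G \<Gamma> \<Lambda> nn c"
      and lam1: "lam1 > 0" and lam2: "lam2 > 0"
      and forget: "\<forall>l \<eta> \<mu> (k :: nat). (\<forall>n. \<eta> n \<in> Prob (S l)) \<longrightarrow> (\<forall>n. \<mu> n \<in> Prob (S l)) \<longrightarrow> int k \<ge> k0 \<longrightarrow>
         flow_dist (S (l + k)) (Phi_bar_comp S \<Phi> (l + k) (l + 1) \<eta>) (Phi_bar_comp S \<Phi> (l + k) (l + 1) \<mu>)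
           \<le> lam1 * exp (- lam2 * real k)"
      and bdA: "bdd_above (range (\<lambda>k. (1 + c k) * (real (nn k) / (1 - b_coeff S M k (nn k)))\<^sup>2))"
      and A: "A = (SUP k. (1 + c k) * (real (nn k) / (1 - b_coeff S M k (nn k)))\<^sup>2)"
      and bdB: "bdd_above (\<Lambda> ` {1..})" and B: "B = 2 * (SUP k\<in>{1..}. \<Lambda> k)"
    interpret regular_interacting_mcmc \<Omega> S \<pi> \<Phi> M0 M \<nu> X G \<Gamma> \<Lambda> nn c by (rule R)
    have lA: "level_constant l \<le> A" for l
      unfolding level_constant_def A by (rule cSUP_upper[OF UNIV_I bdA])
    have lB: "2 * \<Lambda> (Suc l) \<le> B" for l
      unfolding B using cSUP_upper[OF _ bdB, of "Suc l"] by simp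
    have A0: "0 \<le> A" using A_nonneg[OF r lA lB] .
    have err: "Lr_norm \<Omega> r (\<lambda>\<omega>. (\<integral>x. f x \<partial>emp l n \<omega>) - (\<integral>x. f x \<partial>\<pi> l))
        \<le> (4 * r + 10) * A * (\<Sum>j<k. B ^ j) / sqrt (real (n + 1)) + lam1 * exp (- lam2 * real k)"
      if "int k \<ge> k0" "f \<in> Osc1 (S l)" for k l n f
      using that by (intro uniform_error[OF r lA lB _ lam1]) (use forget in blast)+
    show "(B = 1 \<longrightarrow>
        (\<forall>(n :: nat) f. real (n + 1) \<ge> exp (2 * lam2 * (real_of_int k0 + 1)) \<longrightarrow>
          (\<forall>l. f l \<in> Osc1 (S l)) \<longrightarrow>
          (SUP l. ereal (Lr_norm \<Omega> r (\<lambda>\<omega>.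
              (\<integral>x. f l x \<partial>empirical (S l) (\<lambda>p. X l p \<omega>) n) - (\<integral>x. f l x \<partial>\<pi> l))))
          \<le> ereal ((4 * r + 10) / sqrt (real (n + 1)) *
              (A * (1 + ln (real (n + 1)) / (2 * lam2)) + lam1 * exp lam2)))) \<and>
      (B > 1 \<longrightarrow>
        (\<forall>(n :: nat) f. real (n + 1) \<ge> exp (2 * (lam2 + ln B) * (real_of_int k0 + 1)) \<longrightarrow>
          (\<forall>l. f l \<in> Osc1 (S l)) \<longrightarrow>
          (SUP l. ereal (Lr_norm \<Omega> r (\<lambda>\<omega>.
              (\<integral>x. f l x \<partial>empirical (S l) (\<lambda>p. X l p \<omega>) n) - (\<integral>x. f l x \<partial>\<pi> l))))
          \<le> ereal ((4 * r + 10) * (A * B / (B - 1) + lam1) *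
              (exp lam2 / real (n + 1) powr ((lam2 / (lam2 + ln B)) / 2)))))"
    proof (intro conjI impI allI SUP_least ereal_less_eq(3)[THEN iffD2])
      fix n f l
      assume B1: "B = 1" and n: "real (n + 1) \<ge> exp (2 * lam2 * (real_of_int k0 + 1))"
        and f: "\<forall>l. f l \<in> Osc1 (S l)"
      have x: "real (n + 1) \<ge> 1" by simp
      obtain k :: nat where k: "int k \<ge> k0" "real k \<le> ln (real (n + 1)) / (2 * lam2)" "ln (real (n + 1)) / (2 * lam2) < real k + 1"
        by (rule truncation_level[OF x lam2 n])
      show "Lr_norm \<Omega> r (\<lambda>\<omega>. (\<integral>x. f l x \<partial>emp l n \<omega>) - (\<integral>x. f l x \<partial>\<pi> l))
          \<le> (4 * r + 10) / sqrt (real (n + 1)) * (A * (1 + ln (real (n + 1)) / (2 * lam2)) + lam1 * exp lam2)"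
        using err[OF k(1) f[rule_format], of l n] error_bound_B_eq_1[OF x lam1 lam2 A0 _ k(2,3), of "4 * r + 10"] r
        unfolding B1 by linarith
    next
      fix n f l
      assume B1: "B > 1" and n: "real (n + 1) \<ge> exp (2 * (lam2 + ln B) * (real_of_int k0 + 1))"
        and f: "\<forall>l. f l \<in> Osc1 (S l)"
      have x: "real (n + 1) \<ge> 1" by simp
      have \<kappa>: "lam2 + ln B > 0" using lam2 B1 by (simp add: add_pos_pos)
      obtain k :: nat where k: "int k \<ge> k0" "real k \<le> ln (real (n + 1)) / (2 * (lam2 + ln B))"
        "ln (real (n + 1)) / (2 * (lam2 + ln B)) < real k + 1"
        by (rule truncation_level[OF x \<kappa> n])
      show "Lr_norm \<Omega> r (\<lambda>\<omega>. (\<integral>x. f l x \<partial>emp l n \<omega>) - (\<integral>x. f l x \<partial>\<pi> l))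
          \<le> (4 * r + 10) * (A * B / (B - 1) + lam1) * (exp lam2 / real (n + 1) powr ((lam2 / (lam2 + ln B)) / 2))"
        using err[OF k(1) f[rule_format], of l n] error_bound_B_gt_1[OF x lam1 lam2 A0 _ B1 k(2,3), of "4 * r + 10"] r
        by linarith
    qed
  qed
qed

end
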